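(* Let $d\ge1$, $\alpha\in(-\tfrac12,\infty)^d$ and $1\le\lambda<\beta$. Then: (i) The Laguerre fractional derivative $D_\lambda^\alpha$ of order $\lambda$ is bounded from $Lip_\beta(\mu_\alpha)$ into $Lip_{\beta-\lambda}(\mu_\alpha)$. (ii) The Bessel Laguerre fractional derivative $\mathcal{D}_\lambda^\alpha$ of order $\lambda$ is bounded from $Lip_\beta(\mu_\alpha)$ into $Lip_{\beta-\lambda}(\mu_\alpha)$. Here, an operator $S$ is bounded from $Lip_\beta(\mu_\alpha)$ into $Lip_{\beta-\lambda}(\mu_\alpha)$ if there is a constant $C$ such that $Sf\in Lip_{\beta-\lambda}(\mu_\alpha)$ and $\|Sf\|_{Lip_{\beta-\lambda}(\mu_\alpha)}\le C\|f\|_{Lip_\beta(\mu_\alpha)}$ for all $f\in Lip_\beta(\mu_\alpha)$.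
   Context: Let $\mathbb{R}_+^d=(0,\infty)^d$ and, for $\alpha=(\alpha_1,\dots,\alpha_d)\in(-1,\infty)^d$, let $\mathrm{d}\mu_\alpha(x)=\prod_{i=1}^d\frac{x_i^{\alpha_i}e^{-x_i}}{\Gamma(\alpha_i+1)}\,\mathrm{d}x$ be the Laguerre measure on $\mathbb{R}_+^d$. The Laguerre operator $\mathcal{L}^\alpha=-\sum_{i=1}^d\big[x_i\partial_{x_i}^2+(\alpha_i+1-x_i)\partial_{x_i}\big]$ is positive and self-adjoint (after closure) in $L^2(\mathbb{R}_+^d,\mathrm{d}\mu_\alpha)$. Laguerre semigroup: $T_t^\alpha=e^{-t\mathcal{L}^\alpha}$, given for $t>0$ by $T_t^\alpha f(x)=\int_{\mathbb{R}_+^d}G_t^\alpha(x,y)f(y)\,\mathrm{d}\mu_\alpha(y)$ with $$G_t^\alpha(x,y)=\prod_{j=1}^d\frac{\Gamma(\alpha_j+1)}{1-e^{-t}}\,e^{-\frac{e^{-t}}{1-e^{-t}}(x_j+y_j)}\big(\sqrt{e^{-t}x_jy_j}\big)^{-\alpha_j}I_{\alpha_j}\Big(\frac{2\sqrt{e^{-t}x_jy_j}}{1-e^{-t}}\Big),$$ where $I_\nu$ is the modified Bessel function of the first kind of order $\nu$. Poisson-Laguerre semigroup: $P_t^\alpha=e^{-t\sqrt{\mathcal{L}^\alpha}}$, given for $t>0$ by $$P_t^\alpha f(x)=\int_0^\infty T_s^\alpha f(x)\,\frac{t}{2\sqrt\pi}\,\frac{e^{-t^2/(4s)}}{s^{3/2}}\,\mathrm{d}s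 .$$ Laguerre Lipschitz space: for $\beta>0$ let $n$ be the smallest integer greater than $\beta$. A function $f\in L^\infty(\mathbb{R}_+^d)$ belongs to $Lip_\beta(\mu_\alpha)$ if there is a constant $A_\beta(f)$ with $\big\|\frac{\partial^nP_t^\alpha f}{\partial t^n}\big\|_\infty\le A_\beta(f)t^{-n+\beta}$ for all $t>0$. The norm is $\|f\|_{Lip_\beta(\mu_\alpha)}=\|f\|_\infty+A_\beta(f)$, with $A_\beta(f)$ the smallest such constant. Fractional derivatives: formally $D_\lambda^\alpha=(\mathcal{L}^\alpha)^{\lambda/2}$ and $\mathcal{D}_\lambda^\alpha=(I+\sqrt{\mathcal{L}^\alpha})^\lambda$. For $\lambda\ge1$, let $k$ be the smallest integer with $\lambda<k$ and set $c_\lambda^k=\int_0^\infty u^{-\lambda-1}(e^{-u}-1)^k\,\mathrm{d}u$ (here $k$ is an index on $c$, not a power). They are given by $$D_\lambda^\alpha f=\frac1{c_\lambda^k}\int_0^\infty s^{-\lambda-1}(P_s^\alpha-I)^kf\,\mathrm{d}s,\qquad \mathcal{D}_\lambda^\alpha f=\frac1{c_\lambda^k}\int_0^\infty s^{-\lambda-1}(e^{-s}P_s^\alpha-I)^kf\,\mathrm{d}s .$$ *)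

theory Defs
  imports "HOL-Probability.Probability"
begin

definition pos_orthant :: "(real ^ 'd) set" where
  "pos_orthant = {x. \<forall>i. 0 < x $ i}"

text \<open>
  All function spaces live on the positive orthant. Functions are total on \<open>real ^ 'd\<close>, but the
  underlying measure space is the restricted one, so that neither measurability nor the values
  of a function outside the orthant matter.
\<close>

definition orthant_measure :: "(real ^ 'd) measure" where
  "orthant_measure = restrict_space lborel pos_orthant"

definition laguerre_measure :: "real ^ 'd \<Rightarrow> (real ^ 'd) measure" where
  "laguerre_measure \<alpha> = density orthant_measure
     (\<lambda>x. ennreal (\<Prod>i\<in>UNIV. x $ i powr \<alpha> $ i * exp (- (x $ i)) / Gamma (\<alpha> $ i + 1)))"

text \<open>
  Modified Bessel function of the first kind, for positive argument, by its power series. The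
  entire function \<open>rGamma\<close> is the reciprocal of \<open>Gamma\<close>.
\<close>

definition bessel_I :: "real \<Rightarrow> real \<Rightarrow> real" where
  "bessel_I \<nu> z = (\<Sum>m. (z / 2) powr (2 * real m + \<nu>) * rGamma (\<nu> + real m + 1) / fact m)"

definition laguerre_kernel :: "real ^ 'd \<Rightarrow> real \<Rightarrow> real ^ 'd \<Rightarrow> real ^ 'd \<Rightarrow> real" where
  "laguerre_kernel \<alpha> t x y =
     (\<Prod>j\<in>UNIV. Gamma (\<alpha> $ j + 1) / (1 - exp (- t))
        * exp (- (exp (- t) / (1 - exp (- t))) * (x $ j + y $ j))
        * sqrt (exp (- t) * x $ j * y $ j) powr (- (\<alpha> $ j))
        * bessel_I (\<alpha> $ j) (2 * sqrt (exp (- t) * x $ j * y $ j) / (1 - exp (- t))))"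

definition laguerre_semigroup ::
    "real ^ 'd \<Rightarrow> real \<Rightarrow> (real ^ 'd \<Rightarrow> complex) \<Rightarrow> real ^ 'd \<Rightarrow> complex" where
  "laguerre_semigroup \<alpha> t f x = (LINT y|laguerre_measure \<alpha>. laguerre_kernel \<alpha> t x y *\<^sub>R f y)"

definition poisson_laguerre ::
    "real ^ 'd \<Rightarrow> real \<Rightarrow> (real ^ 'd \<Rightarrow> complex) \<Rightarrow> real ^ 'd \<Rightarrow> complex" where
  "poisson_laguerre \<alpha> t f x =
     (LINT s:{0<..}|lborel. (t / (2 * sqrt pi) * exp (- t\<^sup>2 / (4 * s)) / s powr (3 / 2))
        *\<^sub>R laguerre_semigroup \<alpha> s f x)"

text \<open>
  The essential supremum of a non-measurable function is \<open>\<infinity>\<close>, so a finite bound on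
  \<open>Linf_norm\<close> includes measurability of the modulus.
\<close>

definition Linf_norm :: "(real ^ 'd \<Rightarrow> complex) \<Rightarrow> ereal" where
  "Linf_norm f = esssup orthant_measure (\<lambda>x. ereal (norm (f x)))"

definition Linf :: "(real ^ 'd \<Rightarrow> complex) set" where
  "Linf = {f \<in> borel_measurable orthant_measure. Linf_norm f < \<infinity>}"

definition least_above :: "real \<Rightarrow> nat" where
  "least_above b = (LEAST n. b < real n)"

text \<open>
  The \<open>n\<close>-th derivative in \<open>t\<close> of \<open>P\<^sub>t f\<close>, taken pointwise in \<open>x\<close>. For \<open>f\<close> in \<open>Linf\<close>
  and \<open>x\<close> in the orthant the function \<open>t \<mapsto> P\<^sub>t f x\<close> is smooth on \<open>t > 0\<close>, so the derivatives
  exist there.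
\<close>

definition poisson_deriv ::
    "real ^ 'd \<Rightarrow> nat \<Rightarrow> real \<Rightarrow> (real ^ 'd \<Rightarrow> complex) \<Rightarrow> real ^ 'd \<Rightarrow> complex" where
  "poisson_deriv \<alpha> n t f x =
     ((\<lambda>g u. vector_derivative g (at u)) ^^ n) (\<lambda>u. poisson_laguerre \<alpha> u f x) t"

definition Lip_constants :: "real ^ 'd \<Rightarrow> real \<Rightarrow> (real ^ 'd \<Rightarrow> complex) \<Rightarrow> real set" where
  "Lip_constants \<alpha> \<beta> f =
     {A. \<forall>t>0. Linf_norm (poisson_deriv \<alpha> (least_above \<beta>) t f)
                 \<le> ereal (A * t powr (- real (least_above \<beta>) + \<beta>))}"

definition Lip :: "real ^ 'd \<Rightarrow> real \<Rightarrow> (real ^ 'd \<Rightarrow> complex) set" where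
  "Lip \<alpha> \<beta> = {f \<in> Linf. Lip_constants \<alpha> \<beta> f \<noteq> {}}"

definition Lip_norm :: "real ^ 'd \<Rightarrow> real \<Rightarrow> (real ^ 'd \<Rightarrow> complex) \<Rightarrow> real" where
  "Lip_norm \<alpha> \<beta> f = real_of_ereal (Linf_norm f) + Inf (Lip_constants \<alpha> \<beta> f)"

definition frac_const :: "real \<Rightarrow> nat \<Rightarrow> real" where
  "frac_const lam k = (LINT u:{0<..}|lborel. u powr (- lam - 1) * (exp (- u) - 1) ^ k)"

text \<open>
  Both fractional derivatives have the form \<open>1 / c \<integral> s powr (- lam - 1) (Q\<^sub>s - I)\<^sup>k f ds\<close>, for the
  families \<open>Q\<^sub>s = P\<^sub>s\<close> and \<open>Q\<^sub>s = exp (- s) P\<^sub>s\<close>. Since the Bochner integral of a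
  non-integrable function is \<open>0\<close>, the domain, on which the integral converges absolutely at
  almost every point, is recorded separately.
\<close>

definition frac_integrand ::
    "(real \<Rightarrow> (real ^ 'd \<Rightarrow> complex) \<Rightarrow> real ^ 'd \<Rightarrow> complex) \<Rightarrow> real
       \<Rightarrow> (real ^ 'd \<Rightarrow> complex) \<Rightarrow> real ^ 'd \<Rightarrow> real \<Rightarrow> complex" where
  "frac_integrand Q lam f x s =
     s powr (- lam - 1) *\<^sub>R ((\<lambda>g y. Q s g y - g y) ^^ least_above lam) f x"

definition frac_power ::
    "(real \<Rightarrow> (real ^ 'd \<Rightarrow> complex) \<Rightarrow> real ^ 'd \<Rightarrow> complex) \<Rightarrow> real
       \<Rightarrow> (real ^ 'd \<Rightarrow> complex) \<Rightarrow> real ^ 'd \<Rightarrow> complex" where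
  "frac_power Q lam f x =
     (1 / frac_const lam (least_above lam)) *\<^sub>R (LINT s:{0<..}|lborel. frac_integrand Q lam f x s)"

definition frac_power_dom ::
    "(real \<Rightarrow> (real ^ 'd \<Rightarrow> complex) \<Rightarrow> real ^ 'd \<Rightarrow> complex) \<Rightarrow> real
       \<Rightarrow> (real ^ 'd \<Rightarrow> complex) set" where
  "frac_power_dom Q lam =
     {f. AE x in orthant_measure. set_integrable lborel {0<..} (frac_integrand Q lam f x)}"

definition bessel_poisson_laguerre ::
    "real ^ 'd \<Rightarrow> real \<Rightarrow> (real ^ 'd \<Rightarrow> complex) \<Rightarrow> real ^ 'd \<Rightarrow> complex" where
  "bessel_poisson_laguerre \<alpha> s f x = exp (- s) *\<^sub>R poisson_laguerre \<alpha> s f x"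

definition laguerre_frac_deriv ::
    "real ^ 'd \<Rightarrow> real \<Rightarrow> (real ^ 'd \<Rightarrow> complex) \<Rightarrow> real ^ 'd \<Rightarrow> complex" where
  "laguerre_frac_deriv \<alpha> lam = frac_power (poisson_laguerre \<alpha>) lam"

definition bessel_laguerre_frac_deriv ::
    "real ^ 'd \<Rightarrow> real \<Rightarrow> (real ^ 'd \<Rightarrow> complex) \<Rightarrow> real ^ 'd \<Rightarrow> complex" where
  "bessel_laguerre_frac_deriv \<alpha> lam = frac_power (bessel_poisson_laguerre \<alpha>) lam"

definition Lip_bounded ::
    "real ^ 'd \<Rightarrow> real \<Rightarrow> real \<Rightarrow> ((real ^ 'd \<Rightarrow> complex) \<Rightarrow> real ^ 'd \<Rightarrow> complex) \<Rightarrow> bool" where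
  "Lip_bounded \<alpha> \<beta> \<gamma> S \<longleftrightarrow>
     (\<exists>C. \<forall>f \<in> Lip \<alpha> \<beta>. S f \<in> Lip \<alpha> \<gamma> \<and> Lip_norm \<alpha> \<gamma> (S f) \<le> C * Lip_norm \<alpha> \<beta> f)"

end

(*
  Fix f and x and consider the orbit u(t) = P_t f(x).  Subordination gives |u^(m)(t)| <= C |f| t^-m,
  and u^(m)(t + r) = P_r (u^(m)(t)) turns the Lipschitz condition on one derivative into
  |u^(m)(t)| <= C |f|_Lip t^(theta - m) for all m and all theta in [0, beta] with theta = 0 or
  theta < m.  Both fractional derivatives come from Q_s = c(s) P_s with c = 1 or c = exp(-s), and
  (Q_s - I)^k acts on orbits as a weighted k-th difference.  Hence the n'-th t-derivative of
  P_t (Q_s - I)^k f is bounded by t^(beta - n' - zeta) s^zeta for zeta on both sides of lam;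
  integrating s^(-lam - 1) with zeta > lam for s < t and zeta < lam for s > t gives
  t^(beta - lam - n').  At t = 0 the same bounds follow from P_t f -> f almost everywhere along
  a sequence.

  The semigroup law of the Laguerre kernel amounts to Vandermonde's identity for the coefficients
  of the Bessel series; that of P_t then follows from the convolution law of the subordination
  densities.
*)

theory Submission
  imports Defs "HOL-Real_Asymp.Real_Asymp"
begin

section \<open>The one-dimensional Laguerre kernel\<close>

text \<open>The Lipschitz condition holds only for almost every x, with a null set that may depend
  on t, while an orbit has to be differentiated at a fixed x. Since \<open>T t\<close> and
  \<open>P t\<close> are averages against probability densities relative to the Laguerre measure,
  one application of \<open>P r\<close> with r > 0 turns an a.e. bound into a bound at every x.
  Hence all estimates for t > 0 are pointwise. At t = 0 this smoothing is gone; a.e. convergence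
  there comes from continuity in mean, which rests on the symmetry of the kernel and its
  concentration at the diagonal.

  Derivatives of order below n are recovered by integrating from infinity, and the condition theta <
  m is what makes these integrals converge. Intermediate theta come from theta = beta for t <= 1 and
  theta = 0 for t > 1.

  A k-th difference can yield any power s^zeta with 0 < zeta <= k at the price t^(-zeta). A bound
  uniform as t tends to 0 therefore spends the whole exponent theta on s, while the sharp power of t
  spends only part of beta. For c = exp(-s), each factor 1 - c <= s stands in for a missing
  difference.\<close>

definition laguerre_weight :: "real \<Rightarrow> real \<Rightarrow> real" where
  "laguerre_weight a y = y powr a * exp (- y) / Gamma (a + 1)"

definition laguerre_factor :: "real \<Rightarrow> real \<Rightarrow> real \<Rightarrow> real \<Rightarrow> real" where
  "laguerre_factor a t x y = Gamma (a + 1) / (1 - exp (- t))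
     * exp (- (exp (- t) / (1 - exp (- t))) * (x + y))
     * sqrt (exp (- t) * x * y) powr (- a)
     * bessel_I a (2 * sqrt (exp (- t) * x * y) / (1 - exp (- t)))"

text \<open>Coefficients of \<open>(z / 2) powr (- a) * bessel_I a z\<close> as a power series in
  the square of z / 2.\<close>

definition bessel_coeff :: "real \<Rightarrow> nat \<Rightarrow> real" where
  "bessel_coeff a m = 1 / (fact m * Gamma (a + real m + 1))"

lemma bessel_coeff_pos: "- 1 < a \<Longrightarrow> 0 < bessel_coeff a m"
  unfolding bessel_coeff_def by (intro divide_pos_pos mult_pos_pos Gamma_real_pos) auto

text \<open>Successive terms have ratio Z / ((m + 1) (a + m + 1)), which is at most 1 / 2 once m has
  reached 2 Z.\<close>

lemma summable_bessel_series:
  assumes a: "- 1 < a" and Z: "0 \<le> Z"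
  shows "summable (\<lambda>m. Z ^ m * bessel_coeff a m)"
proof (rule summable_ratio_test[where c = "1 / 2" and N = "nat \<lceil>2 * Z\<rceil>"])
  fix m assume m: "nat \<lceil>2 * Z\<rceil> \<le> m"
  then have Zm: "2 * Z \<le> real m" by linarith
  have am: "0 < a + real m + 1" using a by simp
  have "Gamma (a + real (Suc m) + 1) = (a + real m + 1) * Gamma (a + real m + 1)"
  proof -
    have "a + real m + 1 \<notin> \<int>\<^sub>\<le>\<^sub>0" using am nonpos_Ints_nonpos by force
    from Gamma_plus1[OF this] show ?thesis by (simp add: add_ac)
  qed
  then have eq: "bessel_coeff a (Suc m) = bessel_coeff a m / ((real m + 1) * (a + real m + 1))"
    by (simp add: bessel_coeff_def)
  have "2 * Z * 1 \<le> (real m + 1) * (a + real m + 1)" if "1 \<le> m"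
    using that a Zm by (intro mult_mono) auto
  \<comment> \<open>The index 0 lies beyond the threshold only if Z = 0, and then a + 1 > 0
    suffices.\<close>
  moreover have "2 * Z \<le> (real m + 1) * (a + real m + 1)" if "m = 0"
    using that a Zm by simp
  ultimately have le: "2 * Z \<le> (real m + 1) * (a + real m + 1)" by (cases "m = 0") auto
  have "Z / ((real m + 1) * (a + real m + 1)) \<le> 1 / 2"
    using le am by (simp add: divide_le_eq)
  then have "Z / ((real m + 1) * (a + real m + 1)) * (Z ^ m * bessel_coeff a m) \<le> 1 / 2 * (Z ^ m * bessel_coeff a m)"
    using Z bessel_coeff_pos[OF a, of m] by (intro mult_right_mono) auto
  then show "norm (Z ^ Suc m * bessel_coeff a (Suc m)) \<le> 1 / 2 * norm (Z ^ m * bessel_coeff a m)"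
    using Z bessel_coeff_pos[OF a, of m] am by (simp add: eq abs_mult mult_ac)
qed simp

text \<open>The factor \<open>q powr (- a)\<close> cancels the noninteger power of q in the Bessel
  series. What remains is entire in the square of q, so the square root inside the Laguerre kernel
  disappears.\<close>

lemma bessel_I_eq:
  assumes a: "- 1 < a" and q: "0 < q" and R: "0 < R"
  shows "q powr (- a) * bessel_I a (2 * q * R) = R powr a * (\<Sum>m. ((q * R)\<^sup>2) ^ m * bessel_coeff a m)"
proof -
  have s: "summable (\<lambda>m. ((q * R)\<^sup>2) ^ m * bessel_coeff a m)"
    by (rule summable_bessel_series[OF a]) simp
  have "(2 * q * R / 2) powr (2 * real m + a) * rGamma (a + real m + 1) / fact m =
     (q * R) powr a * (((q * R)\<^sup>2) ^ m * bessel_coeff a m)" for m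
  proof -
    have "(q * R) powr (2 * real m) = ((q * R)\<^sup>2) ^ m"
    proof -
      have "(q * R) powr (2 * real m) = (q * R) powr real (2 * m)" by simp
      also have "\<dots> = (q * R) ^ (2 * m)" using q R by (intro powr_realpow) simp
      finally show ?thesis by (simp only: power_mult)
    qed
    then have "(2 * q * R / 2) powr (2 * real m + a) = ((q * R)\<^sup>2) ^ m * (q * R) powr a"
      by (simp only: powr_add) simp
    moreover have "Z * A * inverse g / h = A * (Z * (1 / (h * g)))" for A Z g h :: real
      by (simp add: divide_inverse)
    ultimately show ?thesis
      by (simp only: bessel_coeff_def rGamma_inverse_Gamma)
  qed
  then have "bessel_I a (2 * q * R) = (\<Sum>m. (q * R) powr a * (((q * R)\<^sup>2) ^ m * bessel_coeff a m))"
    unfolding bessel_I_def by (simp only:)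
  also have "\<dots> = (q * R) powr a * (\<Sum>m. ((q * R)\<^sup>2) ^ m * bessel_coeff a m)"
    by (rule suminf_mult[OF s])
  finally have "q powr (- a) * bessel_I a (2 * q * R) =
      (q powr (- a) * (q * R) powr a) * (\<Sum>m. ((q * R)\<^sup>2) ^ m * bessel_coeff a m)"
    by (simp only: mult.assoc)
  also have "q powr (- a) * (q * R) powr a = R powr a"
    using q R by (simp add: powr_mult powr_minus field_simps)
  finally show ?thesis .
qed

text \<open>The parameter \<open>1 / (1 - exp (- t))\<close>, in terms of which
  \<open>exp (- t) / (1 - exp (- t)) = lag_rate t - 1\<close>.\<close>

definition lag_rate :: "real \<Rightarrow> real" where
  "lag_rate t = 1 / (1 - exp (- t))"

lemma lag_rate: "0 < t \<Longrightarrow> 1 < lag_rate t"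
  "0 < t \<Longrightarrow> exp (- t) * lag_rate t = lag_rate t - 1"
  by (auto simp: lag_rate_def field_simps)

text \<open>Here q is the root of exp (- t) x y, and exp (- t) R = R - 1 turns the square of q R
  into (R - 1) R x y. Time then enters only through R, rationally apart from powers and
  exponentials.\<close>

lemma laguerre_factor_eq:
  assumes a: "- 1 < a" and t: "0 < t" and x: "0 < x" and y: "0 < y"
  defines "R \<equiv> lag_rate t"
  shows "laguerre_factor a t x y = Gamma (a + 1) * R powr (a + 1) * exp (- (R - 1) * (x + y)) *
     (\<Sum>m. ((R - 1) * R * x * y) ^ m * bessel_coeff a m)"
proof -
  let ?q = "sqrt (exp (- t) * x * y)"
  have R: "1 < R" "exp (- t) * R = R - 1" "1 / (1 - exp (- t)) = R"
    using lag_rate[OF t] by (simp_all add: R_def) (simp add: lag_rate_def)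
  have q: "0 < ?q" using x y by simp
  have q2: "(?q * R)\<^sup>2 = (R - 1) * R * x * y"
  proof -
    have "(?q * R)\<^sup>2 = (exp (- t) * R) * R * x * y"
      using x y by (simp add: power_mult_distrib power2_eq_square)
    then show ?thesis using R by simp
  qed
  have "laguerre_factor a t x y = Gamma (a + 1) * (1 / (1 - exp (- t))) * exp (- (exp (- t) * (1 / (1 - exp (- t)))) * (x + y)) *
      (?q powr (- a) * bessel_I a (2 * ?q * (1 / (1 - exp (- t)))))"
    unfolding laguerre_factor_def by simp
  also have "\<dots> = Gamma (a + 1) * R * exp (- (R - 1) * (x + y)) * (?q powr (- a) * bessel_I a (2 * ?q * R))"
    unfolding R(2,3) ..
  also have "\<dots> = Gamma (a + 1) * R * exp (- (R - 1) * (x + y)) *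
      (R powr a * (\<Sum>m. ((R - 1) * R * x * y) ^ m * bessel_coeff a m))"
    using bessel_I_eq[OF a q, of R] R(1) q2 by simp
  also have "\<dots> = Gamma (a + 1) * (R powr a * R) * exp (- (R - 1) * (x + y)) * (\<Sum>m. ((R - 1) * R * x * y) ^ m * bessel_coeff a m)"
    by (simp only: mult_ac)
  also have "R powr a * R = R powr (a + 1)" using R(1) by (simp add: powr_add)
  finally show ?thesis .
qed

lemma laguerre_factor_nonneg:
  assumes a: "- 1 < a" and t: "0 < t" and x: "0 < x" and y: "0 < y"
  shows "0 \<le> laguerre_factor a t x y"
proof -
  have "0 \<le> ((lag_rate t - 1) * lag_rate t * x * y) ^ m * bessel_coeff a m" for m
    using lag_rate[OF t] x y bessel_coeff_pos[OF a, of m] by (auto intro!: mult_nonneg_nonneg)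
  then have "0 \<le> (\<Sum>m. ((lag_rate t - 1) * lag_rate t * x * y) ^ m * bessel_coeff a m)"
    using lag_rate[OF t] x y by (intro suminf_nonneg summable_bessel_series a) auto
  then show ?thesis
    unfolding laguerre_factor_eq[OF assms] using Gamma_real_pos[of "a + 1"] a by (intro mult_nonneg_nonneg) auto
qed

text \<open>Coefficients of the kernel, for fixed first argument x, in the functions y^m exp (- (R -
  1) y), whose integrals against the Laguerre weight are Gamma values.\<close>

definition laguerre_coeff :: "real \<Rightarrow> real \<Rightarrow> real \<Rightarrow> nat \<Rightarrow> real" where
  "laguerre_coeff a R x m =
    Gamma (a + 1) * R powr (a + 1) * exp (- (R - 1) * x) * (((R - 1) * R * x) ^ m * bessel_coeff a m)"

lemma laguerre_coeff_nonneg: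
  assumes "- 1 < a" "1 < R" "0 < x"
  shows "0 \<le> laguerre_coeff a R x m"
  unfolding laguerre_coeff_def
  using assms bessel_coeff_pos[of a m] Gamma_real_pos[of "a + 1"] by (intro mult_nonneg_nonneg) auto

text \<open>All terms are nonnegative, so in \<open>ennreal\<close> the series may be integrated
  term by term without any convergence condition.\<close>

lemma ennreal_laguerre_factor:
  assumes a: "- 1 < a" and t: "0 < t" and x: "0 < x" and y: "0 < y"
  defines "R \<equiv> lag_rate t"
  shows "ennreal (laguerre_factor a t x y) =
    (\<Sum>m. ennreal (laguerre_coeff a R x m) * ennreal (y ^ m * exp (- (R - 1) * y)))"
proof -
  have R: "1 < R" using lag_rate(1)[OF t] by (simp add: R_def)
  have s: "summable (\<lambda>m. ((R - 1) * R * x * y) ^ m * bessel_coeff a m)"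
    using R x y by (intro summable_bessel_series a) auto
  have e: "exp (- (R - 1) * (x + y)) = exp (- (R - 1) * x) * exp (- (R - 1) * y)"
    unfolding exp_add[symmetric] by (simp add: algebra_simps)
  have eq: "Gamma (a + 1) * R powr (a + 1) * exp (- (R - 1) * (x + y)) * (((R - 1) * R * x * y) ^ m * bessel_coeff a m) =
      laguerre_coeff a R x m * (y ^ m * exp (- (R - 1) * y))" for m
    unfolding e laguerre_coeff_def by (simp only: power_mult_distrib mult_ac)
  from sums_mult[OF summable_sums[OF s], of "Gamma (a + 1) * R powr (a + 1) * exp (- (R - 1) * (x + y))"]
  have "(\<lambda>m. laguerre_coeff a R x m * (y ^ m * exp (- (R - 1) * y))) sums laguerre_factor a t x y"
    by (simp only: eq laguerre_factor_eq[OF a t x y, folded R_def])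
  then have "(\<Sum>m. ennreal (laguerre_coeff a R x m * (y ^ m * exp (- (R - 1) * y)))) = ennreal (laguerre_factor a t x y)"
    using laguerre_coeff_nonneg[OF a R x] y by (intro suminf_ennreal_eq) auto
  then show ?thesis
    using laguerre_coeff_nonneg[OF a R x] y by (simp add: ennreal_mult)
qed

section \<open>Gamma integrals and the Laplace transform of the one-dimensional kernel\<close>

lemma nn_integral_gamma:
  assumes p: "0 < p" and c: "0 < c"
  shows "(\<integral>\<^sup>+y. ennreal (indicator {0<..} y * (y powr (p - 1) * exp (- c * y))) \<partial>lborel) = ennreal (Gamma p / c powr p)"
proof -
  define f where "f = (\<lambda>y::real. ennreal (indicator {0..} y * y powr (p - 1) / exp y))"
  define I where "I = (\<integral>\<^sup>+y. ennreal (indicator {0<..} y * (y powr (p - 1) * exp (- c * y))) \<partial>lborel)"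
  have [measurable]: "f \<in> borel_measurable borel" unfolding f_def by measurable
  have f: "f (0 + c * y) = ennreal (c powr (p - 1)) * ennreal (indicator {0<..} y * (y powr (p - 1) * exp (- c * y)))" for y
  proof (cases "0 < y")
    case True
    then have "0 + c * y \<in> {0..}" using c by simp
    then have "f (0 + c * y) = ennreal ((c powr (p - 1)) * (y powr (p - 1) * exp (- c * y)))"
      using c True by (simp add: f_def powr_mult exp_minus divide_inverse mult.assoc)
    then show ?thesis using True by (simp add: ennreal_mult)
  next
    case False
    then show ?thesis using c by (cases "y = 0") (auto simp: f_def indicator_def zero_le_mult_iff)
  qed
  have "ennreal (Gamma p) = (\<integral>\<^sup>+y. f y \<partial>lborel)"
    unfolding f_def by (rule Gamma_conv_nn_integral_real[OF p])
  also have "\<dots> = ennreal \<bar>c\<bar> * (\<integral>\<^sup>+y. f (0 + c * y) \<partial>lborel)"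
    by (rule nn_integral_real_affine) (use c in auto)
  also have "(\<integral>\<^sup>+y. f (0 + c * y) \<partial>lborel) = ennreal (c powr (p - 1)) * I"
    unfolding f I_def by (rule nn_integral_cmult) measurable
  also have "ennreal \<bar>c\<bar> * (ennreal (c powr (p - 1)) * I) = ennreal (\<bar>c\<bar> * c powr (p - 1)) * I"
    by (simp only: mult.assoc[symmetric] ennreal_mult[OF abs_ge_zero powr_ge_zero])
  also have "\<bar>c\<bar> * c powr (p - 1) = c powr p"
    using c by (simp add: powr_diff)
  finally have eq: "ennreal (Gamma p) = ennreal (c powr p) * I" .
  have G: "0 \<le> Gamma p" using Gamma_real_pos[OF p] by simp
  have "ennreal (Gamma p / c powr p) = ennreal (1 / c powr p) * ennreal (Gamma p)"
    using G by (subst ennreal_mult[symmetric]) auto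
  also have "\<dots> = (ennreal (1 / c powr p) * ennreal (c powr p)) * I" unfolding eq by (simp only: mult.assoc)
  also have "ennreal (1 / c powr p) * ennreal (c powr p) = ennreal (1 / c powr p * c powr p)"
    by (rule ennreal_mult[symmetric]) auto
  finally show ?thesis using c by (simp add: I_def)
qed

text \<open>The half-line is encoded by an indicator over \<open>lborel\<close>, so that a product
  of such integrals is an integral over the whole of R^d.\<close>

abbreviation lag_int :: "real \<Rightarrow> (real \<Rightarrow> ennreal) \<Rightarrow> ennreal" where
  "lag_int a h \<equiv> \<integral>\<^sup>+y. ennreal (indicator {0<..} y * laguerre_weight a y) * h y \<partial>lborel"

lemma lag_int_cong: "(\<And>y. 0 < y \<Longrightarrow> f y = g y) \<Longrightarrow> lag_int a f = lag_int a g"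
  by (intro nn_integral_cong) (auto simp: indicator_def)

lemma laguerre_weight_measurable [measurable]: "laguerre_weight a \<in> borel_measurable borel"
  unfolding laguerre_weight_def[abs_def] by measurable

lemma lag_int_suminf:
  assumes [measurable]: "\<And>m. f m \<in> borel_measurable borel"
  shows "lag_int a (\<lambda>y. \<Sum>m. ennreal (u m) * f m y) = (\<Sum>m. ennreal (u m) * lag_int a (f m))"
proof -
  have "lag_int a (\<lambda>y. \<Sum>m. ennreal (u m) * f m y) =
    (\<integral>\<^sup>+y. (\<Sum>m. ennreal (u m) * (ennreal (indicator {0<..} y * laguerre_weight a y) * f m y)) \<partial>lborel)"
    by (intro nn_integral_cong) (simp add: ennreal_suminf_cmult[symmetric] mult.left_commute)
  also have "\<dots> = (\<Sum>m. \<integral>\<^sup>+y. ennreal (u m) * (ennreal (indicator {0<..} y * laguerre_weight a y) * f m y) \<partial>lborel)"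
    by (rule nn_integral_suminf) measurable
  also have "\<dots> = (\<Sum>m. ennreal (u m) * lag_int a (f m))"
    by (intro suminf_cong nn_integral_cmult) measurable
  finally show ?thesis .
qed

text \<open>The weight contributes exp (- y) itself, so a function of rate b - 1 leads to the Gamma
  integral of rate b.\<close>

lemma lag_int_power_exp:
  assumes a: "- 1 < a" and b: "0 < b"
  shows "lag_int a (\<lambda>y. ennreal (y ^ m * exp (- (b - 1) * y))) =
    ennreal (Gamma (a + real m + 1) / (Gamma (a + 1) * b powr (a + real m + 1)))"
proof -
  have G: "0 < Gamma (a + 1)" using a by (intro Gamma_real_pos) auto
  have p: "0 < a + real m + 1" using a by simp
  define f where "f = (\<lambda>y. ennreal (indicator {0<..} y * (y powr (a + real m + 1 - 1) * exp (- b * y))))"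
  have [measurable]: "f \<in> borel_measurable borel" unfolding f_def by measurable
  have "ennreal (indicator {0<..} y * laguerre_weight a y) * ennreal (y ^ m * exp (- (b - 1) * y)) =
      ennreal (1 / Gamma (a + 1)) * f y" for y
  proof (cases "0 < y")
    case True
    have "exp (- y) * exp (- (b - 1) * y) = exp (- b * y)"
      unfolding exp_add[symmetric] by (simp add: algebra_simps)
    moreover have "y powr (a + real m + 1 - 1) = y powr a * y ^ m"
      using True by (simp add: powr_add powr_realpow)
    ultimately have "laguerre_weight a y * (y ^ m * exp (- (b - 1) * y)) =
        1 / Gamma (a + 1) * (y powr (a + real m + 1 - 1) * exp (- b * y))"
      by (simp add: laguerre_weight_def mult_ac)
    moreover have "0 \<le> laguerre_weight a y" "0 \<le> 1 / Gamma (a + 1)" using G by (simp_all add: laguerre_weight_def)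
    moreover have "0 \<le> y ^ m * exp (- (b - 1) * y)" "0 \<le> y powr (a + real m + 1 - 1) * exp (- b * y)"
      using True by simp_all
    moreover have "indicator {0<..} y = (1::real)" using True by simp
    ultimately show ?thesis unfolding f_def by (simp only: ennreal_mult[symmetric] mult_1)
  qed (simp add: f_def)
  then have "lag_int a (\<lambda>y. ennreal (y ^ m * exp (- (b - 1) * y))) = (\<integral>\<^sup>+y. ennreal (1 / Gamma (a + 1)) * f y \<partial>lborel)"
    by (simp only:)
  also have "\<dots> = ennreal (1 / Gamma (a + 1)) * (\<integral>\<^sup>+y. f y \<partial>lborel)"
    by (rule nn_integral_cmult) measurable
  also have "(\<integral>\<^sup>+y. f y \<partial>lborel) = ennreal (Gamma (a + real m + 1) / b powr (a + real m + 1))"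
    unfolding f_def by (rule nn_integral_gamma[OF p b])
  also have "ennreal (1 / Gamma (a + 1)) * \<dots> = ennreal (1 / Gamma (a + 1) * (Gamma (a + real m + 1) / b powr (a + real m + 1)))"
    using G Gamma_real_pos[OF p] by (intro ennreal_mult[symmetric]) auto
  finally show ?thesis by simp
qed

lemma lag_int_one:
  assumes a: "- 1 < a"
  shows "lag_int a (\<lambda>_. 1) = 1"
proof -
  have "0 < Gamma (a + 1)" using a by (intro Gamma_real_pos) auto
  then show ?thesis using lag_int_power_exp[OF a, of 1 0] by simp
qed

text \<open>Termwise integration produces Gamma (a + m + 1), which cancels the one in
  \<open>bessel_coeff\<close> and leaves an exponential series. The value c = 0 gives total mass 1;
  c = 1 and c = 2 later give moments in the coordinate exp (- y).\<close>

lemma laguerre_factor_laplace: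
  assumes a: "- 1 < a" and t: "0 < t" and x: "0 < x" and c: "0 \<le> c"
  defines "R \<equiv> lag_rate t"
  shows "lag_int a (\<lambda>y. ennreal (laguerre_factor a t x y) * ennreal (exp (- c * y))) =
    ennreal ((R / (R + c)) powr (a + 1) * exp (- (R - 1) * x * c / (R + c)))"
proof -
  have R: "1 < R" using lag_rate(1)[OF t] by (simp add: R_def)
  have G: "0 < Gamma (a + real m + 1)" for m using a by (intro Gamma_real_pos) auto
  have G1: "0 < Gamma (a + 1)" using G[of 0] by simp
  note u = laguerre_coeff_nonneg[OF a R x]
  let ?I = "\<lambda>m. Gamma (a + real m + 1) / (Gamma (a + 1) * (R + c) powr (a + real m + 1))"
  have "lag_int a (\<lambda>y. ennreal (laguerre_factor a t x y) * ennreal (exp (- c * y))) =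
    lag_int a (\<lambda>y. \<Sum>m. ennreal (laguerre_coeff a R x m) * ennreal (y ^ m * exp (- (R + c - 1) * y)))"
  proof (rule lag_int_cong)
    fix y :: real assume y: "0 < y"
    have "ennreal (y ^ m * exp (- (R - 1) * y)) * ennreal (exp (- c * y)) = ennreal (y ^ m * exp (- (R + c - 1) * y))" for m
      using y by (simp add: ennreal_mult[symmetric] mult.assoc exp_add[symmetric] algebra_simps)
    then show "ennreal (laguerre_factor a t x y) * ennreal (exp (- c * y)) =
        (\<Sum>m. ennreal (laguerre_coeff a R x m) * ennreal (y ^ m * exp (- (R + c - 1) * y)))"
      unfolding ennreal_laguerre_factor[OF a t x y, folded R_def]
      by (simp only: ennreal_suminf_multc[symmetric] mult.assoc)
  qed
  also have "\<dots> = (\<Sum>m. ennreal (laguerre_coeff a R x m) * ennreal (?I m))"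
  proof -
    have "lag_int a (\<lambda>y. ennreal (y ^ m * exp (- (R + c - 1) * y))) = ennreal (?I m)" for m
      by (rule lag_int_power_exp) (use a R c in auto)
    moreover have "(\<lambda>y::real. ennreal (y ^ m * exp (- (R + c - 1) * y))) \<in> borel_measurable borel" for m by measurable
    ultimately show ?thesis by (simp only: lag_int_suminf)
  qed
  also have "\<dots> = (\<Sum>m. ennreal (laguerre_coeff a R x m * ?I m))"
  proof (rule suminf_cong)
    show "ennreal (laguerre_coeff a R x m) * ennreal (?I m) = ennreal (laguerre_coeff a R x m * ?I m)" for m
      by (rule ennreal_mult[OF u, symmetric]) (use G[of m] G1 in auto)
  qed
  also have "\<dots> = ennreal ((R / (R + c)) powr (a + 1) * exp (- (R - 1) * x) * exp ((R - 1) * R * x / (R + c)))"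
  proof (rule suminf_ennreal_eq)
    show "0 \<le> laguerre_coeff a R x m * ?I m" for m
      by (rule mult_nonneg_nonneg[OF u]) (use G[of m] G1 in auto)
    have "laguerre_coeff a R x m * ?I m =
      (R / (R + c)) powr (a + 1) * exp (- (R - 1) * x) * (((R - 1) * R * x / (R + c)) ^ m /\<^sub>R fact m)" for m
    proof -
      have "(R + c) powr (a + real m + 1) = (R + c) powr (a + 1) * (R + c) ^ m"
        using R c by (simp add: powr_add powr_realpow)
      moreover have "(R / (R + c)) powr (a + 1) = R powr (a + 1) / (R + c) powr (a + 1)"
        using R c by (simp add: powr_divide)
      moreover have "g * p * E * (D * (1 / (F * G))) * (G / (g * (q * H))) = p / q * E * (D / H /\<^sub>R F)"
        if "0 < G" "0 < g" for g p E D F G q H :: real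
        using that by (simp add: divide_inverse) (simp add: field_simps)
      ultimately show ?thesis
        unfolding laguerre_coeff_def bessel_coeff_def power_divide using G[of m] G1 by (simp only:)
    qed
    then show "(\<lambda>m. laguerre_coeff a R x m * ?I m) sums
      ((R / (R + c)) powr (a + 1) * exp (- (R - 1) * x) * exp ((R - 1) * R * x / (R + c)))"
      by (simp only:) (intro sums_mult exp_converges)
  qed
  also have "(R / (R + c)) powr (a + 1) * exp (- (R - 1) * x) * exp ((R - 1) * R * x / (R + c)) =
     (R / (R + c)) powr (a + 1) * exp (- (R - 1) * x * c / (R + c))"
  proof -
    have "- (R - 1) * x + (R - 1) * R * x / (R + c) = - (R - 1) * x * c / (R + c)"
      using R c by (simp add: field_simps)
    then show ?thesis by (simp only: mult.assoc exp_add[symmetric])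
  qed
  finally show ?thesis .
qed

section \<open>The semigroup law in one dimension\<close>

lemma laguerre_factor_sym: "laguerre_factor a t x y = laguerre_factor a t y x"
  by (simp add: laguerre_factor_def ac_simps)

text \<open>This is Vandermonde's convolution of \<open>k gchoose j\<close> with
  \<open>(a + m) gchoose (m - j)\<close>, divided by k! Gamma (a + m + 1). On the right, m and k
  interact only through j, so a double series over m and k splits into a product for each j.\<close>

lemma bessel_coeff_Vandermonde:
  assumes a: "- 1 < a"
  shows "bessel_coeff a m * bessel_coeff a k * Gamma (a + real m + real k + 1) =
    (\<Sum>j\<le>m. if j \<le> k then bessel_coeff a j / (fact (m - j) * fact (k - j)) else 0)"
proof -
  have pos: "z \<notin> \<int>\<^sub>\<le>\<^sub>0" if "0 < z" for z :: real using that nonpos_Ints_nonpos by force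
  have G: "0 < Gamma (a + real i + 1)" for i using a by (intro Gamma_real_pos) auto
  have 1: "(real k + (a + real m)) gchoose m = Gamma (a + real m + real k + 1) / (fact m * Gamma (a + real k + 1))"
    using gbinomial_Gamma[OF pos, of "real k + (a + real m)" m] a by (simp add: add_ac)
  have 2: "(a + real m) gchoose (m - j) = Gamma (a + real m + 1) / (fact (m - j) * Gamma (a + real j + 1))" if "j \<le> m" for j
    using gbinomial_Gamma[OF pos, of "a + real m" "m - j"] a that by (simp add: add_ac of_nat_diff)
  have 3: "real k gchoose j = (if j \<le> k then fact k / (fact j * fact (k - j)) else 0)" for j
    by (simp add: binomial_gbinomial[symmetric] binomial_fact)
  have "(\<Sum>j=0..m. (real k gchoose j) * ((a + real m) gchoose (m - j))) = Gamma (a + real m + real k + 1) / (fact m * Gamma (a + real k + 1))"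
    unfolding gbinomial_Vandermonde 1 ..
  then have "Gamma (a + real m + real k + 1) / (fact m * Gamma (a + real k + 1)) / (fact k * Gamma (a + real m + 1)) =
      (\<Sum>j=0..m. (real k gchoose j) * ((a + real m) gchoose (m - j)) / (fact k * Gamma (a + real m + 1)))"
    by (simp only: sum_divide_distrib[symmetric])
  also have "\<dots> = (\<Sum>j\<le>m. if j \<le> k then bessel_coeff a j / (fact (m - j) * fact (k - j)) else 0)"
    unfolding atLeast0AtMost
  proof (rule sum.cong[OF refl])
    fix j assume "j \<in> {..m}"
    then have j: "j \<le> m" by simp
    show "(real k gchoose j) * ((a + real m) gchoose (m - j)) / (fact k * Gamma (a + real m + 1)) =
      (if j \<le> k then bessel_coeff a j / (fact (m - j) * fact (k - j)) else 0)"
      unfolding 2[OF j] 3 using G[of m] G[of j] by (simp add: bessel_coeff_def)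
  qed
  finally show ?thesis by (simp add: bessel_coeff_def mult_ac)
qed

lemma suminf_swap_ennreal:
  fixes f :: "nat \<Rightarrow> nat \<Rightarrow> ennreal"
  shows "(\<Sum>i. \<Sum>j. f i j) = (\<Sum>j. \<Sum>i. f i j)"
  using nn_integral_suminf[of "\<lambda>j i. f i j" "count_space UNIV"]
  by (simp add: nn_integral_count_space_nat)

lemma exp_series_shifted:
  fixes B :: real
  assumes B: "0 \<le> B"
  shows "(\<Sum>k. ennreal (if j \<le> k then B ^ k / fact (k - j) else 0)) = ennreal (B ^ j * exp B)"
proof (rule suminf_ennreal_eq)
  have "(\<lambda>k. B ^ j * (B ^ k /\<^sub>R fact k)) sums (B ^ j * exp B)"
    by (intro sums_mult exp_converges)
  then have "(\<lambda>k. (if j \<le> k + j then B ^ (k + j) / fact (k + j - j) else 0)) sums (B ^ j * exp B)"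
    by (simp add: power_add divide_inverse mult_ac)
  then show "(\<lambda>k. if j \<le> k then B ^ k / fact (k - j) else 0) sums (B ^ j * exp B)"
    using sums_iff_shift[of "\<lambda>k. if j \<le> k then B ^ k / fact (k - j) else 0" j "B ^ j * exp B"] by simp
qed (use B in auto)

text \<open>After the Vandermonde expansion the sum over j is moved outermost; for fixed j the sums
  over m and k are shifted exponential series, and the Bessel series in A B is left.\<close>

lemma bessel_double_series:
  assumes a: "- 1 < a" and A: "0 \<le> A" and B: "0 \<le> B"
  shows "(\<Sum>m. \<Sum>k. ennreal (A ^ m * B ^ k * (bessel_coeff a m * bessel_coeff a k * Gamma (a + real m + real k + 1)))) =
    ennreal (exp A * exp B * (\<Sum>j. (A * B) ^ j * bessel_coeff a j))"
proof -
  note b = bessel_coeff_pos[OF a, THEN less_imp_le]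
  define h where "h = (\<lambda>X j k. if j \<le> k then X ^ k / fact (k - j) else 0 :: real)"
  have h0: "0 \<le> h X j k" if "0 \<le> X" for X j k using that by (simp add: h_def)
  have "(\<Sum>m. \<Sum>k. ennreal (A ^ m * B ^ k * (bessel_coeff a m * bessel_coeff a k * Gamma (a + real m + real k + 1)))) =
    (\<Sum>m. \<Sum>k. \<Sum>j. ennreal (bessel_coeff a j) * ennreal (h A j m) * ennreal (h B j k))"
  proof (intro suminf_cong)
    fix m k
    have "A ^ m * B ^ k * (bessel_coeff a m * bessel_coeff a k * Gamma (a + real m + real k + 1)) =
      (\<Sum>j\<le>m. bessel_coeff a j * h A j m * h B j k)"
      unfolding bessel_coeff_Vandermonde[OF a] sum_distrib_left
      by (intro sum.cong) (auto simp: h_def mult_ac)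
    also have "ennreal \<dots> = (\<Sum>j\<le>m. ennreal (bessel_coeff a j) * ennreal (h A j m) * ennreal (h B j k))"
      using b h0[OF A] h0[OF B] by (simp add: sum_ennreal[symmetric] ennreal_mult)
    also have "\<dots> = (\<Sum>j. ennreal (bessel_coeff a j) * ennreal (h A j m) * ennreal (h B j k))"
      by (rule suminf_finite[symmetric]) (auto simp: h_def)
    finally show "ennreal (A ^ m * B ^ k * (bessel_coeff a m * bessel_coeff a k * Gamma (a + real m + real k + 1))) =
      (\<Sum>j. ennreal (bessel_coeff a j) * ennreal (h A j m) * ennreal (h B j k))" .
  qed
  also have "\<dots> = (\<Sum>m. \<Sum>j. \<Sum>k. ennreal (bessel_coeff a j) * ennreal (h A j m) * ennreal (h B j k))"
    by (intro suminf_cong suminf_swap_ennreal)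
  also have "\<dots> = (\<Sum>j. \<Sum>m. \<Sum>k. ennreal (bessel_coeff a j) * ennreal (h A j m) * ennreal (h B j k))"
    by (rule suminf_swap_ennreal)
  also have "\<dots> = (\<Sum>j. ennreal (exp A * exp B * ((A * B) ^ j * bessel_coeff a j)))"
  proof (rule suminf_cong)
    fix j
    have "(\<Sum>m. \<Sum>k. ennreal (bessel_coeff a j) * ennreal (h A j m) * ennreal (h B j k)) =
      ennreal (bessel_coeff a j) * ((\<Sum>m. ennreal (h A j m)) * (\<Sum>k. ennreal (h B j k)))"
      by (simp only: ennreal_suminf_cmult ennreal_suminf_multc mult.assoc)
    also have "\<dots> = ennreal (bessel_coeff a j) * (ennreal (A ^ j * exp A) * ennreal (B ^ j * exp B))"
      unfolding h_def exp_series_shifted[OF A] exp_series_shifted[OF B] ..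
    also have "\<dots> = ennreal (bessel_coeff a j * ((A ^ j * exp A) * (B ^ j * exp B)))"
      using b A B by (simp add: ennreal_mult)
    also have "bessel_coeff a j * ((A ^ j * exp A) * (B ^ j * exp B)) = exp A * exp B * ((A * B) ^ j * bessel_coeff a j)"
      by (simp add: power_mult_distrib)
    finally show "(\<Sum>m. \<Sum>k. ennreal (bessel_coeff a j) * ennreal (h A j m) * ennreal (h B j k)) =
      ennreal (exp A * exp B * ((A * B) ^ j * bessel_coeff a j))" .
  qed
  also have "\<dots> = ennreal (exp A * exp B * (\<Sum>j. (A * B) ^ j * bessel_coeff a j))"
    using A B b by (intro suminf_ennreal_eq sums_mult summable_sums summable_bessel_series a) auto
  finally show ?thesis .
qed

text \<open>The denominator is the total exponential rate met when two kernels are multiplied and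
  integrated: R - 1 and S - 1 from the kernels and 1 from the weight.\<close>

lemma lag_rate_add:
  assumes t: "0 < t" and s: "0 < s"
  shows "lag_rate (t + s) = lag_rate t * lag_rate s / (lag_rate t + lag_rate s - 1)"
proof -
  have "exp (- t) < 1" "exp (- s) < 1" "exp (- t) * exp (- s) < 1" using t s by (simp_all add: mult_exp_exp)
  moreover have "exp (- (t + s)) = exp (- t) * exp (- s)" by (simp add: exp_add[symmetric])
  moreover have "1 / (1 - p * q) = 1 / (1 - p) * (1 / (1 - q)) / (1 / (1 - p) + 1 / (1 - q) - 1)"
    if "p < 1" "q < 1" "p * q < 1" for p q :: real
  proof -
    have "1 / (1 - p) + 1 / (1 - q) - 1 = (1 - p * q) / ((1 - p) * (1 - q))"
      using that by (simp add: divide_simps) (simp add: algebra_simps)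
    then show ?thesis using that by simp
  qed
  ultimately show ?thesis by (simp add: lag_rate_def)
qed

text \<open>Both kernels are expanded in the middle variable, and each product of powers integrates
  to a Gamma value over a power of c. The result is the double series above with arguments (R - 1) R
  x / c and (S - 1) S z / c, whose product is (U - 1) U x z.\<close>

lemma laguerre_factor_semigroup:
  assumes a: "- 1 < a" and t: "0 < t" and s: "0 < s" and x: "0 < x" and z: "0 < z"
  shows "lag_int a (\<lambda>y. ennreal (laguerre_factor a t x y) * ennreal (laguerre_factor a s y z)) =
    ennreal (laguerre_factor a (t + s) x z)"
proof -
  define R where "R = lag_rate t"
  define S where "S = lag_rate s"
  define U where "U = lag_rate (t + s)"
  define c where "c = R + S - 1"
  have R: "1 < R" and S: "1 < S" using lag_rate(1) t s by (auto simp: R_def S_def)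
  have c: "0 < c" using R S by (simp add: c_def)
  have U: "U = R * S / c" unfolding U_def R_def S_def c_def by (rule lag_rate_add[OF t s])
  have U1: "U - 1 = (R - 1) * (S - 1) / c" unfolding U using c by (simp add: field_simps) (simp add: c_def algebra_simps)
  have G: "0 < Gamma (a + real i + 1)" for i using a by (intro Gamma_real_pos) auto
  have G1: "0 < Gamma (a + 1)" using G[of 0] by simp
  note b = bessel_coeff_pos[OF a, THEN less_imp_le]
  let ?u = "laguerre_coeff a R x" and ?v = "laguerre_coeff a S z"
  note u0 = laguerre_coeff_nonneg[OF a R x] laguerre_coeff_nonneg[OF a S z]
  let ?I = "\<lambda>m k. Gamma (a + real m + real k + 1) / (Gamma (a + 1) * c powr (a + real m + real k + 1))"
  have I: "lag_int a (\<lambda>y. ennreal (y ^ (m + k) * exp (- (c - 1) * y))) = ennreal (?I m k)" for m k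
    using lag_int_power_exp[OF a c, of "m + k"] by (simp add: add.assoc)
  have "lag_int a (\<lambda>y. ennreal (laguerre_factor a t x y) * ennreal (laguerre_factor a s y z)) =
    lag_int a (\<lambda>y. \<Sum>m. ennreal (?u m) * (\<Sum>k. ennreal (?v k) * ennreal (y ^ (m + k) * exp (- (c - 1) * y))))"
  proof (rule lag_int_cong)
    fix y :: real assume y: "0 < y"
    have e: "ennreal (y ^ m * exp (- (R - 1) * y)) * ennreal (y ^ k * exp (- (S - 1) * y)) =
        ennreal (y ^ (m + k) * exp (- (c - 1) * y))" for m k
    proof -
      have "exp (- (R - 1) * y) * exp (- (S - 1) * y) = exp (- (c - 1) * y)"
        unfolding exp_add[symmetric] by (simp add: c_def algebra_simps)
      then have "y ^ m * exp (- (R - 1) * y) * (y ^ k * exp (- (S - 1) * y)) = y ^ (m + k) * exp (- (c - 1) * y)"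
        by (simp add: power_add mult_ac)
      moreover have "0 \<le> y ^ m * exp (- (R - 1) * y)" "0 \<le> y ^ k * exp (- (S - 1) * y)" using y by simp_all
      ultimately show ?thesis by (simp only: ennreal_mult[symmetric])
    qed
    \<comment> \<open>The available expansion is in the second argument, so the second kernel is
      first reflected by symmetry.\<close>
    have "ennreal (laguerre_factor a t x y) * ennreal (laguerre_factor a s y z) =
      (\<Sum>m. ennreal (?u m) * ennreal (y ^ m * exp (- (R - 1) * y))) * (\<Sum>k. ennreal (?v k) * ennreal (y ^ k * exp (- (S - 1) * y)))"
      using ennreal_laguerre_factor[OF a t x y] ennreal_laguerre_factor[OF a s z y] laguerre_factor_sym[of a s y z]
      by (simp only: R_def S_def)
    also have "\<dots> = (\<Sum>m. ennreal (?u m) * (\<Sum>k. ennreal (?v k) *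
        (ennreal (y ^ m * exp (- (R - 1) * y)) * ennreal (y ^ k * exp (- (S - 1) * y)))))"
      unfolding ennreal_suminf_multc[symmetric]
    proof (rule suminf_cong)
      fix m
      show "ennreal (?u m) * ennreal (y ^ m * exp (- (R - 1) * y)) * (\<Sum>k. ennreal (?v k) * ennreal (y ^ k * exp (- (S - 1) * y))) =
        ennreal (?u m) * (\<Sum>k. ennreal (?v k) * (ennreal (y ^ m * exp (- (R - 1) * y)) * ennreal (y ^ k * exp (- (S - 1) * y))))"
        by (simp only: ennreal_suminf_cmult[symmetric] mult_ac)
    qed
    finally show "ennreal (laguerre_factor a t x y) * ennreal (laguerre_factor a s y z) =
      (\<Sum>m. ennreal (?u m) * (\<Sum>k. ennreal (?v k) * ennreal (y ^ (m + k) * exp (- (c - 1) * y))))"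
      unfolding e .
  qed
  also have "\<dots> = (\<Sum>m. ennreal (?u m) * (\<Sum>k. ennreal (?v k) * ennreal (?I m k)))"
  proof -
    have "(\<lambda>y::real. ennreal (y ^ (m + k) * exp (- (c - 1) * y))) \<in> borel_measurable borel" for m k by measurable
    then have "lag_int a (\<lambda>y. \<Sum>k. ennreal (?v k) * ennreal (y ^ (m + k) * exp (- (c - 1) * y))) =
        (\<Sum>k. ennreal (?v k) * ennreal (?I m k))" for m
      by (simp only: lag_int_suminf I)
    moreover have "(\<lambda>y::real. \<Sum>k. ennreal (?v k) * ennreal (y ^ (m + k) * exp (- (c - 1) * y))) \<in> borel_measurable borel" for m
      by measurable
    ultimately show ?thesis by (simp only: lag_int_suminf)
  qed
  also have "\<dots> = (\<Sum>m. \<Sum>k. ennreal (?u m * ?v k * ?I m k))"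
    unfolding ennreal_suminf_cmult[symmetric]
  proof (intro suminf_cong)
    fix m k
    have "0 \<le> ?I m k" using G[of "m + k"] G1 by (simp add: add.assoc)
    moreover have "0 \<le> ?u m" "0 \<le> ?v k" by (rule u0)+
    ultimately show "ennreal (?u m) * (ennreal (?v k) * ennreal (?I m k)) = ennreal (?u m * ?v k * ?I m k)"
      by (simp only: ennreal_mult mult_nonneg_nonneg mult.assoc)
  qed
  also have "\<dots> = (\<Sum>m. \<Sum>k. ennreal (Gamma (a + 1) * U powr (a + 1) * (exp (- (R - 1) * x) * exp (- (S - 1) * z))) *
      ennreal (((R - 1) * R * x / c) ^ m * ((S - 1) * S * z / c) ^ k * (bessel_coeff a m * bessel_coeff a k * Gamma (a + real m + real k + 1))))"
  proof (intro suminf_cong)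
    fix m k
    let ?A = "(R - 1) * R * x / c" and ?B = "(S - 1) * S * z / c"
    have A: "0 \<le> ?A" "0 \<le> ?B" using R S c x z by auto
    have cp: "c powr (a + real m + real k + 1) = c powr (a + 1) * c ^ m * c ^ k"
    proof -
      have "a + real m + real k + 1 = (a + 1) + real m + real k" by simp
      then show ?thesis using c by (simp only: powr_add powr_realpow)
    qed
    have Up: "U powr (a + 1) = R powr (a + 1) * S powr (a + 1) / c powr (a + 1)"
      unfolding U using R S c by (simp add: powr_divide powr_mult)
    have "?u m * ?v k * ?I m k =
      Gamma (a + 1) * U powr (a + 1) * (exp (- (R - 1) * x) * exp (- (S - 1) * z)) *
      (?A ^ m * ?B ^ k * (bessel_coeff a m * bessel_coeff a k * Gamma (a + real m + real k + 1)))"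
      unfolding laguerre_coeff_def cp Up using G1 by (simp add: power_divide mult_ac)
    moreover have "0 \<le> Gamma (a + 1) * U powr (a + 1) * (exp (- (R - 1) * x) * exp (- (S - 1) * z))"
      using G1 by simp
    moreover have "0 \<le> ?A ^ m * ?B ^ k * (bessel_coeff a m * bessel_coeff a k * Gamma (a + real m + real k + 1))"
      using A b[of m] b[of k] G[of "m + k"] by (intro mult_nonneg_nonneg) (auto simp: add.assoc)
    ultimately show "ennreal (?u m * ?v k * ?I m k) =
      ennreal (Gamma (a + 1) * U powr (a + 1) * (exp (- (R - 1) * x) * exp (- (S - 1) * z))) *
      ennreal (?A ^ m * ?B ^ k * (bessel_coeff a m * bessel_coeff a k * Gamma (a + real m + real k + 1)))"
      by (simp only: ennreal_mult)
  qed
  also have "\<dots> = ennreal (Gamma (a + 1) * U powr (a + 1) * (exp (- (R - 1) * x) * exp (- (S - 1) * z))) *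
    ennreal (exp ((R - 1) * R * x / c) * exp ((S - 1) * S * z / c) * (\<Sum>j. ((R - 1) * R * x / c * ((S - 1) * S * z / c)) ^ j * bessel_coeff a j))"
  proof -
    have "0 \<le> (R - 1) * R * x / c" "0 \<le> (S - 1) * S * z / c" using R S c x z by auto
    from bessel_double_series[OF a this] show ?thesis
      by (simp only: ennreal_suminf_cmult)
  qed
  also have "\<dots> = ennreal (laguerre_factor a (t + s) x z)"
  proof -
    have Z: "(R - 1) * R * x / c * ((S - 1) * S * z / c) = (U - 1) * U * x * z"
      unfolding U1 unfolding U by simp
    \<comment> \<open>The exponentials left by the double series correct the rates R - 1 and S - 1
      to the common rate U - 1; this is where c = R + S - 1 is used.\<close>
    have e1: "- (R - 1) * x + (R - 1) * R * x / c = - (U - 1) * x"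
      unfolding U1 using c by (simp add: field_simps) (simp add: c_def algebra_simps)
    have e2: "- (S - 1) * z + (S - 1) * S * z / c = - (U - 1) * z"
      unfolding U1 using c by (simp add: field_simps) (simp add: c_def algebra_simps)
    have E1: "exp (- (R - 1) * x) * exp ((R - 1) * R * x / c) = exp (- (U - 1) * x)"
      unfolding exp_add[symmetric] e1 ..
    have E2: "exp (- (S - 1) * z) * exp ((S - 1) * S * z / c) = exp (- (U - 1) * z)"
      unfolding exp_add[symmetric] e2 ..
    have E3: "exp (- (U - 1) * (x + z)) = exp (- (U - 1) * x) * exp (- (U - 1) * z)"
      unfolding exp_add[symmetric] by (simp add: algebra_simps)
    have U0: "0 < U" unfolding U using R S c by simp
    let ?\<Sigma> = "\<Sum>j. ((U - 1) * U * x * z) ^ j * bessel_coeff a j"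
    have UZ: "0 \<le> (U - 1) * U * x * z" using U1 U0 R S c x z by simp
    have S0: "0 \<le> ?\<Sigma>" using UZ b by (intro suminf_nonneg summable_bessel_series a) auto
    have ts: "0 < t + s" using t s by simp
    have "laguerre_factor a (t + s) x z = Gamma (a + 1) * U powr (a + 1) *
        ((exp (- (R - 1) * x) * exp ((R - 1) * R * x / c)) * (exp (- (S - 1) * z) * exp ((S - 1) * S * z / c))) * ?\<Sigma>"
      unfolding E1 E2 E3[symmetric] using laguerre_factor_eq[OF a ts x z] by (simp add: U_def)
    also have "\<dots> = (Gamma (a + 1) * U powr (a + 1) * (exp (- (R - 1) * x) * exp (- (S - 1) * z))) *
        (exp ((R - 1) * R * x / c) * exp ((S - 1) * S * z / c) * ?\<Sigma>)"
      by (simp only: mult_ac)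
    finally show ?thesis
      unfolding Z using G1 S0 by (simp only:) (subst ennreal_mult[symmetric], auto)
  qed
  finally show ?thesis .
qed

section \<open>Continuity of symmetric Markov kernels in mean\<close>

text \<open>A density argument: the operators are uniformly contractive in L1, so convergence need
  only be known for the approximants. For these, pointwise convergence and the common bound B give
  convergence in mean by domination.\<close>

lemma (in prob_space) symmetric_kernel_L1_continuous:
  fixes G :: "real \<Rightarrow> 'a \<Rightarrow> 'a \<Rightarrow> real" and f :: "'a \<Rightarrow> complex" and \<phi> :: "nat \<Rightarrow> 'a \<Rightarrow> complex"
  assumes G[measurable]: "\<And>s. (\<lambda>(x, y). G s x y) \<in> borel_measurable (M \<Otimes>\<^sub>M M)"
    and G0: "\<And>s x y. 0 < s \<Longrightarrow> x \<in> space M \<Longrightarrow> y \<in> space M \<Longrightarrow> 0 \<le> G s x y"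
    and G1: "\<And>s x. 0 < s \<Longrightarrow> x \<in> space M \<Longrightarrow> (\<integral>\<^sup>+ y. ennreal (G s x y) \<partial>M) = 1"
    and sym: "\<And>s x y. G s x y = G s y x"
    and f[measurable]: "f \<in> borel_measurable M" and fB: "AE x in M. norm (f x) \<le> B"
    and \<phi>[measurable]: "\<And>n. \<phi> n \<in> borel_measurable M" and \<phi>B: "\<And>n x. x \<in> space M \<Longrightarrow> norm (\<phi> n x) \<le> B"
    and approx: "(\<lambda>n. \<integral>x. norm (f x - \<phi> n x) \<partial>M) \<longlonglongrightarrow> 0"
    and cont: "\<And>n x. x \<in> space M \<Longrightarrow> ((\<lambda>s. \<integral>y. G s x y *\<^sub>R \<phi> n y \<partial>M) \<longlongrightarrow> \<phi> n x) (at_right 0)"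
  shows "((\<lambda>s. \<integral>x. norm ((\<integral>y. G s x y *\<^sub>R f y \<partial>M) - f x) \<partial>M) \<longlongrightarrow> 0) (at_right 0)"
proof -
  interpret MM: pair_sigma_finite M M ..
  define T where "T = (\<lambda>s (h :: 'a \<Rightarrow> complex) x. \<integral>y. G s x y *\<^sub>R h y \<partial>M)"
  have Gint: "integrable M (\<lambda>y. G s x y)" "(\<integral>y. G s x y \<partial>M) = 1" if "0 < s" "x \<in> space M" for s x
  proof -
    note [measurable] = that(2)
    show "integrable M (\<lambda>y. G s x y)"
      using G0[OF that] G1[OF that] by (intro integrableI_nonneg) auto
    show "(\<integral>y. G s x y \<partial>M) = 1"
      using G0[OF that] G1[OF that] by (subst integral_eq_nn_integral) auto
  qed
  have Tint: "integrable M (\<lambda>y. G s x y *\<^sub>R h y)" "norm (T s h x) \<le> C"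
    if s: "0 < s" and x: "x \<in> space M" and h: "h \<in> borel_measurable M" "AE y in M. norm (h y) \<le> C" for s x h C
  proof -
    note [measurable] = x h(1)
    show int: "integrable M (\<lambda>y. G s x y *\<^sub>R h y)"
    proof (rule Bochner_Integration.integrable_bound)
      show "integrable M (\<lambda>y. G s x y * C)" using Gint[OF s x] by simp
      show "AE y in M. norm (G s x y *\<^sub>R h y) \<le> norm (G s x y * C)"
        using h(2) by eventually_elim (simp add: abs_mult mult_left_mono)
    qed measurable
    have "norm (T s h x) \<le> (\<integral>y. norm (G s x y *\<^sub>R h y) \<partial>M)"
      unfolding T_def by (rule integral_norm_bound)
    also have "\<dots> \<le> (\<integral>y. G s x y * C \<partial>M)"
    proof (rule integral_mono_AE)
      show "AE y in M. norm (G s x y *\<^sub>R h y) \<le> G s x y * C"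
        using h(2) AE_space by eventually_elim (use G0[OF s x] in \<open>auto intro!: mult_left_mono\<close>)
    qed (use Gint[OF s x] integrable_norm[OF int] in auto)
    also have "\<dots> = C" using Gint[OF s x] by simp
    finally show "norm (T s h x) \<le> C" .
  qed
  have Tm[measurable]: "T s h \<in> borel_measurable M" if [measurable]: "h \<in> borel_measurable M" for s h
    unfolding T_def by measurable
  have bint: "integrable M h" if "h \<in> borel_measurable M" "AE x in M. norm (h x) \<le> C" for h :: "'a \<Rightarrow> complex" and C
    by (rule integrable_const_bound[OF that(2,1)])
  have contraction: "(\<integral>x. norm (T s h x) \<partial>M) \<le> (\<integral>x. norm (h x) \<partial>M)"
    if s: "0 < s" and h[measurable]: "h \<in> borel_measurable M" and hC: "AE y in M. norm (h y) \<le> C" for s h C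
  proof -
    have "AE x in M. norm (T s h x) \<le> C" using Tint(2)[OF s _ h hC] by auto
    have Gh: "(\<lambda>(x, y). ennreal (G s x y) * ennreal (norm (h y))) \<in> borel_measurable (M \<Otimes>\<^sub>M M)"
      by measurable
    from \<open>AE x in M. norm (T s h x) \<le> C\<close> have iT: "integrable M (T s h)" by (intro bint) auto
    have "ennreal (\<integral>x. norm (T s h x) \<partial>M) = (\<integral>\<^sup>+x. ennreal (norm (T s h x)) \<partial>M)"
      using iT by (intro nn_integral_eq_integral[symmetric]) auto
    also have "\<dots> \<le> (\<integral>\<^sup>+x. (\<integral>\<^sup>+y. ennreal (G s x y) * ennreal (norm (h y)) \<partial>M) \<partial>M)"
    proof (rule nn_integral_mono)
      fix x assume x: "x \<in> space M"
      have "ennreal (norm (T s h x)) \<le> (\<integral>\<^sup>+y. ennreal (norm (G s x y *\<^sub>R h y)) \<partial>M)"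
        unfolding T_def by (rule integral_norm_bound_ennreal) (rule Tint(1)[OF s x h hC])
      also have "\<dots> = (\<integral>\<^sup>+y. ennreal (G s x y) * ennreal (norm (h y)) \<partial>M)"
        using G0[OF s x] by (intro nn_integral_cong) (simp add: ennreal_mult)
      finally show "ennreal (norm (T s h x)) \<le> (\<integral>\<^sup>+y. ennreal (G s x y) * ennreal (norm (h y)) \<partial>M)" .
    qed
    also have "\<dots> = (\<integral>\<^sup>+y. (\<integral>\<^sup>+x. ennreal (G s x y) * ennreal (norm (h y)) \<partial>M) \<partial>M)"
      by (rule MM.Fubini[OF Gh, unfolded prod.case, symmetric])
    also have "\<dots> = (\<integral>\<^sup>+y. ennreal (norm (h y)) \<partial>M)"
    proof (rule nn_integral_cong)
      \<comment> \<open>Symmetry converts the known mass of G in its second argument into mass 1 in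
        the first; this makes the operator an L1 contraction.\<close>
      fix y assume y[measurable]: "y \<in> space M"
      have "(\<integral>\<^sup>+x. ennreal (G s x y) \<partial>M) = 1" using G1[OF s y] sym by simp
      then show "(\<integral>\<^sup>+x. ennreal (G s x y) * ennreal (norm (h y)) \<partial>M) = ennreal (norm (h y))"
        by (subst nn_integral_multc) (use sym in auto)
    qed
    also have "\<dots> = ennreal (\<integral>x. norm (h x) \<partial>M)"
      using bint[OF h hC] by (intro nn_integral_eq_integral) auto
    finally show ?thesis by (simp add: ennreal_le_iff)
  qed
  have \<phi>AE: "AE x in M. norm (\<phi> n x) \<le> B" for n using \<phi>B by auto
  have dAE: "AE x in M. norm (f x - \<phi> n x) \<le> 2 * B" for n
    using fB \<phi>AE[of n]
  proof eventually_elim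
    case (elim x)
    then show ?case using norm_triangle_ineq4[of "f x" "\<phi> n x"] by simp
  qed
  \<comment> \<open>The remainder f - \<open>\<phi> n\<close> is counted twice: once by itself and
    once after application of the contraction.\<close>
  have step: "(\<integral>x. norm (T s f x - f x) \<partial>M) \<le> 2 * (\<integral>x. norm (f x - \<phi> n x) \<partial>M) + (\<integral>x. norm (T s (\<phi> n) x - \<phi> n x) \<partial>M)"
    if s: "0 < s" for s n
  proof -
    let ?d = "\<lambda>x. f x - \<phi> n x"
    have dm[measurable]: "?d \<in> borel_measurable M" by measurable
    have bT: "integrable M (T s h)" if "h \<in> borel_measurable M" "AE y in M. norm (h y) \<le> C" for h C
    proof -
      have "AE x in M. norm (T s h x) \<le> C" using Tint(2)[OF s _ that] by auto
      then show ?thesis by (rule bint[OF Tm[OF that(1)]])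
    qed
    have i: "integrable M (T s f)" "integrable M (T s ?d)" "integrable M (T s (\<phi> n))" "integrable M f"
      "integrable M ?d" "integrable M (\<phi> n)"
      using bT[OF f fB] bT[OF dm dAE] bT[OF \<phi> \<phi>AE] bint[OF f fB] bint[OF dm dAE] bint[OF \<phi> \<phi>AE] by auto
    have "(\<integral>x. norm (T s f x - f x) \<partial>M) \<le> (\<integral>x. norm (T s ?d x) + norm (T s (\<phi> n) x - \<phi> n x) + norm (?d x) \<partial>M)"
    proof (rule integral_mono)
      fix x assume x: "x \<in> space M"
      have "T s f x = T s ?d x + T s (\<phi> n) x"
        using Tint(1)[OF s x dm dAE] Tint(1)[OF s x \<phi> \<phi>AE, of n]
        by (simp add: T_def scaleR_diff_right Bochner_Integration.integral_add[symmetric] del: Bochner_Integration.integral_add)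
      then have eq: "T s f x - f x = (T s ?d x + (T s (\<phi> n) x - \<phi> n x)) - ?d x" by simp
      show "norm (T s f x - f x) \<le> norm (T s ?d x) + norm (T s (\<phi> n) x - \<phi> n x) + norm (?d x)"
        unfolding eq
        by (rule order_trans[OF norm_triangle_ineq4]) (rule add_right_mono[OF norm_triangle_ineq])
    qed (use i in auto)
    also have "\<dots> = (\<integral>x. norm (T s ?d x) \<partial>M) + (\<integral>x. norm (T s (\<phi> n) x - \<phi> n x) \<partial>M) + (\<integral>x. norm (?d x) \<partial>M)"
      using i by simp
    also have "(\<integral>x. norm (T s ?d x) \<partial>M) \<le> (\<integral>x. norm (?d x) \<partial>M)"
      by (rule contraction[OF s dm dAE])
    finally show ?thesis by simp
  qed
  have lim: "((\<lambda>s. \<integral>x. norm (T s (\<phi> n) x - \<phi> n x) \<partial>M) \<longlongrightarrow> 0) (at_right 0)" for n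
  proof (subst tendsto_at_iff_sequentially, intro allI impI)
    fix X :: "nat \<Rightarrow> real" assume X: "\<forall>i. X i \<in> {0<..} - {0}" "X \<longlonglongrightarrow> 0"
    have "(\<lambda>i. \<integral>x. norm (T (X i) (\<phi> n) x - \<phi> n x) \<partial>M) \<longlonglongrightarrow> (\<integral>x. 0 \<partial>M)"
    proof (rule integral_dominated_convergence[where w = "\<lambda>_. 2 * B"])
      show "AE x in M. (\<lambda>i. norm (T (X i) (\<phi> n) x - \<phi> n x)) \<longlonglongrightarrow> 0"
      proof (rule AE_I2)
        fix x assume "x \<in> space M"
        from cont[OF this, of n] X have "(\<lambda>i. T (X i) (\<phi> n) x) \<longlonglongrightarrow> \<phi> n x"
          by (auto simp: tendsto_at_iff_sequentially comp_def T_def)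
        then show "(\<lambda>i. norm (T (X i) (\<phi> n) x - \<phi> n x)) \<longlonglongrightarrow> 0"
          by (simp add: LIM_zero tendsto_norm_zero)
      qed
      show "AE x in M. norm (norm (T (X i) (\<phi> n) x - \<phi> n x)) \<le> 2 * B" for i
      proof (rule AE_I2)
        fix x assume x: "x \<in> space M"
        show "norm (norm (T (X i) (\<phi> n) x - \<phi> n x)) \<le> 2 * B"
          using norm_triangle_ineq4[of "T (X i) (\<phi> n) x" "\<phi> n x"] \<phi>B[OF x, of n]
            Tint(2)[OF _ x \<phi> \<phi>AE, of "X i" n] X(1) by force
      qed
    qed auto
    then show "((\<lambda>s. \<integral>x. norm (T s (\<phi> n) x - \<phi> n x) \<partial>M) \<circ> X) \<longlonglongrightarrow> 0" by (simp add: comp_def)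
  qed
  have "((\<lambda>s. \<integral>x. norm (T s f x - f x) \<partial>M) \<longlongrightarrow> 0) (at_right 0)"
  proof (rule order_tendstoI)
    fix e :: real assume e: "0 < e"
    from order_tendstoD(2)[OF approx, of "e / 4"] e obtain n where n: "(\<integral>x. norm (f x - \<phi> n x) \<partial>M) < e / 4"
      by (auto simp: eventually_sequentially)
    from order_tendstoD(2)[OF lim[of n], of "e / 4"] e
    have "\<forall>\<^sub>F s in at_right 0. (\<integral>x. norm (T s (\<phi> n) x - \<phi> n x) \<partial>M) < e / 4" by simp
    moreover have "\<forall>\<^sub>F s in at_right 0. 0 < (s::real)" by (simp add: eventually_at_right_less)
    ultimately show "\<forall>\<^sub>F s in at_right 0. (\<integral>x. norm (T s f x - f x) \<partial>M) < e"
    proof eventually_elim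
      case (elim s)
      then show ?case using step[OF elim(2), of n] n e by linarith
    qed
  next
    fix e :: real assume e: "e < 0"
    show "\<forall>\<^sub>F s in at_right 0. e < (\<integral>x. norm (T s f x - f x) \<partial>M)"
      by (intro always_eventually allI less_le_trans[OF e]) simp
  qed
  then show ?thesis unfolding T_def .
qed

text \<open>Lebesgue measurability supplies continuous functions converging almost everywhere.
  Composing with the nearest-point map onto the closed ball of radius B keeps them continuous,
  bounds them uniformly, and fixes limits that already lie in the ball.\<close>

lemma bounded_measurable_approx_continuous:
  fixes f :: "real ^ 'd \<Rightarrow> complex"
  assumes f: "f \<in> borel_measurable borel" and B: "0 \<le> B"
  shows "\<exists>\<phi>. (\<forall>n. continuous_on UNIV (\<phi> n)) \<and> (\<forall>n x. norm (\<phi> n x) \<le> B) \<and>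
    (AE x in lborel. norm (f x) \<le> B \<longrightarrow> (\<lambda>n. \<phi> n x :: complex) \<longlonglongrightarrow> f x)"
proof -
  have "f \<in> borel_measurable (lebesgue_on UNIV)"
    using f by (simp add: measurable_completion lebesgue_on_UNIV_eq)
  then have "f measurable_on UNIV" by (subst measurable_on_iff_borel_measurable) auto
  then obtain N g where N: "negligible N" and g: "\<And>n. continuous_on UNIV (g n)"
    "\<And>x. x \<notin> N \<Longrightarrow> (\<lambda>n. g n x) \<longlonglongrightarrow> f x"
    unfolding measurable_on_def by auto
  let ?p = "closest_point (cball (0::complex) B)"
  have ne: "cball (0::complex) B \<noteq> {}" using B by auto
  have pc: "continuous_on UNIV ?p" by (rule continuous_on_closest_point) (use ne in auto)
  have "AE x in lebesgue. x \<notin> N"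
    using N by (intro AE_not_in) (simp add: negligible_iff_null_sets)
  then have AEN: "AE x in lborel. x \<notin> N" by (simp add: AE_completion_iff)
  show ?thesis
  proof (intro exI[of _ "\<lambda>n x. ?p (g n x)"] conjI allI)
    show "continuous_on UNIV (\<lambda>x. ?p (g n x))" for n
      by (rule continuous_on_compose2[OF pc g(1)]) auto
    show "norm (?p (g n x)) \<le> B" for n x
      using closest_point_in_set[of "cball (0::complex) B" "g n x"] ne by simp
    show "AE x in lborel. norm (f x) \<le> B \<longrightarrow> (\<lambda>n. ?p (g n x)) \<longlonglongrightarrow> f x"
      using AEN
    proof (eventually_elim, intro impI)
      fix x assume x: "x \<notin> N" "norm (f x) \<le> B"
      have "(\<lambda>n. ?p (g n x)) \<longlonglongrightarrow> ?p (f x)"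
        by (rule continuous_on_tendsto_compose[OF pc g(2)[OF x(1)]]) auto
      moreover have "?p (f x) = f x" using x(2) by (intro closest_point_self) simp
      ultimately show "(\<lambda>n. ?p (g n x)) \<longlonglongrightarrow> f x" by simp
    qed
  qed
qed

section \<open>Differentiation under the integral and finite differences\<close>

text \<open>In this form a derivative can be tested along sequences, as dominated convergence
  requires.\<close>

lemma has_vector_derivative_at_iff_quotient:
  fixes f :: "real \<Rightarrow> 'b::real_normed_vector"
  shows "(f has_vector_derivative D) (at t) \<longleftrightarrow> ((\<lambda>y. (f y - f t) /\<^sub>R (y - t)) \<longlongrightarrow> D) (at t)"
proof -
  have "(f has_vector_derivative D) (at t) \<longleftrightarrow>
     ((\<lambda>y. norm (f y - f t - (y - t) *\<^sub>R D) / norm (y - t)) \<longlongrightarrow> 0) (at t)"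
    unfolding has_vector_derivative_def has_derivative_iff_norm
    by (simp add: bounded_linear_scaleR_left)
  also have "\<dots> \<longleftrightarrow> ((\<lambda>y. norm ((f y - f t) /\<^sub>R (y - t) - D)) \<longlongrightarrow> 0) (at t)"
  proof (rule tendsto_cong, unfold eventually_at_filter, intro always_eventually allI impI)
    fix y assume "y \<noteq> t"
    then have "(f y - f t) /\<^sub>R (y - t) - D = (f y - f t - (y - t) *\<^sub>R D) /\<^sub>R (y - t)"
      by (simp add: scaleR_diff_right)
    then show "norm (f y - f t - (y - t) *\<^sub>R D) / norm (y - t) = norm ((f y - f t) /\<^sub>R (y - t) - D)"
      by (simp add: divide_inverse mult.commute)
  qed
  also have "\<dots> \<longleftrightarrow> ((\<lambda>y. (f y - f t) /\<^sub>R (y - t)) \<longlongrightarrow> D) (at t)"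
    by (simp add: tendsto_norm_zero_iff LIM_zero_iff)
  finally show ?thesis .
qed

lemma norm_diff_le_of_vector_derivative_bound:
  fixes f :: "real \<Rightarrow> 'b::real_normed_vector"
  assumes der: "\<And>u. a < u \<Longrightarrow> u < b \<Longrightarrow> (f has_vector_derivative f' u) (at u)"
    and bnd: "\<And>u. a < u \<Longrightarrow> u < b \<Longrightarrow> norm (f' u) \<le> B"
    and x: "a < x" "x < b" and y: "a < y" "y < b"
  shows "norm (f x - f y) \<le> B * \<bar>x - y\<bar>"
proof -
  have "norm (f x - f y) \<le> B * norm (x - y)"
  proof (rule differentiable_bound[of "{a<..<b}" f "\<lambda>u h. h *\<^sub>R f' u"])
    show "(f has_derivative (\<lambda>h. h *\<^sub>R f' u)) (at u within {a<..<b})" if "u \<in> {a<..<b}" for u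
      using der[of u] that by (auto simp: has_vector_derivative_def intro: has_derivative_at_withinI)
    show "onorm (\<lambda>h. h *\<^sub>R f' u) \<le> B" if "u \<in> {a<..<b}" for u
      using mult_right_mono[OF bnd[of u] abs_ge_zero] that
      by (intro onorm_le) (auto simp: mult.commute)
  qed (use x y in auto)
  then show ?thesis by simp
qed

text \<open>By the mean value inequality the majorant of the derivative also dominates every
  difference quotient, so dominated convergence applies along any sequence tending to t.\<close>

lemma has_vector_derivative_integral_dominated:
  fixes F :: "real \<Rightarrow> 'a \<Rightarrow> 'b::{banach, second_countable_topology}"
  assumes t: "a < t" "t < b"
    and int: "\<And>u. a < u \<Longrightarrow> u < b \<Longrightarrow> integrable M (F u)"
    and der: "\<And>u y. a < u \<Longrightarrow> u < b \<Longrightarrow> y \<in> space M \<Longrightarrow>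
      ((\<lambda>u. F u y) has_vector_derivative F' u y) (at u)"
    and meas: "F' t \<in> borel_measurable M"
    and bnd: "\<And>u y. a < u \<Longrightarrow> u < b \<Longrightarrow> y \<in> space M \<Longrightarrow> norm (F' u y) \<le> \<Phi> y"
    and \<Phi>: "integrable M \<Phi>"
  shows "((\<lambda>u. \<integral>y. F u y \<partial>M) has_vector_derivative (\<integral>y. F' t y \<partial>M)) (at t)"
  unfolding has_vector_derivative_at_iff_quotient
proof (subst tendsto_at_iff_sequentially, intro allI impI)
  fix X :: "nat \<Rightarrow> real" assume X: "\<forall>i. X i \<in> UNIV - {t}" "X \<longlonglongrightarrow> t"
  have "\<forall>\<^sub>F i in sequentially. X i \<in> {a<..<b}"
    by (rule topological_tendstoD[OF X(2)]) (use t in auto)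
  \<comment> \<open>The sequence is shifted by N so that all its members lie in the interval where
    the bounds hold.\<close>
  then obtain N where N: "\<And>i. i \<ge> N \<Longrightarrow> a < X i \<and> X i < b"
    by (auto simp: eventually_sequentially)
  let ?q = "\<lambda>i y. (F (X (i + N)) y - F t y) /\<^sub>R (X (i + N) - t)"
  have XN: "(\<lambda>i. X (i + N)) \<longlonglongrightarrow> t" using X(2) by (rule LIMSEQ_ignore_initial_segment)
  have "(\<lambda>i. \<integral>y. ?q i y \<partial>M) \<longlonglongrightarrow> (\<integral>y. F' t y \<partial>M)"
  proof (rule integral_dominated_convergence[where w = \<Phi>])
    show "F' t \<in> borel_measurable M" "integrable M \<Phi>" by fact+
    show "?q i \<in> borel_measurable M" for i
      using int[of t] int[of "X (i + N)"] N[of "i + N"] t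
      by (intro borel_measurable_scaleR borel_measurable_diff) auto
    show "AE y in M. (\<lambda>i. ?q i y) \<longlonglongrightarrow> F' t y"
    proof (rule AE_I2)
      fix y assume "y \<in> space M"
      then have "((\<lambda>u. (F u y - F t y) /\<^sub>R (u - t)) \<longlongrightarrow> F' t y) (at t)"
        using der[OF t] by (simp add: has_vector_derivative_at_iff_quotient)
      then show "(\<lambda>i. ?q i y) \<longlonglongrightarrow> F' t y"
        using X(1) XN by (auto simp: tendsto_at_iff_sequentially comp_def)
    qed
    show "AE y in M. norm (?q i y) \<le> \<Phi> y" for i
    proof (rule AE_I2)
      fix y assume y: "y \<in> space M"
      have "norm (F (X (i + N)) y - F t y) \<le> \<Phi> y * \<bar>X (i + N) - t\<bar>"
        by (rule norm_diff_le_of_vector_derivative_bound[where a = a and b = b and f' = "\<lambda>u. F' u y"])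
          (use der y bnd N[of "i + N"] t in auto)
      then show "norm (?q i y) \<le> \<Phi> y"
        using X(1) by (simp add: divide_inverse[symmetric] pos_divide_le_eq mult.commute[of "inverse _"])
    qed
  qed
  moreover have "(\<integral>y. ?q i y \<partial>M) = ((\<integral>y. F (X (i + N)) y \<partial>M) - (\<integral>y. F t y \<partial>M)) /\<^sub>R (X (i + N) - t)" for i
    using int[of t] int[of "X (i + N)"] N[of "i + N"] t
    by (subst integral_scaleR_right) (simp add: Bochner_Integration.integral_diff)
  ultimately have "(\<lambda>i. ((\<integral>y. F (X (i + N)) y \<partial>M) - (\<integral>y. F t y \<partial>M)) /\<^sub>R (X (i + N) - t)) \<longlonglongrightarrow> (\<integral>y. F' t y \<partial>M)"
    by (simp only:)
  then show "((\<lambda>u. ((\<integral>y. F u y \<partial>M) - (\<integral>y. F t y \<partial>M)) /\<^sub>R (u - t)) \<circ> X) \<longlonglongrightarrow> (\<integral>y. F' t y \<partial>M)"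
    unfolding comp_def by (rule LIMSEQ_offset)
qed

text \<open>Differentiation is local, so agreement with the chain U on the open half-line passes
  from one derivative to the next. This connects iterated \<open>vector_derivative\<close> with
  explicit formulas.\<close>

lemma funpow_vector_derivative_eq:
  fixes w :: "real \<Rightarrow> 'b::real_normed_vector"
  assumes der: "\<And>i t. i < m \<Longrightarrow> 0 < t \<Longrightarrow> (U i has_vector_derivative U (Suc i) t) (at t)"
    and w: "\<And>t. 0 < t \<Longrightarrow> w t = U 0 t"
    and "0 < t"
  shows "((\<lambda>g u. vector_derivative g (at u)) ^^ m) w t = U m t"
  using der \<open>0 < t\<close>
proof (induction m arbitrary: t)
  case 0
  then show ?case using w by simp
next
  case (Suc m)
  let ?D = "(\<lambda>g u. vector_derivative g (at u)) ^^ m"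
  have "(?D w has_vector_derivative U (Suc m) t) (at t)"
    by (rule has_vector_derivative_transform_within_open[OF Suc.prems(1)[OF lessI], where S = "{0<..}"])
      (use Suc in auto)
  then show ?case by (simp add: vector_derivative_at)
qed

text \<open>This is what \<open>Q\<^sub>s - I\<close> with \<open>Q\<^sub>s = c P\<^sub>s\<close> becomes on the orbits \<open>t \<mapsto> P\<^sub>t f x\<close>.\<close>

definition wdiff :: "real \<Rightarrow> real \<Rightarrow> (real \<Rightarrow> 'b::real_vector) \<Rightarrow> real \<Rightarrow> 'b" where
  "wdiff c s g t = c *\<^sub>R g (t + s) - g t"

abbreviation fdiff :: "real \<Rightarrow> (real \<Rightarrow> 'b::real_vector) \<Rightarrow> real \<Rightarrow> 'b" where
  "fdiff \<equiv> wdiff 1"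

section \<open>Iterated weighted differences\<close>

lemma funpow_wdiff_linear:
  "(wdiff c s ^^ k) (\<lambda>t. a *\<^sub>R g t - b *\<^sub>R h t) =
    (\<lambda>t. a *\<^sub>R (wdiff c s ^^ k) g t - b *\<^sub>R (wdiff c s ^^ k) h t)"
proof (induction k)
  case (Suc k)
  show ?case
    unfolding funpow.simps comp_apply Suc
    by (rule ext) (simp add: wdiff_def algebra_simps)
qed simp

lemma funpow_wdiff_cong_pos:
  assumes "\<And>t. 0 < t \<Longrightarrow> g t = h t" "0 \<le> s" "0 < t"
  shows "(wdiff c s ^^ k) g t = (wdiff c s ^^ k) h t"
  using assms(3)
proof (induction k arbitrary: t)
  case (Suc k)
  then show ?case using Suc.IH[of "t + s"] assms(2) by (simp add: wdiff_def)
qed (use assms in simp)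

lemma has_vector_derivative_funpow_wdiff:
  fixes g :: "real \<Rightarrow> 'b::real_normed_vector"
  assumes "\<And>t. 0 < t \<Longrightarrow> (g has_vector_derivative g' t) (at t)" "0 \<le> s" "0 < t"
  shows "((wdiff c s ^^ k) g has_vector_derivative (wdiff c s ^^ k) g' t) (at t)"
  using assms(3)
proof (induction k arbitrary: t)
  case (Suc k)
  have "((\<lambda>t. (wdiff c s ^^ k) g (t + s)) has_vector_derivative (wdiff c s ^^ k) g' (t + s)) (at t)"
    using vector_diff_chain_at[of "\<lambda>t. t + s" 1 t "(wdiff c s ^^ k) g" "(wdiff c s ^^ k) g' (t + s)", OF has_vector_derivative_add_const[THEN iffD2, OF has_vector_derivative_id]]
      Suc.IH[of "t + s"] Suc.prems assms(2)
    by (simp add: comp_def)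
  moreover have "((wdiff c s ^^ k) g has_vector_derivative (wdiff c s ^^ k) g' t) (at t)"
    using Suc by simp
  ultimately have "((\<lambda>t. c *\<^sub>R (wdiff c s ^^ k) g (t + s) - (wdiff c s ^^ k) g t) has_vector_derivative
     c *\<^sub>R (wdiff c s ^^ k) g' (t + s) - (wdiff c s ^^ k) g' t) (at t)"
    by (intro has_vector_derivative_diff bounded_linear.has_vector_derivative[OF bounded_linear_scaleR_right])
  then show ?case by (simp add: wdiff_def[abs_def])
qed (use assms in simp)

text \<open>The estimate without cancellation: each difference at most doubles a bound valid to the
  right of t0.\<close>

lemma norm_funpow_wdiff_le:
  fixes g :: "real \<Rightarrow> 'b::real_normed_vector"
  assumes "\<And>t. 0 < t \<Longrightarrow> t0 \<le> t \<Longrightarrow> norm (g t) \<le> B" "0 \<le> s" "\<bar>c\<bar> \<le> 1" "0 < t" "t0 \<le> t"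
  shows "norm ((wdiff c s ^^ k) g t) \<le> 2 ^ k * B"
  using assms(4,5)
proof (induction k arbitrary: t)
  case (Suc k)
  let ?g = "(wdiff c s ^^ k) g"
  have "norm (?g (t + s)) \<le> 2 ^ k * B" "norm (?g t) \<le> 2 ^ k * B"
    using Suc assms(2) by auto
  moreover have "norm (c *\<^sub>R ?g (t + s)) \<le> norm (?g (t + s))"
    using assms(3) by (simp add: mult_left_le_one_le)
  ultimately have "norm (c *\<^sub>R ?g (t + s) - ?g t) \<le> 2 ^ k * B + 2 ^ k * B"
    by (intro order_trans[OF norm_triangle_ineq4] add_mono) auto
  then show ?case by (simp add: wdiff_def[of c s ?g] mult.assoc mult.commute)
qed (use assms in simp)

text \<open>Expanding \<open>(c \<tau>\<^sub>s - I)\<^sup>k = (c (\<tau>\<^sub>s - I) - (1 - c) I)\<^sup>k\<close> costs a factor \<open>\<sigma>\<close> for every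
  occurrence of \<open>1 - c\<close>.\<close>

lemma norm_funpow_wdiff_le_fdiff:
  fixes g :: "real \<Rightarrow> 'b::real_normed_vector"
  assumes "0 \<le> c" "c \<le> 1" "1 - c \<le> \<sigma>" "0 < \<sigma>"
    and "\<And>i. i \<le> k \<Longrightarrow> \<sigma> ^ (k - i) * norm ((fdiff s ^^ i) g t) \<le> X"
  shows "norm ((wdiff c s ^^ k) g t) \<le> 2 ^ k * X"
  using assms(5)
proof (induction k arbitrary: g X)
  case (Suc k)
  have "(wdiff c s ^^ Suc k) g t = (wdiff c s ^^ k) (wdiff c s g) t"
    by (simp add: funpow_swap1)
  also have "wdiff c s g = (\<lambda>t. c *\<^sub>R fdiff s g t - (1 - c) *\<^sub>R g t)"
    by (rule ext) (simp add: wdiff_def algebra_simps)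
  finally have eq: "(wdiff c s ^^ Suc k) g t =
      c *\<^sub>R (wdiff c s ^^ k) (fdiff s g) t - (1 - c) *\<^sub>R (wdiff c s ^^ k) g t"
    by (simp add: funpow_wdiff_linear)
  have 1: "norm ((wdiff c s ^^ k) (fdiff s g) t) \<le> 2 ^ k * X"
  proof (rule Suc.IH)
    fix i assume "i \<le> k"
    then show "\<sigma> ^ (k - i) * norm ((fdiff s ^^ i) (fdiff s g) t) \<le> X"
      using Suc.prems[of "Suc i"] by (simp add: funpow_swap1)
  qed
  \<comment> \<open>For g itself the hypothesis carries one power of sigma more than the induction
    asks for. Dividing by it gives X / sigma, and the factor 1 - c <= sigma in front restores
    X.\<close>
  have 2: "norm ((wdiff c s ^^ k) g t) \<le> 2 ^ k * (X / \<sigma>)"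
  proof (rule Suc.IH)
    fix i assume "i \<le> k"
    then show "\<sigma> ^ (k - i) * norm ((fdiff s ^^ i) g t) \<le> X / \<sigma>"
      using Suc.prems[of i] assms(4) by (simp add: Suc_diff_le field_simps)
  qed
  have "norm ((wdiff c s ^^ Suc k) g t) \<le> norm (c *\<^sub>R (wdiff c s ^^ k) (fdiff s g) t) +
      norm ((1 - c) *\<^sub>R (wdiff c s ^^ k) g t)"
    unfolding eq by (rule norm_triangle_ineq4)
  also have "\<dots> \<le> 1 * (2 ^ k * X) + \<sigma> * (2 ^ k * (X / \<sigma>))"
    unfolding norm_scaleR using 1 2 assms(1-4) by (intro add_mono mult_mono) auto
  also have "\<dots> = 2 ^ Suc k * X" using assms(4) by simp
  finally show ?case .
qed simp

text \<open>The power u^(-p) is split into u^(b - p) <= t^(b - p) and u^(-b) <= (u - t)^(-b). The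
  second has an integrable singularity at t because b < 1. The parameter b decides how the decay is
  shared between t and s.\<close>

lemma norm_diff_le_of_power_derivative_bound:
  fixes h :: "real \<Rightarrow> 'b::real_normed_vector"
  assumes der: "\<And>u. t \<le> u \<Longrightarrow> (h has_vector_derivative h' u) (at u)"
    and bnd: "\<And>u. t \<le> u \<Longrightarrow> norm (h' u) \<le> A * u powr (- p)"
    and b: "0 \<le> b" "b < 1" "b \<le> p" and t: "0 < t" and s: "0 < s" and A: "0 \<le> A"
  shows "norm (h (t + s) - h t) \<le> A / (1 - b) * t powr (b - p) * s powr (1 - b)"
proof -
  let ?\<phi> = "\<lambda>u. A / (1 - b) * t powr (b - p) * (u - t) powr (1 - b)"
  have "norm (h (t + s) - h t) \<le> ?\<phi> (t + s) - ?\<phi> t"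
  proof (rule differentiable_bound_general[where f' = h' and \<phi>' = "\<lambda>u. A * t powr (b - p) * (u - t) powr (- b)"])
    show "t < t + s" using s by simp
    show "continuous_on {t..t + s} h"
      using der by (auto intro!: continuous_at_imp_continuous_on has_vector_derivative_continuous)
    show "continuous_on {t..t + s} ?\<phi>"
      using b by (auto intro!: continuous_intros continuous_on_powr')
  next
    fix u assume u: "t < u" "u < t + s"
    show "(h has_vector_derivative h' u) (at u)" using der u by simp
    have "(?\<phi> has_real_derivative A * t powr (b - p) * (u - t) powr (- b)) (at u)"
    proof -
      have "((\<lambda>u. u - t) has_real_derivative 1) (at u)" by (auto intro!: derivative_eq_intros)
      from DERIV_chain2[OF has_real_derivative_powr[of "u - t" "1 - b"] this] u
      have "((\<lambda>u. (u - t) powr (1 - b)) has_real_derivative (1 - b) * (u - t) powr (- b)) (at u)"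
        by simp
      from DERIV_cmult[OF this, of "A / (1 - b) * t powr (b - p)"] show ?thesis
        using b by (simp add: mult.assoc)
    qed
    then show "(?\<phi> has_vector_derivative A * t powr (b - p) * (u - t) powr (- b)) (at u)"
      by (simp add: has_real_derivative_iff_has_vector_derivative)
    have "u powr (- p) \<le> t powr (b - p) * (u - t) powr (- b)"
    proof -
      have "u powr (- p) = u powr (b - p) * u powr (- b)"
        by (simp add: powr_add[symmetric])
      also have "\<dots> \<le> t powr (b - p) * (u - t) powr (- b)"
        using u t b by (intro mult_mono powr_mono2') auto
      finally show ?thesis .
    qed
    then show "norm (h' u) \<le> A * t powr (b - p) * (u - t) powr (- b)"
      using bnd[of u] u A mult_left_mono[of "u powr (- p)" "t powr (b - p) * (u - t) powr (- b)" A]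
      by (simp add: mult.assoc)
  qed
  then show ?thesis by simp
qed

text \<open>Each difference uses up one derivative and gains s^(1 - b). The family U is general in
  the induction because the derivative of an i-fold difference is the i-fold difference of the next
  member.\<close>

lemma norm_funpow_fdiff_le:
  fixes U :: "nat \<Rightarrow> real \<Rightarrow> 'b::real_normed_vector"
  assumes "\<And>j u. j < i \<Longrightarrow> 0 < u \<Longrightarrow> (U j has_vector_derivative U (Suc j) u) (at u)"
    and "\<And>u. 0 < u \<Longrightarrow> norm (U i u) \<le> A * u powr (- p)"
    and b: "0 \<le> b" "b < 1" and "real i * b \<le> p" and t: "0 < t" and s: "0 < s" and A: "0 \<le> A"
  shows "norm ((fdiff s ^^ i) (U 0) t) \<le> A / (1 - b) ^ i * t powr (real i * b - p) * s powr (real i * (1 - b))"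
  using assms(1,2,5) t
proof (induction i arbitrary: U t)
  case 0
  then show ?case using s by simp
next
  case (Suc i)
  let ?h = "(fdiff s ^^ i) (U 0)" and ?h' = "(fdiff s ^^ i) (U 1)"
  let ?A = "A / (1 - b) ^ i * s powr (real i * (1 - b))"
  have le: "real i * b \<le> p" using Suc.prems(3) b by (simp add: algebra_simps)
  have "norm (?h (t + s) - ?h t) \<le> ?A / (1 - b) * t powr (b - (p - real i * b)) * s powr (1 - b)"
  proof (rule norm_diff_le_of_power_derivative_bound[where h' = ?h'])
    fix u assume u: "t \<le> u"
    show "(?h has_vector_derivative ?h' u) (at u)"
      by (rule has_vector_derivative_funpow_wdiff) (use Suc.prems u s in auto)
    \<comment> \<open>The induction hypothesis is applied to the family shifted by one
      derivative.\<close>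
    have "norm (?h' u) \<le> A / (1 - b) ^ i * u powr (real i * b - p) * s powr (real i * (1 - b))"
      using Suc.IH[of "\<lambda>j. U (Suc j)" u] Suc.prems(1,2,4) u le by simp
    then show "norm (?h' u) \<le> ?A * u powr (- (p - real i * b))"
      by (simp add: mult_ac)
  qed (use b s A Suc.prems in \<open>auto simp: algebra_simps\<close>)
  also have "\<dots> = A / (1 - b) ^ Suc i * t powr (real (Suc i) * b - p) * s powr (real (Suc i) * (1 - b))"
    by (simp add: powr_add[symmetric] algebra_simps)
  finally show ?case by (simp add: wdiff_def[of 1 s ?h])
qed

text \<open>Written out instead of obtained by an existence statement because its linearity in C is
  needed: a common factor of all decay constants has to come out in front. The two branches are the
  two regimes of \<open>norm_fdiff_term_le\<close>; for i = 0 and zeta <= k the first applies, so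
  there is no division by zero.\<close>

definition wdiff_const :: "(nat \<Rightarrow> real \<Rightarrow> real) \<Rightarrow> nat \<Rightarrow> nat \<Rightarrow> real \<Rightarrow> real \<Rightarrow> real" where
  "wdiff_const C n k \<gamma> \<zeta> = 2 ^ k * (\<Sum>i\<le>k. if \<zeta> \<le> real (k - i) then 2 ^ i * C n (\<gamma> - \<zeta>)
     else C (n + i) (\<gamma> - real (k - i)) / ((\<zeta> - real (k - i)) / real i) ^ i)"

lemma wdiff_const_cmult: "wdiff_const (\<lambda>m \<theta>. C m \<theta> * N) n k \<gamma> \<zeta> = wdiff_const C n k \<gamma> \<zeta> * N"
  unfolding wdiff_const_def sum_distrib_right mult.assoc
  by (intro arg_cong[where f = "\<lambda>x. 2 ^ k * x"] sum.cong) auto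

text \<open>An orbit t -> P_t f(x) abstracted to its derivatives. Either theta = 0 or theta < m, so
  every bound is nonincreasing in t and a bound at t controls all later times.\<close>

locale decaying_derivatives =
  fixes U :: "nat \<Rightarrow> real \<Rightarrow> 'b::real_normed_vector" and C :: "nat \<Rightarrow> real \<Rightarrow> real" and \<beta> :: real
  assumes der: "\<And>m t. 0 < t \<Longrightarrow> (U m has_vector_derivative U (Suc m) t) (at t)"
    and decay: "\<And>m \<theta> t. 0 \<le> \<theta> \<Longrightarrow> \<theta> \<le> \<beta> \<Longrightarrow> \<theta> = 0 \<or> \<theta> < real m \<Longrightarrow> 0 < t \<Longrightarrow>
      norm (U m t) \<le> C m \<theta> * t powr (\<theta> - real m)"
    and C_nonneg: "\<And>m \<theta>. 0 \<le> C m \<theta>"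
begin

text \<open>The exponent zeta is collected from two sources: the k - i factors
  \<open>min 1 s\<close> and the i differences. If the former already reach zeta, the differences
  are bounded trivially; otherwise the deficit is spread evenly over the differences.\<close>

lemma norm_fdiff_term_le:
  assumes i: "i \<le> k" and \<zeta>: "0 < \<zeta>" "\<zeta> \<le> real k" "\<zeta> \<le> \<gamma>" and \<gamma>: "\<gamma> \<le> \<beta>"
    and n: "\<gamma> - \<zeta> < real n \<or> \<gamma> = \<zeta> \<and> \<zeta> < real k"
    and s: "0 < s" and t: "0 < t"
  shows "min 1 s ^ (k - i) * norm ((fdiff s ^^ i) (U n) t) \<le>
    (if \<zeta> \<le> real (k - i) then 2 ^ i * C n (\<gamma> - \<zeta>)
     else C (n + i) (\<gamma> - real (k - i)) / ((\<zeta> - real (k - i)) / real i) ^ i) *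
    t powr (\<gamma> - real n - \<zeta>) * s powr \<zeta>"
proof (cases "\<zeta> \<le> real (k - i)")
  case True
  \<comment> \<open>With a base at most 1 the exponent may be lowered from k - i to zeta; only
    afterwards is \<open>min 1 s\<close> replaced by s.\<close>
  have "min 1 s ^ (k - i) = min 1 s powr real (k - i)" using s by (simp add: powr_realpow)
  also have "\<dots> \<le> min 1 s powr \<zeta>" using True s by (intro powr_mono') auto
  also have "\<dots> \<le> s powr \<zeta>" using \<zeta> s by (intro powr_mono2) auto
  finally have 1: "min 1 s ^ (k - i) \<le> s powr \<zeta>" .
  have "norm (U n u) \<le> C n (\<gamma> - \<zeta>) * t powr (\<gamma> - real n - \<zeta>)" if "t \<le> u" for u
  proof -
    have "norm (U n u) \<le> C n (\<gamma> - \<zeta>) * u powr (\<gamma> - \<zeta> - real n)"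
      using decay[of "\<gamma> - \<zeta>" n u] that t \<zeta> \<gamma> n by auto
    also have "\<dots> \<le> C n (\<gamma> - \<zeta>) * t powr (\<gamma> - \<zeta> - real n)"
      using that t n C_nonneg by (intro mult_left_mono powr_mono2') auto
    finally show ?thesis by (simp add: algebra_simps)
  qed
  then have 2: "norm ((fdiff s ^^ i) (U n) t) \<le> 2 ^ i * (C n (\<gamma> - \<zeta>) * t powr (\<gamma> - real n - \<zeta>))"
    by (intro norm_funpow_wdiff_le[where t0 = t]) (use s t in auto)
  have "min 1 s ^ (k - i) * norm ((fdiff s ^^ i) (U n) t) \<le>
      s powr \<zeta> * (2 ^ i * (C n (\<gamma> - \<zeta>) * t powr (\<gamma> - real n - \<zeta>)))"
    by (rule mult_mono[OF 1 2]) auto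
  then show ?thesis using True by (simp add: mult_ac)
next
  case False
  define \<theta> where "\<theta> = \<zeta> - real (k - i)"
  \<comment> \<open>With 1 - b = theta / i, each of the i differences yields s^(theta / i), in total
    the missing s^theta.\<close>
  define b where "b = 1 - \<theta> / real i"
  define p where "p = real (n + i) - (\<gamma> - real (k - i))"
  have ki: "real (k - i) = real k - real i" using i by (simp add: of_nat_diff)
  have \<theta>: "0 < \<theta>" "\<theta> \<le> real i" using False \<zeta> by (auto simp: \<theta>_def ki)
  then have i0: "0 < real i" by simp
  have b: "0 \<le> b" "b < 1" "1 - b = \<theta> / real i" "real i * b = real i - \<theta>"
    using \<theta> i0 by (auto simp: b_def field_simps)
  have 2: "norm ((fdiff s ^^ i) (U (n + 0)) t) \<le> C (n + i) (\<gamma> - real (k - i)) / (1 - b) ^ i *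
      t powr (real i * b - p) * s powr (real i * (1 - b))"
  proof (rule norm_funpow_fdiff_le[where U = "\<lambda>j. U (n + j)"])
    \<comment> \<open>The exponent gamma - (k - i) is admissible at order n + i: it is nonnegative
      since k - i < zeta <= gamma, and it stays below n + i since gamma - k < n. In the case gamma =
      zeta the strict bound zeta < k secures the latter.\<close>
    show "norm (U (n + i) u) \<le> C (n + i) (\<gamma> - real (k - i)) * u powr - p" if "0 < u" for u
    proof -
      have "\<gamma> - real (k - i) - real (n + i) = - p" by (simp add: p_def)
      then show ?thesis
        using decay[of "\<gamma> - real (k - i)" "n + i" u] that False \<zeta> \<gamma> n i by (auto simp: ki)
    qed
    show "real i * b \<le> p" using b n \<theta> \<zeta> by (auto simp: p_def ki \<theta>_def)
  qed (use der b s t C_nonneg in auto)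
  have 1: "min 1 s ^ (k - i) \<le> s powr real (k - i)"
    using s by (simp add: powr_realpow power_mono)
  have "min 1 s ^ (k - i) * norm ((fdiff s ^^ i) (U n) t) \<le>
      s powr real (k - i) * (C (n + i) (\<gamma> - real (k - i)) / (1 - b) ^ i *
      t powr (real i * b - p) * s powr (real i * (1 - b)))"
    using 1 2 by (intro mult_mono) auto
  also have "\<dots> = C (n + i) (\<gamma> - real (k - i)) / (1 - b) ^ i * t powr (real i * b - p) *
      s powr (real (k - i) + real i * (1 - b))"
    by (simp add: powr_add)
  also have "real (k - i) + real i * (1 - b) = \<zeta>" using b i0 by (simp add: \<theta>_def)
  also have "real i * b - p = \<gamma> - real n - \<zeta>" using b by (simp add: p_def \<theta>_def)
  finally show ?thesis using False b by (simp add: \<theta>_def)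
qed

text \<open>The bounds on c give 1 - c <= \<open>min 1 s\<close>, the admissible sigma. Two choices
  matter later: gamma = zeta leaves t^(-n), hence uniformity in t for n = 0, and gamma = beta gives
  the sharp power of t.\<close>

lemma norm_wdiff_le:
  assumes \<zeta>: "0 < \<zeta>" "\<zeta> \<le> real k" "\<zeta> \<le> \<gamma>" and \<gamma>: "\<gamma> \<le> \<beta>"
    and n: "\<gamma> - \<zeta> < real n \<or> \<gamma> = \<zeta> \<and> \<zeta> < real k"
    and s: "0 < s" and t: "0 < t" and c: "0 \<le> c" "c \<le> 1" "1 - c \<le> s"
  shows "norm ((wdiff c s ^^ k) (U n) t) \<le> wdiff_const C n k \<gamma> \<zeta> * t powr (\<gamma> - real n - \<zeta>) * s powr \<zeta>"
proof -
  define K where "K = (\<lambda>i. if \<zeta> \<le> real (k - i) then 2 ^ i * C n (\<gamma> - \<zeta>)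
     else C (n + i) (\<gamma> - real (k - i)) / ((\<zeta> - real (k - i)) / real i) ^ i)"
  have K: "0 \<le> K i" for i using C_nonneg by (auto simp: K_def)
  have "norm ((wdiff c s ^^ k) (U n) t) \<le> 2 ^ k * ((\<Sum>i\<le>k. K i) * t powr (\<gamma> - real n - \<zeta>) * s powr \<zeta>)"
  proof (rule norm_funpow_wdiff_le_fdiff[where \<sigma> = "min 1 s"])
    fix i assume i: "i \<le> k"
    have "min 1 s ^ (k - i) * norm ((fdiff s ^^ i) (U n) t) \<le> K i * t powr (\<gamma> - real n - \<zeta>) * s powr \<zeta>"
      unfolding K_def by (rule norm_fdiff_term_le[OF i \<zeta> \<gamma> n s t])
    also have "K i \<le> (\<Sum>i\<le>k. K i)" using i K by (intro member_le_sum) auto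
    finally show "min 1 s ^ (k - i) * norm ((fdiff s ^^ i) (U n) t) \<le>
        (\<Sum>i\<le>k. K i) * t powr (\<gamma> - real n - \<zeta>) * s powr \<zeta>"
      by (simp add: mult_right_mono)
  qed (use s c in auto)
  then show ?thesis by (simp add: wdiff_const_def K_def mult_ac)
qed

end

section \<open>The subordination kernel\<close>

text \<open>The error function up to the factor sqrt pi / 2.\<close>

definition gauss_primitive :: "real \<Rightarrow> real" where
  "gauss_primitive x = (LBINT y=0..x. exp (- y\<^sup>2))"

lemma DERIV_gauss_primitive: "(gauss_primitive has_real_derivative exp (- x\<^sup>2)) (at x)"
proof -
  let ?a = "- \<bar>x\<bar> - 1" and ?b = "\<bar>x\<bar> + 1"
  have "((\<lambda>u. LBINT y=(0::real)..u. exp (- y\<^sup>2)) has_vector_derivative exp (- x\<^sup>2)) (at x within {?a..?b})"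
    by (rule interval_integral_FTC2) (auto intro!: continuous_intros)
  then have "((\<lambda>u. LBINT y=(0::real)..u. exp (- y\<^sup>2)) has_vector_derivative exp (- x\<^sup>2)) (at x)"
    by (subst (asm) at_within_interior) auto
  then show ?thesis
    by (simp add: has_real_derivative_iff_has_vector_derivative gauss_primitive_def[abs_def] zero_ereal_def)
qed

lemma gauss_primitive_0 [simp]: "gauss_primitive 0 = 0"
  by (simp add: gauss_primitive_def zero_ereal_def)

lemma gauss_primitive_minus: "gauss_primitive (- x) = - gauss_primitive x"
proof -
  have "((\<lambda>x. gauss_primitive x + gauss_primitive (- x)) has_real_derivative 0) (at y)" for y
    by (auto intro!: derivative_eq_intros DERIV_chain2[OF DERIV_gauss_primitive] DERIV_gauss_primitive)
  then have "gauss_primitive x + gauss_primitive (- x) = gauss_primitive 0 + gauss_primitive (- 0)"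
    by (intro DERIV_isconst_all) auto
  then show ?thesis by simp
qed

lemma tendsto_gauss_primitive_at_top: "(gauss_primitive \<longlongrightarrow> sqrt pi / 2) at_top"
proof -
  have "integrable lborel (\<lambda>x. indicator {0..} x *\<^sub>R exp (- x\<^sup>2) :: real)"
    and eq: "(\<integral>x. indicator {0..} x *\<^sub>R exp (- x\<^sup>2) \<partial>lborel) = sqrt pi / 2"
    using gaussian_moment_0 by (auto simp: has_bochner_integral_iff)
  from tendsto_integral_at_top[OF sets_lborel this(1)]
  have "((\<lambda>y. \<integral>x. indicator {..y} x *\<^sub>R (indicator {0..} x *\<^sub>R exp (- x\<^sup>2)) \<partial>lborel) \<longlongrightarrow> sqrt pi / 2) at_top"
    by (simp only: eq)
  moreover have "\<forall>\<^sub>F y in at_top. (\<integral>x. indicator {..y} x *\<^sub>R (indicator {0..} x *\<^sub>R exp (- x\<^sup>2)) \<partial>lborel) = gauss_primitive y"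
    using eventually_ge_at_top[of 0]
  proof eventually_elim
    case (elim y)
    then have "gauss_primitive y = (LBINT x:{0..y}. exp (- x\<^sup>2))"
      unfolding gauss_primitive_def zero_ereal_def by (rule interval_integral_Icc)
    then show ?case
      by (auto simp: set_lebesgue_integral_def intro!: Bochner_Integration.integral_cong split: split_indicator)
  qed
  ultimately show ?thesis by (rule Lim_transform_eventually)
qed

lemma tendsto_gauss_primitive_at_bot: "(gauss_primitive \<longlongrightarrow> - (sqrt pi / 2)) at_bot"
  using tendsto_minus[OF tendsto_gauss_primitive_at_top]
  by (subst filterlim_at_bot_mirror) (simp add: gauss_primitive_minus)

text \<open>The density of the one-sided stable law of index 1 / 2, whose Laplace transform is exp
  (- t sqrt lambda).\<close>

definition sub_kernel :: "real \<Rightarrow> real \<Rightarrow> real" where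
  "sub_kernel t s = t / (2 * sqrt pi) * exp (- t\<^sup>2 / (4 * s)) / s powr (3 / 2)"

lemma sub_kernel_measurable [measurable]: "(\<lambda>(t, s). sub_kernel t s) \<in> borel_measurable (borel \<Otimes>\<^sub>M borel)"
  unfolding sub_kernel_def by measurable

lemma sub_kernel_nonneg: "0 \<le> t \<Longrightarrow> 0 \<le> sub_kernel t s"
  by (simp add: sub_kernel_def)

lemma powr_three_halves: "0 \<le> s \<Longrightarrow> s powr (3 / 2) = s * sqrt s"
proof -
  assume "0 \<le> s"
  have "s powr (3 / 2) = s powr (1 + 1 / 2)" by simp
  also have "\<dots> = s * sqrt s" using \<open>0 \<le> s\<close> by (simp only: powr_add powr_half_sqrt powr_one)
  finally show ?thesis .
qed

text \<open>The substitution z = t / (2 sqrt s) makes the density Gaussian, which gives an explicit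
  primitive running from -1 at s = 0 to 0 at infinity.\<close>

lemma sub_kernel_integral:
  assumes t: "0 < t"
  shows "set_integrable lborel {0<..} (sub_kernel t)" "(LBINT s:{0<..}. sub_kernel t s) = 1"
proof -
  let ?F = "\<lambda>s. - (2 / sqrt pi) * gauss_primitive (t / (2 * sqrt s))"
  have lim0: "(?F \<longlongrightarrow> - (2 / sqrt pi) * (sqrt pi / 2)) (at_right 0)"
  proof (intro tendsto_intros filterlim_compose[OF tendsto_gauss_primitive_at_top])
    show "filterlim (\<lambda>s. t / (2 * sqrt s)) at_top (at_right 0)" using t by real_asymp
  qed
  have limi: "(?F \<longlongrightarrow> - (2 / sqrt pi) * gauss_primitive 0) at_top"
  proof (intro tendsto_intros isCont_tendsto_compose[where g = gauss_primitive])
    show "isCont gauss_primitive 0" by (rule DERIV_isCont[OF DERIV_gauss_primitive])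
    show "((\<lambda>s. t / (2 * sqrt s)) \<longlongrightarrow> 0) at_top" by real_asymp
  qed
  have der: "(?F has_real_derivative sub_kernel t s) (at s)" if s: "0 < s" for s
  proof -
    have "((\<lambda>s. t / (2 * sqrt s)) has_real_derivative - t / (4 * (s * sqrt s))) (at s)"
      using s by (auto intro!: derivative_eq_intros simp: field_simps power2_eq_square)
    from DERIV_cmult[OF DERIV_chain2[OF DERIV_gauss_primitive this], of "- (2 / sqrt pi)"]
    have "(?F has_real_derivative - (2 / sqrt pi) * (exp (- (t / (2 * sqrt s))\<^sup>2) * (- t / (4 * (s * sqrt s))))) (at s)" .
    also have "- (2 / sqrt pi) * (exp (- (t / (2 * sqrt s))\<^sup>2) * (- t / (4 * (s * sqrt s)))) = sub_kernel t s"
      using s by (simp add: sub_kernel_def powr_three_halves power_divide power_mult_distrib field_simps)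
    finally show ?thesis .
  qed
  have "isCont (sub_kernel t) s" if "0 < s" for s
    using that unfolding sub_kernel_def by (auto intro!: continuous_intros)
  note ftc = interval_integral_FTC_nonneg[of 0 \<infinity> ?F "sub_kernel t" "- 1" 0]
  have "set_integrable lborel (einterval 0 \<infinity>) (sub_kernel t)"
    "(LBINT s=0..\<infinity>. sub_kernel t s) = 0 - (- 1)"
    using ftc der \<open>\<And>s. 0 < s \<Longrightarrow> isCont (sub_kernel t) s\<close> lim0 limi t
    by (auto simp: zero_ereal_def ereal_tendsto_simps sub_kernel_nonneg)
  then show "set_integrable lborel {0<..} (sub_kernel t)" "(LBINT s:{0<..}. sub_kernel t s) = 1"
    by (simp_all add: zero_ereal_def interval_integral_to_infinity_eq)
qed

lemma sub_kernel_convolution: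
  assumes t: "0 < t" and \<tau>: "0 < \<tau>" and v: "0 < v"
  shows "set_integrable lborel {0<..<v} (\<lambda>r. sub_kernel t r * sub_kernel \<tau> (v - r))"
    "(LBINT r:{0<..<v}. sub_kernel t r * sub_kernel \<tau> (v - r)) = sub_kernel (t + \<tau>) v"
proof -
  let ?f = "\<lambda>r. sub_kernel t r * sub_kernel \<tau> (v - r)"
  \<comment> \<open>The exponents satisfy \<open>t\<^sup>2 / (4 r) + \<tau>\<^sup>2 / (4 (v - r)) = (t + \<tau>)\<^sup>2 / (4 v) + (Y (- 1) r)\<^sup>2\<close>
    and \<open>(Y 1 r)\<^sup>2 = (Y (- 1) r)\<^sup>2 + t \<tau> / v\<close>, so the integrand has an explicit primitive.\<close>
  define Y where "Y = (\<lambda>e r. (\<tau> * r + e * t * (v - r)) / (2 * sqrt (v * r * (v - r))))"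
  define c where "c = exp (- (t + \<tau>)\<^sup>2 / (4 * v)) / (2 * pi * (v * sqrt v))"
  let ?F = "\<lambda>r. c * (t + \<tau>) * gauss_primitive (Y (- 1) r) +
     c * (t - \<tau>) * exp (t * \<tau> / v) * gauss_primitive (Y 1 r)"
  have der: "(?F has_real_derivative ?f r) (at r)" if r: "0 < r" "r < v" for r
  proof -
    define q where "q = sqrt (v * r * (v - r))"
    have q: "0 < q" "q\<^sup>2 = v * r * (v - r)" using r v by (auto simp: q_def)
    have q3: "q ^ 3 = v * sqrt v * (r * sqrt r) * ((v - r) * sqrt (v - r))"
      using q r v by (simp add: power3_eq_cube power2_eq_square[symmetric] q(2))
        (simp add: q_def real_sqrt_mult)
    define X where "X = exp (- (Y (- 1) r)\<^sup>2)"
    have Y': "(Y e has_real_derivative v\<^sup>2 * (\<tau> * r - e * t * (v - r)) / (4 * q ^ 3)) (at r)" for e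
    proof -
      have num: "((\<lambda>r. \<tau> * r + e * t * (v - r)) has_real_derivative \<tau> - e * t) (at r)"
        by (auto intro!: derivative_eq_intros)
      have "((\<lambda>r. v * r * (v - r)) has_real_derivative v * (v - 2 * r)) (at r)"
        by (auto intro!: derivative_eq_intros simp: algebra_simps)
      from DERIV_chain2[OF DERIV_real_sqrt this]
      have "((\<lambda>r. sqrt (v * r * (v - r))) has_real_derivative inverse q / 2 * (v * (v - 2 * r))) (at r)"
        using q r v by (simp add: q_def)
      from DERIV_divide[OF num DERIV_cmult[OF this, of 2]] q(1)
      have "(Y e has_real_derivative ((\<tau> - e * t) * (2 * q) - 2 * (inverse q / 2 * (v * (v - 2 * r))) * (\<tau> * r + e * t * (v - r))) / (2 * q * (2 * q))) (at r)"
        unfolding Y_def q_def[symmetric] by (simp only: mult.commute)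
      also have "((\<tau> - e * t) * (2 * q) - 2 * (inverse q / 2 * (v * (v - 2 * r))) * (\<tau> * r + e * t * (v - r))) / (2 * q * (2 * q)) =
         ((\<tau> - e * t) * (2 * q\<^sup>2) - (\<tau> * r + e * t * (v - r)) * (v * (v - 2 * r))) / (4 * q ^ 3)"
      proof -
        have "(A * (2 * q) - 2 * (inverse q / 2 * w) * N) / (2 * q * (2 * q)) = (A * (2 * q\<^sup>2) - N * w) / (4 * q ^ 3)" for A w N
          using q(1) by (simp add: field_simps power2_eq_square power3_eq_cube)
        then show ?thesis .
      qed
      also have "(\<tau> - e * t) * (2 * q\<^sup>2) - (\<tau> * r + e * t * (v - r)) * (v * (v - 2 * r)) =
         v\<^sup>2 * (\<tau> * r - e * t * (v - r))"
        unfolding q(2) by (simp add: algebra_simps power2_eq_square)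
      finally show ?thesis .
    qed
    have Ysq: "(Y e r)\<^sup>2 = (\<tau> * r + e * t * (v - r))\<^sup>2 / (4 * (v * r * (v - r)))" for e
      by (simp add: Y_def power_divide power_mult_distrib q_def[symmetric] q(2))
    have "(Y 1 r)\<^sup>2 = (Y (- 1) r)\<^sup>2 + t * \<tau> / v"
      unfolding Ysq using r v by (simp add: divide_simps) (simp add: algebra_simps power2_eq_square)
    then have X: "exp (t * \<tau> / v) * exp (- (Y 1 r)\<^sup>2) = X"
      by (simp add: X_def exp_add[symmetric])
    have "(?F has_real_derivative
        c * (t + \<tau>) * (exp (- (Y (- 1) r)\<^sup>2) * (v\<^sup>2 * (\<tau> * r - - 1 * t * (v - r)) / (4 * q ^ 3))) +
        c * (t - \<tau>) * exp (t * \<tau> / v) * (exp (- (Y 1 r)\<^sup>2) * (v\<^sup>2 * (\<tau> * r - 1 * t * (v - r)) / (4 * q ^ 3)))) (at r)"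
      by (intro DERIV_add DERIV_cmult DERIV_chain2[OF DERIV_gauss_primitive] Y')
    also have "c * (t + \<tau>) * (exp (- (Y (- 1) r)\<^sup>2) * (v\<^sup>2 * (\<tau> * r - - 1 * t * (v - r)) / (4 * q ^ 3))) +
        c * (t - \<tau>) * exp (t * \<tau> / v) * (exp (- (Y 1 r)\<^sup>2) * (v\<^sup>2 * (\<tau> * r - 1 * t * (v - r)) / (4 * q ^ 3)))
      = c * X * v\<^sup>2 * ((t + \<tau>) * (\<tau> * r + t * (v - r)) + (t - \<tau>) * (\<tau> * r - t * (v - r))) / (4 * q ^ 3)"
      unfolding X_def[symmetric] X[symmetric] by (simp add: algebra_simps add_divide_distrib diff_divide_distrib)
    also have "\<dots> = c * X * v ^ 3 * t * \<tau> / (2 * q ^ 3)"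
      using q(1) by (simp add: algebra_simps power2_eq_square power3_eq_cube)
    also have "\<dots> = t * \<tau> / (4 * pi) * (exp (- (t + \<tau>)\<^sup>2 / (4 * v)) * X) / ((r * sqrt r) * ((v - r) * sqrt (v - r)))"
      unfolding q3 c_def using r v by (simp add: divide_simps) (simp add: power3_eq_cube)
    also have "exp (- (t + \<tau>)\<^sup>2 / (4 * v)) * X = exp (- t\<^sup>2 / (4 * r)) * exp (- \<tau>\<^sup>2 / (4 * (v - r)))"
    proof -
      have "- (t + \<tau>)\<^sup>2 / (4 * v) - (Y (- 1) r)\<^sup>2 = - t\<^sup>2 / (4 * r) - \<tau>\<^sup>2 / (4 * (v - r))"
        unfolding Ysq using r v by (simp add: divide_simps) (simp add: algebra_simps power2_eq_square)
      then show ?thesis by (simp add: X_def exp_add[symmetric])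
    qed
    also have "t * \<tau> / (4 * pi) * (exp (- t\<^sup>2 / (4 * r)) * exp (- \<tau>\<^sup>2 / (4 * (v - r)))) / ((r * sqrt r) * ((v - r) * sqrt (v - r))) = ?f r"
    proof -
      have "t * \<tau> / (4 * pi) = t / (2 * sqrt pi) * (\<tau> / (2 * sqrt pi))" by simp
      moreover have "a * b * (E * F) / (R * S) = a * E / R * (b * F / S)" for a b E F R S :: real by simp
      ultimately show ?thesis using r by (simp only: sub_kernel_def powr_three_halves)
    qed
    finally show ?thesis .
  qed
  have lim0: "(?F \<longlongrightarrow> c * (t + \<tau>) * (- (sqrt pi / 2)) + c * (t - \<tau>) * exp (t * \<tau> / v) * (sqrt pi / 2)) (at_right 0)"
  proof (intro tendsto_intros filterlim_compose[OF tendsto_gauss_primitive_at_top]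
      filterlim_compose[OF tendsto_gauss_primitive_at_bot])
    show "filterlim (Y (- 1)) at_bot (at_right 0)" unfolding Y_def using t \<tau> v by real_asymp
    show "filterlim (Y 1) at_top (at_right 0)" unfolding Y_def using t \<tau> v by real_asymp
  qed
  have limv: "(?F \<longlongrightarrow> c * (t + \<tau>) * (sqrt pi / 2) + c * (t - \<tau>) * exp (t * \<tau> / v) * (sqrt pi / 2)) (at_left v)"
  proof (intro tendsto_intros filterlim_compose[OF tendsto_gauss_primitive_at_top])
    show "filterlim (Y (- 1)) at_top (at_left v)" unfolding Y_def using t \<tau> v by real_asymp
    show "filterlim (Y 1) at_top (at_left v)" unfolding Y_def using t \<tau> v by real_asymp
  qed
  have cont: "isCont ?f r" if "0 < r" "r < v" for r
    using that unfolding sub_kernel_def by (auto intro!: continuous_intros)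
  let ?a = "c * (t + \<tau>) * (- (sqrt pi / 2)) + c * (t - \<tau>) * exp (t * \<tau> / v) * (sqrt pi / 2)"
  let ?b = "c * (t + \<tau>) * (sqrt pi / 2) + c * (t - \<tau>) * exp (t * \<tau> / v) * (sqrt pi / 2)"
  note ftc = interval_integral_FTC_nonneg[of 0 v ?F ?f ?a ?b]
  have "set_integrable lborel (einterval 0 v) ?f" "(LBINT r=0..v. ?f r) = ?b - ?a"
    using ftc der cont lim0 limv t \<tau> v
    by (auto simp: zero_ereal_def ereal_tendsto_simps sub_kernel_nonneg)
  moreover have "?b - ?a = sub_kernel (t + \<tau>) v"
  proof -
    \<comment> \<open>\<open>Y 1\<close> tends to plus infinity at both ends, so its term cancels;
      \<open>Y (- 1)\<close> runs from minus to plus infinity and contributes a jump of sqrt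
      pi.\<close>
    have "?b - ?a = c * (t + \<tau>) * sqrt pi" by simp
    also have "\<dots> = (t + \<tau>) * (sqrt pi / pi) / 2 * exp (- (t + \<tau>)\<^sup>2 / (4 * v)) / (v * sqrt v)"
      by (simp add: c_def mult_ac)
    also have "sqrt pi / pi = 1 / sqrt pi" by (simp add: sqrt_divide_self_eq inverse_eq_divide)
    finally show ?thesis using v by (simp add: sub_kernel_def powr_three_halves)
  qed
  ultimately show "set_integrable lborel {0<..<v} ?f" "(LBINT r:{0<..<v}. ?f r) = sub_kernel (t + \<tau>) v"
    using v by (simp_all add: zero_ereal_def interval_lebesgue_integral_def)
qed


section \<open>Time derivatives of the subordination kernel\<close>

lemma poly_bounded_by_gaussian:
  fixes p :: "real poly"
  assumes "0 < e"
  shows "\<exists>C\<ge>0. \<forall>z. \<bar>poly p z\<bar> \<le> C * exp (e * z\<^sup>2)"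
  using assms
proof (induction p arbitrary: e)
  case 0
  then show ?case by (intro exI[of _ 0]) auto
next
  case (pCons a p)
  from pCons.IH[of "e / 2"] pCons.prems obtain C where
    C: "0 \<le> C" "\<And>z. \<bar>poly p z\<bar> \<le> C * exp (e / 2 * z\<^sup>2)" by auto
  \<comment> \<open>Half of the exponent absorbs the leading factor z; the other half goes to the
    remaining polynomial through the induction hypothesis at e / 2.\<close>
  have z: "\<bar>z\<bar> \<le> (1 + 2 / e) * exp (e / 2 * z\<^sup>2)" for z
  proof -
    have "\<bar>z\<bar> \<le> 1 + z\<^sup>2"
      using zero_le_power2[of "\<bar>z\<bar> - 1"] zero_le_power2[of z] by (simp add: power2_eq_square algebra_simps)
    also have "\<dots> \<le> 1 + z\<^sup>2 + (2 / e + e / 2 * z\<^sup>2)"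
      using pCons.prems by simp
    also have "\<dots> = (1 + 2 / e) * (1 + e / 2 * z\<^sup>2)"
      using pCons.prems by (simp add: field_simps)
    also have "\<dots> \<le> (1 + 2 / e) * exp (e / 2 * z\<^sup>2)"
      using pCons.prems by (intro mult_left_mono exp_ge_add_one_self) auto
    finally show ?thesis .
  qed
  show ?case
  proof (intro exI[of _ "\<bar>a\<bar> + (1 + 2 / e) * C"] conjI allI)
    fix z
    have "\<bar>poly (pCons a p) z\<bar> \<le> \<bar>a\<bar> + \<bar>z\<bar> * \<bar>poly p z\<bar>"
      by (simp add: abs_mult[symmetric])
    also have "\<dots> \<le> \<bar>a\<bar> * exp (e * z\<^sup>2) + ((1 + 2 / e) * exp (e / 2 * z\<^sup>2)) * (C * exp (e / 2 * z\<^sup>2))"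
      using pCons.prems C z by (intro add_mono mult_mono) (auto simp: mult_le_cancel_left1)
    also have "((1 + 2 / e) * exp (e / 2 * z\<^sup>2)) * (C * exp (e / 2 * z\<^sup>2)) = (1 + 2 / e) * C * (exp (e / 2 * z\<^sup>2) * exp (e / 2 * z\<^sup>2))"
      by simp
    also have "exp (e / 2 * z\<^sup>2) * exp (e / 2 * z\<^sup>2) = exp (e * z\<^sup>2)"
      by (simp add: exp_add[symmetric])
    finally show "\<bar>poly (pCons a p) z\<bar> \<le> (\<bar>a\<bar> + (1 + 2 / e) * C) * exp (e * z\<^sup>2)"
      by (simp add: algebra_simps)
  qed (use C pCons.prems in auto)
qed

text \<open>Hermite-type polynomials: the m-th derivative of z exp (- z^2 / 4) / (2 sqrt pi) is the
  m-th of them times exp (- z^2 / 4).\<close>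

fun sub_poly :: "nat \<Rightarrow> real poly" where
  "sub_poly 0 = [:0, 1 / (2 * sqrt pi):]"
| "sub_poly (Suc m) = pderiv (sub_poly m) - smult (1 / 2) (pCons 0 (sub_poly m))"

text \<open>The kernel is h (t / sqrt s) / s for one profile h, so each derivative in t costs a
  further s^(- 1 / 2).\<close>

definition sub_kernel_deriv :: "nat \<Rightarrow> real \<Rightarrow> real \<Rightarrow> real" where
  "sub_kernel_deriv m t s = s powr (- 1 - real m / 2) * (poly (sub_poly m) (t / sqrt s) * exp (- (t / sqrt s)\<^sup>2 / 4))"

lemma sub_kernel_deriv_measurable [measurable]:
  "(\<lambda>(t, s). sub_kernel_deriv m t s) \<in> borel_measurable (borel \<Otimes>\<^sub>M borel)"
proof -
  have [measurable]: "poly (sub_poly m) \<in> borel_measurable borel"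
    by (intro borel_measurable_continuous_onI continuous_intros)
  show ?thesis unfolding sub_kernel_deriv_def by measurable
qed

lemma sub_kernel_deriv_0: "0 < s \<Longrightarrow> sub_kernel_deriv 0 t s = sub_kernel t s"
  by (simp add: sub_kernel_deriv_def sub_kernel_def powr_minus powr_three_halves power_divide field_simps)

lemma DERIV_sub_kernel_deriv:
  assumes "0 < s"
  shows "((\<lambda>t. sub_kernel_deriv m t s) has_real_derivative sub_kernel_deriv (Suc m) t s) (at t)"
proof -
  let ?p = "sub_poly m" and ?z = "t / sqrt s"
  have dz: "((\<lambda>t. t / sqrt s) has_real_derivative 1 / sqrt s) (at t)"
    by (rule DERIV_cdivide[OF DERIV_ident])
  have "((\<lambda>z. poly ?p z * exp (- z\<^sup>2 / 4)) has_real_derivative poly (sub_poly (Suc m)) ?z * exp (- ?z\<^sup>2 / 4)) (at ?z)"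
    by (auto intro!: derivative_eq_intros poly_DERIV simp: algebra_simps)
  from DERIV_cmult[OF DERIV_chain2[OF this dz], of "s powr (- 1 - real m / 2)"]
  have "((\<lambda>t. sub_kernel_deriv m t s) has_real_derivative
     s powr (- 1 - real m / 2) * (poly (sub_poly (Suc m)) ?z * exp (- ?z\<^sup>2 / 4) * (1 / sqrt s))) (at t)"
    unfolding sub_kernel_deriv_def .
  also have "s powr (- 1 - real m / 2) * (poly (sub_poly (Suc m)) ?z * exp (- ?z\<^sup>2 / 4) * (1 / sqrt s)) =
    (s powr (- 1 - real m / 2) * (1 / sqrt s)) * (poly (sub_poly (Suc m)) ?z * exp (- ?z\<^sup>2 / 4))"
    by (simp only: mult_ac)
  also have "s powr (- 1 - real m / 2) * (1 / sqrt s) = s powr (- 1 - real (Suc m) / 2)"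
  proof -
    have "1 / sqrt s = s powr (- 1 / 2)" using assms by (simp add: powr_minus_divide powr_half_sqrt)
    then show ?thesis by (simp add: powr_add[symmetric] add_divide_distrib)
  qed
  finally show ?thesis by (simp only: sub_kernel_deriv_def)
qed

text \<open>With z = t / sqrt s, pulling out t^(- m) leaves z^m times a polynomial. Half of the
  Gaussian exponent absorbs it, and the other half is the Gaussian of the kernel at time t / sqrt 2.
  The derivatives are thus dominated by a density of mass 1.\<close>

lemma sub_kernel_deriv_bound:
  "\<exists>C\<ge>0. \<forall>t>0. \<forall>s>0. \<bar>sub_kernel_deriv m t s\<bar> \<le> C * t powr (- real m) * sub_kernel (t / sqrt 2) s"
proof -
  \<comment> \<open>One factor z is kept because \<open>sub_kernel\<close> itself contains t. For m
    = 0 it is present in \<open>sub_poly 0\<close>; otherwise it is taken from z^m.\<close>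
  obtain r :: "real poly" where r: "\<And>z. z ^ m * poly (sub_poly m) z = z * poly r z"
  proof (cases m)
    case 0
    then show ?thesis by (intro that[of "[:1 / (2 * sqrt pi):]"]) simp
  next
    case (Suc j)
    then show ?thesis by (intro that[of "monom 1 j * sub_poly m"]) (simp add: poly_monom mult_ac)
  qed
  from poly_bounded_by_gaussian[of "1 / 8" r] obtain C where
    C: "0 \<le> C" "\<And>z. \<bar>poly r z\<bar> \<le> C * exp (z\<^sup>2 / 8)" by auto
  show ?thesis
  proof (intro exI[of _ "C * (2 * sqrt pi * sqrt 2)"] conjI allI impI)
    fix t s :: real assume t: "0 < t" and s: "0 < s"
    define z where "z = t / sqrt s"
    have z: "0 < z" "t = z * sqrt s" using t s by (auto simp: z_def)
    have sm: "s powr (- 1 - real m / 2) = t powr (- real m) * (z ^ m / s)"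
    proof -
      have "t powr (- real m) = z powr (- real m) * s powr (- real m / 2)"
        using s z by (simp add: powr_mult powr_half_sqrt[symmetric] powr_powr)
      moreover have "z powr (- real m) * z ^ m = 1"
        using z by (simp add: powr_minus powr_realpow)
      moreover have "s powr (- 1 - real m / 2) = s powr (- real m / 2) / s"
      proof -
        have "- 1 - real m / 2 = - real m / 2 - 1" by simp
        then show ?thesis using s by (simp only: powr_diff powr_one)
      qed
      ultimately show ?thesis by (metis (no_types, lifting) mult.assoc mult.commute mult.right_neutral times_divide_eq_right)
    qed
    have "\<bar>sub_kernel_deriv m t s\<bar> = t powr (- real m) * (\<bar>z ^ m * poly (sub_poly m) z\<bar> * exp (- z\<^sup>2 / 4) / s)"
      unfolding sub_kernel_deriv_def sm z_def[symmetric] using s z by (simp add: abs_mult)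
    also have "\<dots> = t powr (- real m) * (z * (\<bar>poly r z\<bar> * exp (- z\<^sup>2 / 4)) / s)"
      unfolding r using z by (simp add: abs_mult)
    also have "\<dots> \<le> t powr (- real m) * (z * (C * exp (z\<^sup>2 / 8) * exp (- z\<^sup>2 / 4)) / s)"
      using z s C(2)[of z] by (intro mult_left_mono divide_right_mono mult_right_mono) auto
    also have "C * exp (z\<^sup>2 / 8) * exp (- z\<^sup>2 / 4) = C * exp (- z\<^sup>2 / 8)"
      by (simp add: exp_add[symmetric] mult.assoc)
    also have "t powr (- real m) * (z * (C * exp (- z\<^sup>2 / 8)) / s) =
       C * (2 * sqrt pi * sqrt 2) * t powr - real m * sub_kernel (t / sqrt 2) s"
    proof -
      have "sub_kernel (t / sqrt 2) s = z / (sqrt 2 * (2 * sqrt pi)) * exp (- z\<^sup>2 / 8) / s"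
        using s by (simp add: sub_kernel_def z_def powr_three_halves power_divide mult_ac)
      then show ?thesis by simp
    qed
    finally show "\<bar>sub_kernel_deriv m t s\<bar> \<le> C * (2 * sqrt pi * sqrt 2) * t powr - real m * sub_kernel (t / sqrt 2) s" .
  qed (use C in auto)
qed

text \<open>Supplies one majorant for all times in an interval, as differentiation under the
  integral requires.\<close>

lemma sub_kernel_mono:
  assumes "0 < a" "a \<le> t" "t \<le> b" "0 < s"
  shows "sub_kernel t s \<le> b / a * sub_kernel a s"
proof -
  have "exp (- t\<^sup>2 / (4 * s)) \<le> exp (- a\<^sup>2 / (4 * s))"
    using assms by (auto intro!: divide_right_mono power_mono)
  then have "t * exp (- t\<^sup>2 / (4 * s)) \<le> b * exp (- a\<^sup>2 / (4 * s))"
    using assms by (intro mult_mono) auto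
  then show ?thesis
    using assms by (simp add: sub_kernel_def divide_right_mono)
qed

section \<open>Integration over the half-line and interchange of integrals\<close>

abbreviation half_line :: "real measure" where
  "half_line \<equiv> restrict_space lborel {0<..}"

lemma integrable_half_line:
  fixes f :: "real \<Rightarrow> 'b::{banach, second_countable_topology}"
  shows "integrable half_line f \<longleftrightarrow> set_integrable lborel {0<..} f"
  by (simp add: integrable_restrict_space set_integrable_def)

lemma integral_half_line:
  fixes f :: "real \<Rightarrow> 'b::{banach, second_countable_topology}"
  shows "(\<integral>s. f s \<partial>half_line) = (LINT s:{0<..}|lborel. f s)"
  by (simp add: integral_restrict_space set_lebesgue_integral_def)

lemma sigma_finite_half_line: "sigma_finite_measure half_line"
  by (rule sigma_finite_measure_restrict_space) (auto intro: lborel.sigma_finite_measure_axioms)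

lemma sets_half_line_id [measurable]: "(\<lambda>s. s) \<in> half_line \<rightarrow>\<^sub>M borel"
  by (rule measurable_restrict_space1) simp

lemma space_half_line [simp]: "space half_line = {0<..}"
  by (simp add: space_restrict_space)

lemma sub_kernel_half_line:
  assumes "0 < t"
  shows "integrable half_line (sub_kernel t)" "(\<integral>s. sub_kernel t s \<partial>half_line) = 1"
  using sub_kernel_integral[OF assms] by (simp_all add: integrable_half_line integral_half_line)

text \<open>The majorant depends on s alone and K is finite, so the inner norm integrals are bounded
  by a constant. The bound must hold for all s outside a single null set of y.\<close>

lemma Fubini_dominated:
  fixes F :: "'a \<Rightarrow> 'b \<Rightarrow> 'c::{banach, second_countable_topology}"
  assumes N: "sigma_finite_measure N" and K: "finite_measure K"
    and F[measurable]: "(\<lambda>(s, y). F s y) \<in> borel_measurable (N \<Otimes>\<^sub>M K)"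
    and bnd: "AE y in K. \<forall>s\<in>space N. norm (F s y) \<le> \<Phi> s" and \<Phi>: "integrable N \<Phi>"
  shows "(\<integral>y. (\<integral>s. F s y \<partial>N) \<partial>K) = (\<integral>s. (\<integral>y. F s y \<partial>K) \<partial>N)"
    "integrable K (\<lambda>y. \<integral>s. F s y \<partial>N)"
proof -
  interpret N: sigma_finite_measure N by fact
  interpret K: finite_measure K by fact
  interpret KN: pair_sigma_finite K N ..
  have F': "(\<lambda>(y, s). F s y) \<in> borel_measurable (K \<Otimes>\<^sub>M N)"
    by measurable
  have sec: "AE y in K. integrable N (\<lambda>s. F s y) \<and> (\<integral>s. norm (F s y) \<partial>N) \<le> (\<integral>s. \<Phi> s \<partial>N)"
    using bnd AE_space
  proof eventually_elim
    case (elim y)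
    then have int: "integrable N (\<lambda>s. F s y)"
      by (intro Bochner_Integration.integrable_bound[OF \<Phi>]) (auto intro!: AE_I2 order_trans[OF _ abs_ge_self])
    then show ?case using elim by (auto intro!: integral_mono \<Phi>)
  qed
  have int: "integrable (K \<Otimes>\<^sub>M N) (\<lambda>(y, s). F s y)"
  proof (rule KN.Fubini_integrable[OF F'])
    show "AE y in K. integrable N (\<lambda>s. case (y, s) of (y, s) \<Rightarrow> F s y)"
      using sec by eventually_elim simp
    show "integrable K (\<lambda>y. \<integral>s. norm (case (y, s) of (y, s) \<Rightarrow> F s y) \<partial>N)"
    proof (rule K.integrable_const_bound[where B = "\<integral>s. \<Phi> s \<partial>N"])
      show "AE y in K. norm (\<integral>s. norm (case (y, s) of (y, s) \<Rightarrow> F s y) \<partial>N) \<le> (\<integral>s. \<Phi> s \<partial>N)"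
        using sec by eventually_elim simp
      show "(\<lambda>y. \<integral>s. norm (case (y, s) of (y, s) \<Rightarrow> F s y) \<partial>N) \<in> borel_measurable K"
        using F' by measurable
    qed
  qed
  from KN.Fubini_integral[OF int] show "(\<integral>y. (\<integral>s. F s y \<partial>N) \<partial>K) = (\<integral>s. (\<integral>y. F s y \<partial>K) \<partial>N)"
    by simp
  from KN.integrable_fst[OF int] show "integrable K (\<lambda>y. \<integral>s. F s y \<partial>N)"
    by simp
qed

text \<open>The substitution v = r + s and Fubini reduce the double integral to the convolution of
  the densities. The majorant is the product of two probability densities times B.\<close>

lemma sub_kernel_convolution_integral:
  fixes H :: "real \<Rightarrow> 'b::{banach, second_countable_topology}"
  assumes t: "0 < t" and \<tau>: "0 < \<tau>" and H[measurable]: "H \<in> borel_measurable borel"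
    and B: "\<And>s. 0 < s \<Longrightarrow> norm (H s) \<le> B"
  shows "(\<integral>r. sub_kernel t r *\<^sub>R (\<integral>s. sub_kernel \<tau> s *\<^sub>R H (r + s) \<partial>half_line) \<partial>half_line) =
    (\<integral>v. sub_kernel (t + \<tau>) v *\<^sub>R H v \<partial>half_line)"
proof -
  let ?i = "\<lambda>s. indicator {0<..} s :: real"
  let ?F = "\<lambda>r v. (?i r * sub_kernel t r * (?i (v - r) * sub_kernel \<tau> (v - r))) *\<^sub>R (indicator {0<..} v *\<^sub>R H v)"
  have k: "integrable lborel (\<lambda>s. ?i s * sub_kernel t s)" "(\<integral>s. ?i s * sub_kernel t s \<partial>lborel) = 1" if "0 < t" for t
    using sub_kernel_integral[OF that] by (simp_all add: set_integrable_def set_lebesgue_integral_def)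
  have kv: "integrable lborel (\<lambda>v. ?i (v - r) * sub_kernel \<tau> (v - r))"
    "(\<integral>v. ?i (v - r) * sub_kernel \<tau> (v - r) \<partial>lborel) = 1" for r
    using k[OF \<tau>] lborel_integrable_real_affine[of "\<lambda>s. ?i s * sub_kernel \<tau> s" 1 "- r"]
      lborel_integral_real_affine[of 1 "\<lambda>s. ?i s * sub_kernel \<tau> s" "- r"] by simp_all
  have Fb: "norm (?F r v) \<le> ?i r * sub_kernel t r * (B * (?i (v - r) * sub_kernel \<tau> (v - r)))" for r v
    using mult_right_mono[OF B[of v], of "sub_kernel t r * sub_kernel \<tau> (v - r)"] t \<tau>
    by (auto simp: sub_kernel_nonneg mult_ac split: split_indicator)
  have Fm[measurable]: "(\<lambda>(r, v). ?F r v) \<in> borel_measurable (lborel \<Otimes>\<^sub>M lborel)" by measurable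
  have Fint: "integrable lborel (\<lambda>v. ?F r v)" for r
    by (rule Bochner_Integration.integrable_bound[where f = "\<lambda>v. ?i r * sub_kernel t r * (B * (?i (v - r) * sub_kernel \<tau> (v - r)))"])
      (use kv Fb in \<open>auto intro!: AE_I2 order_trans[OF _ abs_ge_self]\<close>)
  have int: "integrable (lborel \<Otimes>\<^sub>M lborel) (\<lambda>(r, v). ?F r v)"
  proof (rule lborel_pair.Fubini_integrable[OF Fm])
    show "AE r in lborel. integrable lborel (\<lambda>v. case (r, v) of (r, v) \<Rightarrow> ?F r v)"
      using Fint by simp
    show "integrable lborel (\<lambda>r. \<integral>v. norm (case (r, v) of (r, v) \<Rightarrow> ?F r v) \<partial>lborel)"
    proof (rule Bochner_Integration.integrable_bound[where f = "\<lambda>r. ?i r * sub_kernel t r * B"])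
      show "integrable lborel (\<lambda>r. ?i r * sub_kernel t r * B)" using k[OF t] by simp
      show "(\<lambda>r. \<integral>v. norm (case (r, v) of (r, v) \<Rightarrow> ?F r v) \<partial>lborel) \<in> borel_measurable lborel"
        by measurable
      show "AE r in lborel. norm (\<integral>v. norm (case (r, v) of (r, v) \<Rightarrow> ?F r v) \<partial>lborel) \<le> norm (?i r * sub_kernel t r * B)"
      proof (intro AE_I2)
        fix r
        have "(\<integral>v. norm (?F r v) \<partial>lborel) \<le> (\<integral>v. ?i r * sub_kernel t r * (B * (?i (v - r) * sub_kernel \<tau> (v - r))) \<partial>lborel)"
          by (rule integral_mono[OF integrable_norm[OF Fint]]) (use Fb kv in auto)
        also have "\<dots> = ?i r * sub_kernel t r * B" using kv by simp
        finally show "norm (\<integral>v. norm (case (r, v) of (r, v) \<Rightarrow> ?F r v) \<partial>lborel) \<le> norm (?i r * sub_kernel t r * B)"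
          by simp
      qed
    qed
  qed
  have "(\<integral>r. sub_kernel t r *\<^sub>R (\<integral>s. sub_kernel \<tau> s *\<^sub>R H (r + s) \<partial>half_line) \<partial>half_line) =
    (\<integral>r. ?i r *\<^sub>R (sub_kernel t r *\<^sub>R (\<integral>s. ?i s *\<^sub>R (sub_kernel \<tau> s *\<^sub>R H (r + s)) \<partial>lborel)) \<partial>lborel)"
    by (simp add: integral_half_line set_lebesgue_integral_def)
  also have "\<dots> = (\<integral>r. (\<integral>v. ?F r v \<partial>lborel) \<partial>lborel)"
  proof (rule Bochner_Integration.integral_cong[OF refl])
    fix r
    have "(\<integral>s. ?i s *\<^sub>R (sub_kernel \<tau> s *\<^sub>R H (r + s)) \<partial>lborel) =
      (\<integral>v. ?i (v - r) *\<^sub>R (sub_kernel \<tau> (v - r) *\<^sub>R H v) \<partial>lborel)"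
      using lborel_integral_real_affine[of 1 "\<lambda>s. ?i s *\<^sub>R (sub_kernel \<tau> s *\<^sub>R H (r + s))" "- r"] by simp
    then have "?i r *\<^sub>R (sub_kernel t r *\<^sub>R (\<integral>s. ?i s *\<^sub>R (sub_kernel \<tau> s *\<^sub>R H (r + s)) \<partial>lborel)) =
      (\<integral>v. (?i r * sub_kernel t r) *\<^sub>R (?i (v - r) *\<^sub>R (sub_kernel \<tau> (v - r) *\<^sub>R H v)) \<partial>lborel)"
      by (simp only: integral_scaleR_right) (simp only: scaleR_scaleR)
    also have "\<dots> = (\<integral>v. ?F r v \<partial>lborel)"
      by (rule Bochner_Integration.integral_cong) (auto split: split_indicator)
    finally show "?i r *\<^sub>R (sub_kernel t r *\<^sub>R (\<integral>s. ?i s *\<^sub>R (sub_kernel \<tau> s *\<^sub>R H (r + s)) \<partial>lborel)) =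
      (\<integral>v. ?F r v \<partial>lborel)" .
  qed
  also have "\<dots> = (\<integral>v. (\<integral>r. ?F r v \<partial>lborel) \<partial>lborel)"
    by (rule lborel_pair.Fubini_integral[OF int, symmetric])
  also have "\<dots> = (\<integral>v. ?i v *\<^sub>R (sub_kernel (t + \<tau>) v *\<^sub>R H v) \<partial>lborel)"
  proof (rule Bochner_Integration.integral_cong[OF refl])
    fix v
    have "(\<integral>r. ?F r v \<partial>lborel) = (\<integral>r. (indicator {0<..<v} r * (sub_kernel t r * sub_kernel \<tau> (v - r))) *\<^sub>R (indicator {0<..} v *\<^sub>R H v) \<partial>lborel)"
      by (rule Bochner_Integration.integral_cong) (auto split: split_indicator)
    also have "\<dots> = ?i v *\<^sub>R (sub_kernel (t + \<tau>) v *\<^sub>R H v)"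
    proof (cases "0 < v")
      case True
      then show ?thesis
        using sub_kernel_convolution[OF t \<tau> True]
        by (subst integral_scaleR_left) (auto simp: set_integrable_def set_lebesgue_integral_def)
    qed simp
    finally show "(\<integral>r. ?F r v \<partial>lborel) = ?i v *\<^sub>R (sub_kernel (t + \<tau>) v *\<^sub>R H v)" .
  qed
  also have "\<dots> = (\<integral>v. sub_kernel (t + \<tau>) v *\<^sub>R H v \<partial>half_line)"
    by (simp add: integral_half_line set_lebesgue_integral_def)
  finally show ?thesis .
qed

section \<open>Subordinated Markov semigroups\<close>

lemma (in prob_space) AE_bounded_integral:
  fixes f :: "'a \<Rightarrow> 'b::{banach, second_countable_topology}"
  assumes "f \<in> borel_measurable M" "AE x in M. norm (f x) \<le> B"
  shows "integrable M f" "norm (\<integral>x. f x \<partial>M) \<le> B"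
proof -
  show int: "integrable M f" by (rule integrable_const_bound[OF assms(2,1)])
  have "norm (\<integral>x. f x \<partial>M) \<le> (\<integral>x. norm (f x) \<partial>M)" by (rule integral_norm_bound)
  also have "\<dots> \<le> (\<integral>x. B \<partial>M)" using assms(2) int by (intro integral_mono_AE) auto
  finally show "norm (\<integral>x. f x \<partial>M) \<le> B" by (simp add: prob_space)
qed

text \<open>Mass and composition laws hold at every point, not just almost everywhere, so that
  orbits exist for each fixed x. Behaviour at time 0 is assumed only in mean; symmetry of the
  Laguerre kernel is used in verifying that axiom.\<close>

locale density_semigroup = prob_space M for M :: "'a measure" +
  fixes G :: "real \<Rightarrow> 'a \<Rightarrow> 'a \<Rightarrow> real"
  assumes G_measurable [measurable]: "(\<lambda>(t, x, y). G t x y) \<in> borel_measurable (borel \<Otimes>\<^sub>M M \<Otimes>\<^sub>M M)"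
    and G_nonneg: "0 < t \<Longrightarrow> x \<in> space M \<Longrightarrow> y \<in> space M \<Longrightarrow> 0 \<le> G t x y"
    and G_mass: "0 < t \<Longrightarrow> x \<in> space M \<Longrightarrow> (\<integral>\<^sup>+ y. ennreal (G t x y) \<partial>M) = 1"
    and G_semigroup: "0 < t \<Longrightarrow> 0 < s \<Longrightarrow> x \<in> space M \<Longrightarrow> z \<in> space M \<Longrightarrow>
      (\<integral>\<^sup>+ y. ennreal (G t x y) * ennreal (G s y z) \<partial>M) = ennreal (G (t + s) x z)"
    and L1_continuous: "\<And>f :: 'a \<Rightarrow> complex. f \<in> borel_measurable M \<Longrightarrow> AE x in M. norm (f x) \<le> B \<Longrightarrow>
      ((\<lambda>s. \<integral>x. norm ((\<integral>y. G s x y *\<^sub>R f y \<partial>M) - f x) \<partial>M) \<longlongrightarrow> 0) (at_right 0)"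
begin

text \<open>The bound is an explicit parameter instead of an essential supremum, so that constants
  such as C (A + B) can be tracked directly.\<close>

definition essbdd :: "real \<Rightarrow> ('a \<Rightarrow> complex) \<Rightarrow> bool" where
  "essbdd B f \<longleftrightarrow> f \<in> borel_measurable M \<and> (AE x in M. norm (f x) \<le> B)"

definition T :: "real \<Rightarrow> ('a \<Rightarrow> complex) \<Rightarrow> 'a \<Rightarrow> complex" where
  "T t f x = (\<integral>y. G t x y *\<^sub>R f y \<partial>M)"

definition P :: "real \<Rightarrow> ('a \<Rightarrow> complex) \<Rightarrow> 'a \<Rightarrow> complex" where
  "P t f x = (\<integral>s. sub_kernel t s *\<^sub>R T s f x \<partial>half_line)"

definition D :: "nat \<Rightarrow> real \<Rightarrow> ('a \<Rightarrow> complex) \<Rightarrow> 'a \<Rightarrow> complex" where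
  "D m t f x = (\<integral>s. sub_kernel_deriv m t s *\<^sub>R T s f x \<partial>half_line)"

lemma essbdd_measurable: "essbdd B f \<Longrightarrow> f \<in> borel_measurable M"
  by (simp add: essbdd_def)

lemma essbdd_nonneg: assumes "essbdd B f" shows "0 \<le> B"
proof -
  have "AE x in M. 0 \<le> B"
    using assms[unfolded essbdd_def, THEN conjunct2] by eventually_elim (use norm_ge_zero order_trans in blast)
  then show ?thesis by simp
qed

lemma essbdd_mono: "essbdd B f \<Longrightarrow> B \<le> B' \<Longrightarrow> essbdd B' f"
  unfolding essbdd_def by (auto elim!: eventually_mono)

lemma measurable_G_fixed [measurable (raw)]:
  assumes [measurable]: "g \<in> N \<rightarrow>\<^sub>M borel" "h \<in> N \<rightarrow>\<^sub>M M" "k \<in> N \<rightarrow>\<^sub>M M"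
  shows "(\<lambda>z. G (g z) (h z) (k z)) \<in> borel_measurable N"
proof -
  have "(\<lambda>z. (\<lambda>(t, x, y). G t x y) (g z, h z, k z)) \<in> borel_measurable N" by measurable
  then show ?thesis by simp
qed

text \<open>A probability measure absolutely continuous with respect to M. An a.e. bound on f
  therefore bounds its mean \<open>T t f x\<close> at every x.\<close>

definition KT :: "real \<Rightarrow> 'a \<Rightarrow> 'a measure" where
  "KT t x = density M (\<lambda>y. ennreal (G t x y))"

lemma sets_KT [measurable_cong, simp]: "sets (KT t x) = sets M"
  by (simp add: KT_def)

lemma prob_space_KT: "0 < t \<Longrightarrow> x \<in> space M \<Longrightarrow> prob_space (KT t x)"
  unfolding KT_def by (intro prob_spaceI) (simp add: emeasure_density G_mass)

lemma AE_KT: "x \<in> space M \<Longrightarrow> AE y in M. Q y \<Longrightarrow> AE y in KT t x. Q y"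
  unfolding KT_def by (subst AE_density) auto

lemma T_eq_KT:
  assumes "0 < t" "x \<in> space M" and [measurable]: "f \<in> borel_measurable M"
  shows "T t f x = (\<integral>y. f y \<partial>KT t x)"
  unfolding KT_def T_def using assms(1,2) G_nonneg by (subst integral_density) auto

lemma essbdd_integrable_KT:
  assumes "essbdd B f" "0 < t" "x \<in> space M"
  shows "integrable (KT t x) f"
  by (rule prob_space.AE_bounded_integral(1)[OF prob_space_KT[OF assms(2,3)]])
    (use assms AE_KT[OF assms(3)] in \<open>auto simp: essbdd_def\<close>)

lemma T_measurable [measurable (raw)]:
  assumes [measurable]: "(\<lambda>(z, y). f z y) \<in> borel_measurable (N \<Otimes>\<^sub>M M)" "g \<in> N \<rightarrow>\<^sub>M borel" "h \<in> N \<rightarrow>\<^sub>M M"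
  shows "(\<lambda>z. T (g z) (f z) (h z)) \<in> borel_measurable N"
  unfolding T_def by measurable

lemma T_bound:
  assumes "essbdd B f" "0 < t" "x \<in> space M"
  shows "norm (T t f x) \<le> B"
  unfolding T_eq_KT[OF assms(2,3) essbdd_measurable[OF assms(1)]]
  by (rule prob_space.AE_bounded_integral(2)[OF prob_space_KT[OF assms(2,3)]])
    (use assms AE_KT[OF assms(3)] in \<open>auto simp: essbdd_def\<close>)

text \<open>Fubini is licensed by the composition identity itself: applied with |f| in place of f,
  it bounds the double integral of norms by B.\<close>

lemma T_semigroup:
  assumes f: "essbdd B f" and t: "0 < t" and s: "0 < s" and x: "x \<in> space M"
  shows "T t (T s f) x = T (t + s) f x"
proof -
  have [measurable]: "f \<in> borel_measurable M" using f by (rule essbdd_measurable)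
  note [measurable] = x
  interpret MM: pair_sigma_finite M M ..
  let ?F = "\<lambda>(y, z). (G t x y * G s y z) *\<^sub>R f z"
  have [measurable]: "?F \<in> borel_measurable (M \<Otimes>\<^sub>M M)" by measurable
  have int: "integrable (M \<Otimes>\<^sub>M M) ?F"
  proof (rule integrableI_bounded)
    have "(\<integral>\<^sup>+ p. norm (?F p) \<partial>(M \<Otimes>\<^sub>M M)) = (\<integral>\<^sup>+ z. (\<integral>\<^sup>+ y. norm (?F (y, z)) \<partial>M) \<partial>M)"
      by (rule MM.nn_integral_snd[symmetric]) measurable
    also have "\<dots> = (\<integral>\<^sup>+ z. (\<integral>\<^sup>+ y. (ennreal (G t x y) * ennreal (G s y z)) * ennreal (norm (f z)) \<partial>M) \<partial>M)"
      using t s x G_nonneg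
      by (intro nn_integral_cong) (simp add: abs_mult ennreal_mult[symmetric])
    also have "\<dots> = (\<integral>\<^sup>+ z. ennreal (G (t + s) x z) * ennreal (norm (f z)) \<partial>M)"
      using t s x by (intro nn_integral_cong) (simp add: nn_integral_multc G_semigroup)
    also have "\<dots> \<le> (\<integral>\<^sup>+ z. ennreal (G (t + s) x z) * ennreal B \<partial>M)"
      using f by (intro nn_integral_mono_AE) (auto simp: essbdd_def elim!: eventually_mono intro!: mult_left_mono ennreal_leI)
    also have "\<dots> = ennreal B" using t s x by (simp add: nn_integral_multc G_mass)
    finally show "(\<integral>\<^sup>+ p. norm (?F p) \<partial>(M \<Otimes>\<^sub>M M)) < \<infinity>"
      by (simp add: le_less_trans)
  qed measurable
  have "T t (T s f) x = (\<integral>y. (\<integral>z. ?F (y, z) \<partial>M) \<partial>M)"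
    unfolding T_def by (intro Bochner_Integration.integral_cong refl)
      (simp add: integral_scaleR_right[symmetric] del: integral_scaleR_right)
  also have "\<dots> = (\<integral>z. (\<integral>y. ?F (y, z) \<partial>M) \<partial>M)"
    using MM.Fubini_integral[of "\<lambda>y z. ?F (y, z)"] int by simp
  also have "\<dots> = T (t + s) f x"
    unfolding T_def
  proof (intro Bochner_Integration.integral_cong refl)
    fix z assume z[measurable]: "z \<in> space M"
    have "(\<integral>y. G t x y * G s y z \<partial>M) = enn2real (\<integral>\<^sup>+ y. ennreal (G t x y * G s y z) \<partial>M)"
      using t s x z G_nonneg by (intro integral_eq_nn_integral) auto
    also have "(\<integral>\<^sup>+ y. ennreal (G t x y * G s y z) \<partial>M) = ennreal (G (t + s) x z)"
      using t s x z G_nonneg G_semigroup[OF t s x z, symmetric]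
      by (auto intro!: nn_integral_cong simp: ennreal_mult)
    finally have eq: "(\<integral>y. G t x y * G s y z \<partial>M) = G (t + s) x z"
      using t s x z G_nonneg by simp
    have "integrable M (\<lambda>y. G t x y * G s y z)"
    proof (rule integrableI_nonneg)
      show "AE y in M. 0 \<le> G t x y * G s y z" using t s x z G_nonneg by auto
      show "(\<integral>\<^sup>+ y. ennreal (G t x y * G s y z) \<partial>M) < \<infinity>"
        using \<open>(\<integral>\<^sup>+ y. ennreal (G t x y * G s y z) \<partial>M) = ennreal (G (t + s) x z)\<close> by simp
    qed measurable
    then show "(\<integral>y. ?F (y, z) \<partial>M) = G (t + s) x z *\<^sub>R f z"
      by (simp add: eq[symmetric])
  qed
  finally show ?thesis .
qed

section \<open>The subordinated kernel and its probability measures\<close>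

definition pk :: "real \<Rightarrow> 'a \<Rightarrow> 'a \<Rightarrow> real" where
  "pk t x y = (\<integral>s. sub_kernel t s * G s x y \<partial>half_line)"

text \<open>Like \<open>KT\<close>, absolutely continuous with respect to M; this is what lets
  \<open>P t\<close> upgrade a.e. bounds to pointwise ones.\<close>

definition KP :: "real \<Rightarrow> 'a \<Rightarrow> 'a measure" where
  "KP t x = density M (\<lambda>y. ennreal (pk t x y))"

lemma sets_KP [measurable_cong, simp]: "sets (KP t x) = sets M"
  by (simp add: KP_def)

lemma space_KP [simp]: "space (KP t x) = space M"
  by (simp add: KP_def)

sublocale half: sigma_finite_measure half_line
  by (rule sigma_finite_half_line)

lemma pk_measurable [measurable (raw)]:
  assumes [measurable]: "g \<in> N \<rightarrow>\<^sub>M borel" "h \<in> N \<rightarrow>\<^sub>M M" "k \<in> N \<rightarrow>\<^sub>M M"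
  shows "(\<lambda>z. pk (g z) (h z) (k z)) \<in> borel_measurable N"
  unfolding pk_def by measurable

lemma pk_nonneg: "0 < t \<Longrightarrow> x \<in> space M \<Longrightarrow> y \<in> space M \<Longrightarrow> 0 \<le> pk t x y"
  unfolding pk_def by (intro integral_nonneg_AE AE_I2) (auto simp: sub_kernel_nonneg G_nonneg)

text \<open>The order of the integrals over s and y is exchanged, with majorant
  \<open>sub_kernel t s * B\<close> for the inner norm integral.\<close>

lemma P_eq_pk:
  assumes f: "essbdd B f" and t: "0 < t" and x: "x \<in> space M"
  shows "P t f x = (\<integral>y. pk t x y *\<^sub>R f y \<partial>M)" "integrable M (\<lambda>y. pk t x y *\<^sub>R f y)"
proof -
  have [measurable]: "f \<in> borel_measurable M" using f by (rule essbdd_measurable)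
  note [measurable] = x
  interpret HM: pair_sigma_finite half_line M ..
  let ?F = "\<lambda>(s, y). (sub_kernel t s * G s x y) *\<^sub>R f y"
  have [measurable]: "?F \<in> borel_measurable (half_line \<Otimes>\<^sub>M M)" by measurable
  have B: "0 \<le> B" by (rule essbdd_nonneg[OF f])
  have sec: "integrable M (\<lambda>y. ?F (s, y))" "(\<integral>y. norm (?F (s, y)) \<partial>M) \<le> sub_kernel t s * B" if "0 < s" for s
  proof -
    have g: "integrable M (\<lambda>y. G s x y *\<^sub>R f y)"
      using essbdd_integrable_KT[OF f that x] G_nonneg[OF that x]
      by (simp add: KT_def integrable_density)
    from integrable_scaleR_right[OF this, of "sub_kernel t s"] show "integrable M (\<lambda>y. ?F (s, y))" by simp
    \<comment> \<open>The norm of f is regarded as a complex function, so that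
      \<open>T_bound\<close> also controls the integral of norms.\<close>
    have nf: "essbdd B (\<lambda>y. complex_of_real (norm (f y)))" using f by (simp add: essbdd_def)
    have "(\<integral>y. norm (?F (s, y)) \<partial>M) = (\<integral>y. sub_kernel t s * (G s x y * norm (f y)) \<partial>M)"
      using t that x by (intro Bochner_Integration.integral_cong) (auto simp: abs_mult sub_kernel_nonneg G_nonneg)
    also have "\<dots> = sub_kernel t s * (\<integral>y. G s x y * norm (f y) \<partial>M)" by simp
    also have "(\<integral>y. G s x y * norm (f y) \<partial>M) \<le> B"
    proof -
      have "complex_of_real (\<integral>y. G s x y * norm (f y) \<partial>M) = T s (\<lambda>y. complex_of_real (norm (f y))) x"
        unfolding T_def integral_complex_of_real[symmetric]
        by (intro Bochner_Integration.integral_cong) (auto simp: scaleR_conv_of_real)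
      then have "\<bar>\<integral>y. G s x y * norm (f y) \<partial>M\<bar> = norm (T s (\<lambda>y. complex_of_real (norm (f y))) x)"
        by (metis norm_of_real)
      then show ?thesis using T_bound[OF nf that x] by simp
    qed
    finally show "(\<integral>y. norm (?F (s, y)) \<partial>M) \<le> sub_kernel t s * B"
      using t by (simp add: mult_left_mono sub_kernel_nonneg)
  qed
  have int: "integrable (half_line \<Otimes>\<^sub>M M) ?F"
  proof (rule HM.Fubini_integrable)
    show "AE s in half_line. integrable M (\<lambda>y. ?F (s, y))" using sec by auto
    show "integrable half_line (\<lambda>s. \<integral>y. norm (?F (s, y)) \<partial>M)"
    proof (rule Bochner_Integration.integrable_bound)
      show "integrable half_line (\<lambda>s. sub_kernel t s * B)"
        using sub_kernel_half_line[OF t] by simp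
      show "AE s in half_line. norm (\<integral>y. norm (?F (s, y)) \<partial>M) \<le> norm (sub_kernel t s * B)"
        using sec by (auto intro!: AE_I2 order_trans[OF _ abs_ge_self])
    qed measurable
  qed measurable
  have "P t f x = (\<integral>s. (\<integral>y. ?F (s, y) \<partial>M) \<partial>half_line)"
    unfolding P_def T_def by (intro Bochner_Integration.integral_cong refl)
      (simp add: integral_scaleR_right[symmetric] del: integral_scaleR_right)
  also have "\<dots> = (\<integral>y. (\<integral>s. ?F (s, y) \<partial>half_line) \<partial>M)"
    using HM.Fubini_integral[of "\<lambda>s y. ?F (s, y)"] int by simp
  also have eq: "AE y in M. (\<integral>s. ?F (s, y) \<partial>half_line) = pk t x y *\<^sub>R f y"
  proof (rule AE_I2)
    fix y assume y: "y \<in> space M"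
    show "(\<integral>s. ?F (s, y) \<partial>half_line) = pk t x y *\<^sub>R f y" unfolding pk_def
      by (simp only: prod.case scaleR_conv_of_real integral_mult_left_zero integral_complex_of_real)
  qed
  then have "(\<integral>y. (\<integral>s. ?F (s, y) \<partial>half_line) \<partial>M) = (\<integral>y. pk t x y *\<^sub>R f y \<partial>M)"
    by (intro integral_cong_AE) measurable
  finally show "P t f x = (\<integral>y. pk t x y *\<^sub>R f y \<partial>M)" .
  from HM.integrable_snd[of "\<lambda>s y. ?F (s, y)"] int
  have "integrable M (\<lambda>y. \<integral>s. ?F (s, y) \<partial>half_line)" by simp
  then show "integrable M (\<lambda>y. pk t x y *\<^sub>R f y)"
    by (rule integrable_cong_AE_imp) (use eq in \<open>auto\<close>)
qed

lemma T_const: "0 < t \<Longrightarrow> x \<in> space M \<Longrightarrow> T t (\<lambda>_. c) x = c"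
  using prob_space.prob_space[OF prob_space_KT[of t x]]
  by (simp add: T_eq_KT)

text \<open>The total mass is read off from \<open>P t\<close> applied to the constant 1: every
  \<open>T s\<close> fixes it and the subordination density has mass 1.\<close>

lemma prob_space_KP:
  assumes "0 < t" "x \<in> space M"
  shows "prob_space (KP t x)"
proof (rule prob_spaceI)
  note [measurable] = assms(2)
  have e: "essbdd 1 (\<lambda>_. 1)" by (simp add: essbdd_def)
  have "P t (\<lambda>_. 1) x = (\<integral>s. complex_of_real (sub_kernel t s) \<partial>half_line)"
    unfolding P_def using assms
    by (intro Bochner_Integration.integral_cong) (auto simp: T_const scaleR_conv_of_real)
  also have "\<dots> = 1" using sub_kernel_half_line[OF assms(1)] by simp
  finally have "(\<integral>y. complex_of_real (pk t x y) \<partial>M) = 1"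
    using P_eq_pk(1)[OF e assms] by (simp add: scaleR_conv_of_real)
  then have 1: "(\<integral>y. pk t x y \<partial>M) = 1" by (simp del: of_real_eq_1_iff add: of_real_eq_1_iff[symmetric, where 'a = complex])
  have "integrable M (\<lambda>y. complex_of_real (pk t x y))"
    using P_eq_pk(2)[OF e assms] by (simp add: scaleR_conv_of_real)
  from integrable_Re[OF this] have "integrable M (\<lambda>y. pk t x y)" by simp
  from nn_integral_eq_integral[OF this] 1 pk_nonneg[OF assms]
  show "emeasure (KP t x) (space (KP t x)) = 1"
    by (simp add: KP_def emeasure_density)
qed

lemma AE_KP: "x \<in> space M \<Longrightarrow> AE y in M. Q y \<Longrightarrow> AE y in KP t x. Q y"
  unfolding KP_def by (subst AE_density) auto

lemma P_eq_KP:
  assumes "essbdd B f" "0 < t" "x \<in> space M"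
  shows "P t f x = (\<integral>y. f y \<partial>KP t x)"
proof -
  note [measurable] = assms(3) essbdd_measurable[OF assms(1)]
  show ?thesis
    unfolding KP_def using P_eq_pk(1)[OF assms] pk_nonneg[OF assms(2,3)]
    by (subst integral_density) auto
qed

lemma essbdd_integrable_KP:
  assumes "essbdd B f" "0 < t" "x \<in> space M"
  shows "integrable (KP t x) f"
  by (rule prob_space.AE_bounded_integral(1)[OF prob_space_KP[OF assms(2,3)]])
    (use assms AE_KP[OF assms(3)] in \<open>auto simp: essbdd_def\<close>)

end

text \<open>Since h vanishes at infinity, h t is recovered from its derivative over (t, infinity),
  where u^(q - 1) is integrable because q < 0.\<close>

lemma tail_bound_of_power_derivative_bound:
  fixes h :: "real \<Rightarrow> 'b::real_normed_vector"
  assumes der: "\<And>u. 0 < u \<Longrightarrow> (h has_vector_derivative h' u) (at u)"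
    and bnd: "\<And>u. 0 < u \<Longrightarrow> norm (h' u) \<le> A * u powr (q - 1)"
    and q: "q < 0" and A: "0 \<le> A" and lim: "(h \<longlongrightarrow> 0) at_top" and t: "0 < t"
  shows "norm (h t) \<le> A / (- q) * t powr q"
proof -
  have le: "norm (h b - h t) \<le> A / (- q) * t powr q" if "t < b" for b
  proof -
    let ?\<phi> = "\<lambda>u. A / q * u powr q"
    have "norm (h b - h t) \<le> ?\<phi> b - ?\<phi> t"
    proof (rule differentiable_bound_general[where f' = h' and \<phi>' = "\<lambda>u. A * u powr (q - 1)"])
      show "continuous_on {t..b} h"
        using t by (auto intro!: continuous_at_imp_continuous_on has_vector_derivative_continuous[OF der])
      show "continuous_on {t..b} ?\<phi>" using t q by (auto intro!: continuous_intros)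
      fix u assume u: "t < u" "u < b"
      have "(?\<phi> has_real_derivative A / q * (q * u powr (q - 1))) (at u)"
        using u t by (intro DERIV_cmult has_real_derivative_powr) auto
      then show "(?\<phi> has_vector_derivative A * u powr (q - 1)) (at u)"
        using q by (simp add: has_real_derivative_iff_has_vector_derivative)
    qed (use that der bnd t in auto)
    also have "\<dots> \<le> A / (- q) * t powr q"
      using q A by (simp add: mult_nonneg_nonpos2 divide_nonneg_neg mult_nonpos_nonneg divide_nonpos_neg divide_nonneg_nonpos)
    finally show ?thesis .
  qed
  have "((\<lambda>b. norm (h b - h t)) \<longlongrightarrow> norm (0 - h t)) at_top"
    by (intro tendsto_intros lim)
  moreover have "\<forall>\<^sub>F b in at_top. norm (h b - h t) \<le> A / (- q) * t powr q"
    using eventually_gt_at_top[of t] by eventually_elim (rule le)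
  ultimately show ?thesis using tendsto_upperbound by fastforce
qed

text \<open>One constant per order, fixed by choice, so that it can enter later constants as a
  function of m.\<close>

definition sub_const :: "nat \<Rightarrow> real" where
  "sub_const m = (SOME C. 0 \<le> C \<and>
    (\<forall>t>0. \<forall>s>0. \<bar>sub_kernel_deriv m t s\<bar> \<le> C * t powr (- real m) * sub_kernel (t / sqrt 2) s))"

lemma sub_const: "0 \<le> sub_const m"
  "0 < t \<Longrightarrow> 0 < s \<Longrightarrow> \<bar>sub_kernel_deriv m t s\<bar> \<le> sub_const m * t powr (- real m) * sub_kernel (t / sqrt 2) s"
  using someI_ex[OF sub_kernel_deriv_bound[of m]] unfolding sub_const_def[symmetric] by auto

section \<open>Derivatives of Poisson orbits\<close>

context density_semigroup
begin

lemma P_measurable [measurable (raw)]: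
  assumes [measurable]: "(\<lambda>(z, y). f z y) \<in> borel_measurable (N \<Otimes>\<^sub>M M)" "g \<in> N \<rightarrow>\<^sub>M borel" "h \<in> N \<rightarrow>\<^sub>M M"
  shows "(\<lambda>z. P (g z) (f z) (h z)) \<in> borel_measurable N"
  unfolding P_def by measurable

lemma D_measurable [measurable (raw)]:
  assumes [measurable]: "(\<lambda>(z, y). f z y) \<in> borel_measurable (N \<Otimes>\<^sub>M M)" "g \<in> N \<rightarrow>\<^sub>M borel" "h \<in> N \<rightarrow>\<^sub>M M"
  shows "(\<lambda>z. D m (g z) (f z) (h z)) \<in> borel_measurable N"
  unfolding D_def by measurable

lemma P_bound:
  assumes "essbdd B f" "0 < t" "x \<in> space M"
  shows "norm (P t f x) \<le> B"
  unfolding P_eq_KP[OF assms]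
  by (rule prob_space.AE_bounded_integral(2)[OF prob_space_KP[OF assms(2,3)]])
    (use assms AE_KP[OF assms(3)] in \<open>auto simp: essbdd_def\<close>)

lemma essbdd_P:
  assumes f: "essbdd B f" and "0 < t"
  shows "essbdd B (P t f)"
proof -
  note [measurable] = essbdd_measurable[OF f]
  have "P t f \<in> borel_measurable M" by measurable
  then show ?thesis using assms by (auto simp: essbdd_def[of B "P t f"] P_bound)
qed

lemma P_semigroup:
  assumes f: "essbdd B f" and t: "0 < t" and \<tau>: "0 < \<tau>" and x: "x \<in> space M"
  shows "P t (P \<tau> f) x = P (t + \<tau>) f x"
proof -
  note [measurable] = essbdd_measurable[OF f] x
  have "T r (P \<tau> f) x = (\<integral>s. sub_kernel \<tau> s *\<^sub>R T (r + s) f x \<partial>half_line)" if r: "0 < r" for r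
  proof -
    interpret K: prob_space "KT r x" using r x by (rule prob_space_KT)
    have "T r (P \<tau> f) x = (\<integral>y. P \<tau> f y \<partial>KT r x)"
      by (rule T_eq_KT[OF r x]) measurable
    also have "\<dots> = (\<integral>s. (\<integral>y. sub_kernel \<tau> s *\<^sub>R T s f y \<partial>KT r x) \<partial>half_line)"
      unfolding P_def
    proof (rule Fubini_dominated)
      show "AE y in KT r x. \<forall>s\<in>space half_line. norm (sub_kernel \<tau> s *\<^sub>R T s f y) \<le> sub_kernel \<tau> s * B"
        using T_bound[OF f] \<tau> by (auto simp: KT_def sub_kernel_nonneg intro!: AE_I2 mult_left_mono)
      show "integrable half_line (\<lambda>s. sub_kernel \<tau> s * B)" using sub_kernel_half_line[OF \<tau>] by simp
    qed (use sigma_finite_half_line K.finite_measure_axioms in \<open>measurable\<close>)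
    also have "\<dots> = (\<integral>s. sub_kernel \<tau> s *\<^sub>R T (r + s) f x \<partial>half_line)"
    proof (rule Bochner_Integration.integral_cong[OF refl])
      fix s assume s: "s \<in> space half_line"
      have "(\<integral>y. T s f y \<partial>KT r x) = T r (T s f) x" by (rule T_eq_KT[OF r x, symmetric]) measurable
      also have "\<dots> = T (r + s) f x" using T_semigroup[OF f r _ x] s by simp
      finally show "(\<integral>y. sub_kernel \<tau> s *\<^sub>R T s f y \<partial>KT r x) = sub_kernel \<tau> s *\<^sub>R T (r + s) f x" by simp
    qed
    finally show ?thesis .
  qed
  then have "P t (P \<tau> f) x = (\<integral>r. sub_kernel t r *\<^sub>R (\<integral>s. sub_kernel \<tau> s *\<^sub>R T (r + s) f x \<partial>half_line) \<partial>half_line)"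
    unfolding P_def[of t] by (intro Bochner_Integration.integral_cong) auto
  also have "\<dots> = P (t + \<tau>) f x"
    unfolding P_def by (rule sub_kernel_convolution_integral[OF t \<tau>]) (use T_bound[OF f] x in auto)
  finally show ?thesis .
qed

text \<open>The dominating kernel at time t / sqrt 2 has mass 1 for every t, so only the factor t^(-
  m) remains. This is the decay estimate with theta = 0.\<close>

lemma D_integrand:
  assumes f: "essbdd B f" and t: "0 < t" and x: "x \<in> space M"
  shows "integrable half_line (\<lambda>s. sub_kernel_deriv m t s *\<^sub>R T s f x)"
    "norm (D m t f x) \<le> sub_const m * B * t powr (- real m)"
proof -
  note [measurable] = essbdd_measurable[OF f] x
  let ?b = "\<lambda>s. sub_const m * t powr (- real m) * B * sub_kernel (t / sqrt 2) s"
  have k: "integrable half_line (sub_kernel (t / sqrt 2))" "(\<integral>s. sub_kernel (t / sqrt 2) s \<partial>half_line) = 1"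
    using t by (intro sub_kernel_half_line; simp)+
  have b: "norm (sub_kernel_deriv m t s *\<^sub>R T s f x) \<le> ?b s" if "0 < s" for s
  proof -
    have "norm (sub_kernel_deriv m t s *\<^sub>R T s f x) \<le> (sub_const m * t powr (- real m) * sub_kernel (t / sqrt 2) s) * B"
      unfolding norm_scaleR using sub_const(2)[OF t that] T_bound[OF f that x] sub_const(1) t
      by (intro mult_mono) (auto simp: sub_kernel_nonneg)
    then show ?thesis by (simp add: mult_ac)
  qed
  show int: "integrable half_line (\<lambda>s. sub_kernel_deriv m t s *\<^sub>R T s f x)"
  proof (rule Bochner_Integration.integrable_bound)
    show "integrable half_line ?b" using k by simp
    show "AE s in half_line. norm (sub_kernel_deriv m t s *\<^sub>R T s f x) \<le> norm (?b s)"
      using b by (auto intro!: AE_I2 order_trans[OF _ abs_ge_self])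
  qed measurable
  have "norm (D m t f x) \<le> (\<integral>s. norm (sub_kernel_deriv m t s *\<^sub>R T s f x) \<partial>half_line)"
    unfolding D_def by (rule integral_norm_bound)
  also have "\<dots> \<le> (\<integral>s. ?b s \<partial>half_line)"
    using int k b by (intro integral_mono integrable_norm) auto
  also have "\<dots> = sub_const m * B * t powr (- real m)" using k by simp
  finally show "norm (D m t f x) \<le> sub_const m * B * t powr (- real m)" .
qed

lemmas D_bound = D_integrand(2)

lemma D_0: "D 0 t f x = P t f x"
  unfolding D_def P_def by (intro Bochner_Integration.integral_cong) (auto simp: sub_kernel_deriv_0)

text \<open>Differentiation under the subordination integral, with a majorant valid for all times
  between t / 2 and 2 t.\<close>

lemma has_vector_derivative_D:
  assumes f: "essbdd B f" and t: "0 < t" and x: "x \<in> space M"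
  shows "((\<lambda>t. D m t f x) has_vector_derivative D (Suc m) t f x) (at t)"
  unfolding D_def
proof (rule has_vector_derivative_integral_dominated[where a = "t / 2" and b = "2 * t"])
  note [measurable] = essbdd_measurable[OF f] x
  \<comment> \<open>The factor 4 is the ratio of the interval ends 2 t and t / 2, as it occurs in
    \<open>sub_kernel_mono\<close>.\<close>
  let ?c = "sub_const (Suc m) * (t / 2) powr (- real (Suc m)) * B * 4"
  show "t / 2 < t" "t < 2 * t" using t by auto
  show "integrable half_line (\<lambda>s. sub_kernel_deriv m u s *\<^sub>R T s f x)" if "t / 2 < u" for u
    using D_integrand(1)[OF f _ x] that t by simp
  show "((\<lambda>u. sub_kernel_deriv m u s *\<^sub>R T s f x) has_vector_derivative
      sub_kernel_deriv (Suc m) u s *\<^sub>R T s f x) (at u)" if "s \<in> space half_line" for u s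
    using DERIV_sub_kernel_deriv[of s m u] that
    by (intro bounded_linear.has_vector_derivative[OF bounded_linear_scaleR_left])
      (simp add: has_real_derivative_iff_has_vector_derivative)
  show "(\<lambda>s. sub_kernel_deriv (Suc m) t s *\<^sub>R T s f x) \<in> borel_measurable half_line" by measurable
  show "integrable half_line (\<lambda>s. ?c * sub_kernel (t / 2 / sqrt 2) s)"
    using sub_kernel_half_line[of "t / 2 / sqrt 2"] t by simp
  fix u s assume u: "t / 2 < u" "u < 2 * t" and "s \<in> space half_line"
  then have s: "0 < s" by simp
  have B: "0 \<le> B" by (rule essbdd_nonneg[OF f])
  have "norm (sub_kernel_deriv (Suc m) u s *\<^sub>R T s f x) \<le> (sub_const (Suc m) * u powr (- real (Suc m)) * sub_kernel (u / sqrt 2) s) * B"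
    unfolding norm_scaleR using sub_const(2)[of u s "Suc m"] T_bound[OF f s x] sub_const(1) t u s
    by (intro mult_mono) (auto simp: sub_kernel_nonneg)
  also have "\<dots> \<le> (sub_const (Suc m) * (t / 2) powr (- real (Suc m)) * (4 * sub_kernel (t / 2 / sqrt 2) s)) * B"
  proof (intro mult_right_mono[OF mult_mono] mult_left_mono)
    show "u powr (- real (Suc m)) \<le> (t / 2) powr (- real (Suc m))"
      using t u by (intro powr_mono2') auto
    have "sub_kernel (u / sqrt 2) s \<le> (2 * t / sqrt 2) / (t / 2 / sqrt 2) * sub_kernel (t / 2 / sqrt 2) s"
      using t u s by (intro sub_kernel_mono) (auto simp: divide_simps)
    also have "(2 * t / sqrt 2) / (t / 2 / sqrt 2) = 4" using t by (simp add: field_simps)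
    finally show "sub_kernel (u / sqrt 2) s \<le> 4 * sub_kernel (t / 2 / sqrt 2) s" .
  qed (use B t u sub_const in \<open>auto simp: sub_kernel_nonneg\<close>)
  finally show "norm (sub_kernel_deriv (Suc m) u s *\<^sub>R T s f x) \<le> ?c * sub_kernel (t / 2 / sqrt 2) s"
    by (simp add: mult_ac)
qed

lemma essbdd_D:
  assumes f: "essbdd B f" and "0 < t"
  shows "essbdd (sub_const m * B * t powr (- real m)) (D m t f)"
proof -
  note [measurable] = essbdd_measurable[OF f]
  have "D m t f \<in> borel_measurable M" by measurable
  then show ?thesis using D_bound[OF assms] by (auto simp: essbdd_def)
qed

text \<open>By induction on m: both sides are t-derivatives of the same function, the left one by
  differentiating under the measure \<open>KP \<tau> x\<close>, and derivatives are unique.\<close>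

lemma P_D:
  assumes f: "essbdd B f" and t: "0 < t" and \<tau>: "0 < \<tau>" and x: "x \<in> space M"
  shows "P \<tau> (D m t f) x = D m (\<tau> + t) f x"
  using t
proof (induction m arbitrary: t)
  case 0
  have "D 0 t f = P t f" by (rule ext) (rule D_0)
  then show ?case using P_semigroup[OF f \<tau> 0 x] by (simp add: D_0)
next
  case (Suc m)
  note [measurable] = essbdd_measurable[OF f]
  interpret K: prob_space "KP \<tau> x" using \<tau> x by (rule prob_space_KP)
  have "((\<lambda>t. \<integral>y. D m t f y \<partial>KP \<tau> x) has_vector_derivative (\<integral>y. D (Suc m) t f y \<partial>KP \<tau> x)) (at t)"
  proof (rule has_vector_derivative_integral_dominated[where a = "t / 2" and b = "2 * t"])
    show "integrable (KP \<tau> x) (D m u f)" if "t / 2 < u" for u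
      using essbdd_integrable_KP[OF essbdd_D[OF f, of u] \<tau> x] that Suc.prems by simp
    show "D (Suc m) t f \<in> borel_measurable (KP \<tau> x)" by measurable
    show "integrable (KP \<tau> x) (\<lambda>y. sub_const (Suc m) * B * (t / 2) powr (- real (Suc m)))" by simp
    show "norm (D (Suc m) u f y) \<le> sub_const (Suc m) * B * (t / 2) powr (- real (Suc m))"
      if u: "t / 2 < u" and y: "y \<in> space (KP \<tau> x)" for u y
    proof -
      have "norm (D (Suc m) u f y) \<le> sub_const (Suc m) * B * u powr (- real (Suc m))"
        using D_bound[OF f, of u y "Suc m"] u y Suc.prems by simp
      also have "\<dots> \<le> sub_const (Suc m) * B * (t / 2) powr (- real (Suc m))"
        using u Suc.prems sub_const(1) essbdd_nonneg[OF f] by (intro mult_left_mono powr_mono2') auto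
      finally show ?thesis .
    qed
  qed (use Suc.prems has_vector_derivative_D[OF f] in auto)
  then have "((\<lambda>t. \<integral>y. D m t f y \<partial>KP \<tau> x) has_vector_derivative P \<tau> (D (Suc m) t f) x) (at t)"
    using P_eq_KP[OF essbdd_D[OF f Suc.prems] \<tau> x] by simp
  moreover have "((\<lambda>t. \<integral>y. D m t f y \<partial>KP \<tau> x) has_vector_derivative D (Suc m) (\<tau> + t) f x) (at t)"
  proof (rule has_vector_derivative_transform_within_open[where S = "{0<..}"])
    show "((\<lambda>t. D m (\<tau> + t) f x) has_vector_derivative D (Suc m) (\<tau> + t) f x) (at t)"
    proof -
      have "((\<lambda>t. \<tau> + t) has_vector_derivative 1) (at t)"
        by (auto intro!: derivative_eq_intros)
      from vector_diff_chain_at[OF this has_vector_derivative_D[OF f _ x]] \<tau> Suc.prems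
      show ?thesis by (simp add: comp_def)
    qed
    show "D m (\<tau> + u) f x = (\<integral>y. D m u f y \<partial>KP \<tau> x)" if "u \<in> {0<..}" for u
      using Suc.IH[of u] P_eq_KP[OF essbdd_D[OF f, of u] \<tau> x] that by simp
  qed (use Suc.prems in auto)
  ultimately show ?case by (rule vector_derivative_unique_at)
qed

lemma funpow_vector_derivative_P:
  assumes f: "essbdd B f" and t: "0 < t" and x: "x \<in> space M"
  shows "((\<lambda>g u. vector_derivative g (at u)) ^^ m) (\<lambda>u. P u f x) t = D m t f x"
  by (rule funpow_vector_derivative_eq[where U = "\<lambda>m t. D m t f x"])
    (use has_vector_derivative_D[OF f _ x] t in \<open>auto simp: D_0\<close>)

text \<open>The Poisson orbit of \<open>D m t f\<close> is the translated m-th derivative of the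
  orbit of f, by \<open>P_D\<close>; differentiating it j times adds the orders and the
  times.\<close>

lemma D_D:
  assumes f: "essbdd B f" and t: "0 < t" and \<tau>: "0 < \<tau>" and x: "x \<in> space M"
  shows "D j \<tau> (D m t f) x = D (j + m) (\<tau> + t) f x"
proof -
  have "D j \<tau> (D m t f) x = ((\<lambda>g u. vector_derivative g (at u)) ^^ j) (\<lambda>u. P u (D m t f) x) \<tau>"
    by (rule funpow_vector_derivative_P[OF essbdd_D[OF f t] \<tau> x, symmetric])
  also have "\<dots> = D (j + m) (\<tau> + t) f x"
  proof (rule funpow_vector_derivative_eq[where U = "\<lambda>j \<tau>. D (j + m) (\<tau> + t) f x"])
    fix i u :: real
    show "P u (D m t f) x = D (0 + m) (u + t) f x" if "0 < u" using P_D[OF f t that x] by simp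
  next
    fix i and u :: real assume "0 < u"
    have "((\<lambda>u. u + t) has_vector_derivative 1) (at u)"
      by (auto intro!: derivative_eq_intros)
    from vector_diff_chain_at[OF this has_vector_derivative_D[OF f _ x]] \<open>0 < u\<close> t
    show "((\<lambda>\<tau>. D (i + m) (\<tau> + t) f x) has_vector_derivative D (Suc i + m) (u + t) f x) (at u)"
      by (simp add: comp_def)
  qed (rule \<tau>)
  finally show ?thesis .
qed

end

section \<open>Integrals of powers on the half-line\<close>

lemma set_integral_powr_0:
  fixes e a :: real
  assumes e: "- 1 < e" and a: "0 < a"
  shows "set_integrable lborel {0<..<a} (\<lambda>s. s powr e)" "(LBINT s:{0<..<a}. s powr e) = a powr (e + 1) / (e + 1)"
proof -
  let ?F = "\<lambda>s. s powr (e + 1) / (e + 1)"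
  have "(?F \<longlongrightarrow> 0 powr (e + 1) / (e + 1)) (at_right 0)"
    using e by (intro tendsto_intros) (auto simp: eventually_at_filter)
  moreover have "(?F \<longlongrightarrow> ?F a) (at_left a)"
    using a e by (intro tendsto_intros) auto
  moreover have "(?F has_real_derivative s powr e) (at s)" if "0 < s" for s
  proof -
    have "(?F has_real_derivative ((e + 1) * s powr (e + 1 - 1)) / (e + 1)) (at s)"
      using that by (intro DERIV_cdivide has_real_derivative_powr)
    then show ?thesis using e by simp
  qed
  moreover have "isCont (\<lambda>s. s powr e) s" if "0 < s" for s
    using that by (intro continuous_intros) auto
  moreover note interval_integral_FTC_nonneg[of 0 a ?F "\<lambda>s. s powr e" 0 "?F a"]
  ultimately have "set_integrable lborel (einterval 0 a) (\<lambda>s. s powr e)" "(LBINT s=0..a. s powr e) = ?F a - 0"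
    using a by (auto simp: zero_ereal_def ereal_tendsto_simps)
  then show "set_integrable lborel {0<..<a} (\<lambda>s. s powr e)" "(LBINT s:{0<..<a}. s powr e) = a powr (e + 1) / (e + 1)"
    using a by (simp_all add: zero_ereal_def interval_lebesgue_integral_def)
qed

lemma set_integral_powr_inf:
  fixes e a :: real
  assumes e: "e < - 1" and a: "0 < a"
  shows "set_integrable lborel {a<..} (\<lambda>s. s powr e)" "(LBINT s:{a<..}. s powr e) = a powr (e + 1) / (- e - 1)"
proof -
  let ?F = "\<lambda>s. s powr (e + 1) / (e + 1)"
  have "((\<lambda>s. s powr (e + 1)) \<longlongrightarrow> 0) at_top"
    using e by (intro tendsto_neg_powr filterlim_ident) auto
  then have "(?F \<longlongrightarrow> 0 / (e + 1)) at_top"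
    using e by (intro tendsto_intros) auto
  moreover have "(?F \<longlongrightarrow> ?F a) (at_right a)"
    using a e by (intro tendsto_intros) auto
  moreover have "(?F has_real_derivative s powr e) (at s)" if "0 < s" for s
  proof -
    have "(?F has_real_derivative ((e + 1) * s powr (e + 1 - 1)) / (e + 1)) (at s)"
      using that by (intro DERIV_cdivide has_real_derivative_powr)
    then show ?thesis using e by simp
  qed
  moreover have "isCont (\<lambda>s. s powr e) s" if "0 < s" for s
    using that by (intro continuous_intros) auto
  moreover note interval_integral_FTC_nonneg[of a \<infinity> ?F "\<lambda>s. s powr e" "?F a" 0]
  ultimately have "set_integrable lborel (einterval a \<infinity>) (\<lambda>s. s powr e)" "(LBINT s=a..\<infinity>. s powr e) = 0 - ?F a"
    using a by (auto simp: ereal_tendsto_simps)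
  moreover have "- (A / (e + 1)) = A / (- e - 1)" for A
  proof -
    have "- e - 1 = - (e + 1)" by simp
    then show ?thesis by (metis minus_divide_right)
  qed
  ultimately show "set_integrable lborel {a<..} (\<lambda>s. s powr e)" "(LBINT s:{a<..}. s powr e) = a powr (e + 1) / (- e - 1)"
    by (simp_all add: interval_integral_to_infinity_eq)
qed

text \<open>The exponents lie on the two sides of l, so one piece converges at 0 and the other at
  infinity. The powers of a by which both results scale produce the final power of t.\<close>

lemma integral_split_powers:
  fixes a l \<zeta>\<^sub>1 \<zeta>\<^sub>2 e\<^sub>1 e\<^sub>2 :: real
  assumes a: "0 < a" and l: "\<zeta>\<^sub>2 < l" "l < \<zeta>\<^sub>1"
  defines "g \<equiv> \<lambda>s. s powr (- l - 1) * (if s < a then e\<^sub>1 * s powr \<zeta>\<^sub>1 else e\<^sub>2 * s powr \<zeta>\<^sub>2)"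
  shows "integrable half_line g"
    "(\<integral>s. g s \<partial>half_line) = e\<^sub>1 * a powr (\<zeta>\<^sub>1 - l) / (\<zeta>\<^sub>1 - l) + e\<^sub>2 * a powr (\<zeta>\<^sub>2 - l) / (l - \<zeta>\<^sub>2)"
proof -
  let ?h = "\<lambda>s. e\<^sub>1 * (indicator {0<..<a} s *\<^sub>R s powr (\<zeta>\<^sub>1 - l - 1)) + e\<^sub>2 * (indicator {a<..} s *\<^sub>R s powr (\<zeta>\<^sub>2 - l - 1))"
  have h: "integrable lborel ?h"
    "(\<integral>s. ?h s \<partial>lborel) = e\<^sub>1 * (a powr (\<zeta>\<^sub>1 - l) / (\<zeta>\<^sub>1 - l)) + e\<^sub>2 * (a powr (\<zeta>\<^sub>2 - l) / (l - \<zeta>\<^sub>2))"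
    using set_integral_powr_0[of "\<zeta>\<^sub>1 - l - 1" a] set_integral_powr_inf[of "\<zeta>\<^sub>2 - l - 1" a] a l
    by (simp_all add: set_integrable_def set_lebesgue_integral_def)
  \<comment> \<open>The two pieces live on open intervals, so the splitting point s = a has to be
    excluded.\<close>
  have eq: "AE s in lborel. indicator {0<..} s *\<^sub>R g s = ?h s"
    using AE_lborel_singleton[of a]
  proof eventually_elim
    case (elim s)
    then show ?case
      using a by (auto simp: g_def powr_add[symmetric] algebra_simps split: split_indicator)
  qed
  have m: "(\<lambda>s. indicator {0<..} s *\<^sub>R g s) \<in> borel_measurable lborel"
    unfolding g_def supply sets_half_line_id[measurable del] by measurable
  show "integrable half_line g"
    unfolding integrable_half_line set_integrable_def
    by (rule integrable_cong_AE_imp[OF h(1) m]) (use eq in \<open>auto elim!: eventually_mono\<close>)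
  show "(\<integral>s. g s \<partial>half_line) = e\<^sub>1 * a powr (\<zeta>\<^sub>1 - l) / (\<zeta>\<^sub>1 - l) + e\<^sub>2 * a powr (\<zeta>\<^sub>2 - l) / (l - \<zeta>\<^sub>2)"
    unfolding integral_half_line set_lebesgue_integral_def
    using integral_cong_AE[OF m borel_measurable_integrable[OF h(1)] eq] h(2) by simp
qed

lemma tendsto_funpow_wdiff:
  fixes g :: "real \<Rightarrow> 'b::real_normed_vector"
  assumes "\<And>a. 0 \<le> a \<Longrightarrow> (\<lambda>j. g (X j + a)) \<longlonglongrightarrow> g a" "0 \<le> s" "0 \<le> a"
  shows "(\<lambda>j. (wdiff c s ^^ k) g (X j + a)) \<longlonglongrightarrow> (wdiff c s ^^ k) g a"
  using assms(3)
proof (induction k arbitrary: a)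
  case (Suc k)
  let ?g = "(wdiff c s ^^ k) g"
  have "(\<lambda>j. c *\<^sub>R ?g (X j + (a + s)) - ?g (X j + a)) \<longlonglongrightarrow> c *\<^sub>R ?g (a + s) - ?g a"
    using Suc assms(2) by (intro tendsto_intros) auto
  then show ?case by (simp add: wdiff_def[of c s ?g] add.assoc)
qed (use assms in simp)

section \<open>Convergence at t = 0 and decay of derivatives under the Lipschitz condition\<close>

context density_semigroup
begin

text \<open>The mean error of \<open>P t\<close> is at most the average of that of
  \<open>T s\<close> under the subordination density. For small s the latter is small by
  \<open>L1_continuous\<close>; the mass on larger s is of order t.\<close>

lemma P_L1_tendsto:
  assumes f: "essbdd B f"
  shows "(\<lambda>j. \<integral>x. norm (P (1 / real (Suc j)) f x - f x) \<partial>M) \<longlonglongrightarrow> 0"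
proof -
  note [measurable] = essbdd_measurable[OF f]
  have B: "0 \<le> B" by (rule essbdd_nonneg[OF f])
  define \<omega> where "\<omega> = (\<lambda>s. \<integral>x. norm (T s f x - f x) \<partial>M)"
  have [measurable]: "\<omega> \<in> borel_measurable borel" unfolding \<omega>_def by measurable
  have AEf: "AE x in M. norm (f x) \<le> B" using f by (simp add: essbdd_def)
  have b2: "AE x in M. \<forall>s>0. norm (T s f x - f x) \<le> 2 * B"
    using AEf AE_space
  proof eventually_elim
    case (elim x)
    show ?case
    proof (intro allI impI)
      fix s :: real assume "0 < s"
      then show "norm (T s f x - f x) \<le> 2 * B"
        using norm_triangle_ineq4[of "T s f x" "f x"] T_bound[OF f, of s x] elim by simp
    qed
  qed
  have intT: "integrable M (\<lambda>x. norm (T s f x - f x))" if "0 < s" for s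
    using b2 that by (intro integrable_const_bound[where B = "2 * B"]) auto
  have \<omega>0: "0 \<le> \<omega> s" for s unfolding \<omega>_def by simp
  have \<omega>B: "\<omega> s \<le> 2 * B" if "0 < s" for s
  proof -
    have "\<omega> s \<le> (\<integral>x. 2 * B \<partial>M)"
      unfolding \<omega>_def using b2 that intT[OF that] by (intro integral_mono_AE) auto
    then show ?thesis by (simp add: prob_space)
  qed
  have le: "(\<integral>x. norm (P t f x - f x) \<partial>M) \<le> (\<integral>s. sub_kernel t s * \<omega> s \<partial>half_line)"
    and int\<omega>: "integrable half_line (\<lambda>s. sub_kernel t s * \<omega> s)" if t: "0 < t" for t
  proof -
    note k = sub_kernel_half_line[OF t]
    let ?F = "\<lambda>s x. sub_kernel t s * norm (T s f x - f x)"
    have F: "(\<integral>x. (\<integral>s. ?F s x \<partial>half_line) \<partial>M) = (\<integral>s. (\<integral>x. ?F s x \<partial>M) \<partial>half_line)"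
      "integrable M (\<lambda>x. \<integral>s. ?F s x \<partial>half_line)"
    proof -
      have 1: "AE x in M. \<forall>s\<in>space half_line. norm (?F s x) \<le> sub_kernel t s * (2 * B)"
        using b2 t by (auto elim!: eventually_mono simp: abs_mult sub_kernel_nonneg intro!: mult_left_mono)
      have 2: "integrable half_line (\<lambda>s. sub_kernel t s * (2 * B))" using k by simp
      have 3: "(\<lambda>(s, x). ?F s x) \<in> borel_measurable (half_line \<Otimes>\<^sub>M M)" by measurable
      show "(\<integral>x. (\<integral>s. ?F s x \<partial>half_line) \<partial>M) = (\<integral>s. (\<integral>x. ?F s x \<partial>M) \<partial>half_line)"
        "integrable M (\<lambda>x. \<integral>s. ?F s x \<partial>half_line)"
        using Fubini_dominated[OF sigma_finite_half_line finite_measure_axioms 3 1 2] by auto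
    qed
    have "(\<integral>x. norm (P t f x - f x) \<partial>M) \<le> (\<integral>x. (\<integral>s. ?F s x \<partial>half_line) \<partial>M)"
    proof (rule integral_mono_AE)
      show "integrable M (\<lambda>x. norm (P t f x - f x))"
      proof (rule integrable_const_bound[where B = "2 * B"])
        show "AE x in M. norm (norm (P t f x - f x)) \<le> 2 * B"
          using AEf AE_space
        proof eventually_elim
          case (elim x)
          show ?case
            using norm_triangle_ineq4[of "P t f x" "f x"] P_bound[OF f t, of x] elim by simp
        qed
      qed measurable
      show "integrable M (\<lambda>x. \<integral>s. ?F s x \<partial>half_line)" by (rule F)
      show "AE x in M. norm (P t f x - f x) \<le> (\<integral>s. ?F s x \<partial>half_line)"
      proof (rule AE_I2)
        fix x assume x: "x \<in> space M"
        have i1: "integrable half_line (\<lambda>s. sub_kernel t s *\<^sub>R T s f x)"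
        proof (rule Bochner_Integration.integrable_bound)
          show "integrable half_line (\<lambda>s. sub_kernel t s * B)" using k by simp
          show "AE s in half_line. norm (sub_kernel t s *\<^sub>R T s f x) \<le> norm (sub_kernel t s * B)"
            using T_bound[OF f _ x] t B by (auto intro!: AE_I2 mult_left_mono simp: sub_kernel_nonneg abs_mult)
          show "(\<lambda>s. sub_kernel t s *\<^sub>R T s f x) \<in> borel_measurable half_line" using x by measurable
        qed
        have i2: "integrable half_line (\<lambda>s. sub_kernel t s *\<^sub>R f x)" "(\<integral>s. sub_kernel t s *\<^sub>R f x \<partial>half_line) = f x"
          using k by simp_all
        have "P t f x - f x = (\<integral>s. sub_kernel t s *\<^sub>R (T s f x - f x) \<partial>half_line)"
          unfolding P_def scaleR_diff_right using i1 i2 by simp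
        also have "norm \<dots> \<le> (\<integral>s. norm (sub_kernel t s *\<^sub>R (T s f x - f x)) \<partial>half_line)"
          by (rule integral_norm_bound)
        also have "\<dots> = (\<integral>s. ?F s x \<partial>half_line)"
          using t by (simp add: sub_kernel_nonneg)
        finally show "norm (P t f x - f x) \<le> (\<integral>s. ?F s x \<partial>half_line)" .
      qed
    qed
    also have "\<dots> = (\<integral>s. sub_kernel t s * \<omega> s \<partial>half_line)" unfolding F(1) \<omega>_def by simp
    finally show "(\<integral>x. norm (P t f x - f x) \<partial>M) \<le> (\<integral>s. sub_kernel t s * \<omega> s \<partial>half_line)" .
    show "integrable half_line (\<lambda>s. sub_kernel t s * \<omega> s)"
    proof (rule Bochner_Integration.integrable_bound)
      show "integrable half_line (\<lambda>s. sub_kernel t s * (2 * B))" using k by simp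
      show "AE s in half_line. norm (sub_kernel t s * \<omega> s) \<le> norm (sub_kernel t s * (2 * B))"
        using \<omega>B \<omega>0 t B by (auto intro!: AE_I2 mult_left_mono simp: sub_kernel_nonneg abs_mult)
    qed measurable
  qed
  have lim: "(\<omega> \<longlongrightarrow> 0) (at_right 0)"
    unfolding \<omega>_def T_def by (rule L1_continuous[OF essbdd_measurable[OF f] AEf])
  show ?thesis
  proof (rule LIMSEQ_I)
    fix e :: real assume e: "0 < e"
    have "\<forall>\<^sub>F s in at_right 0. \<omega> s < e / 2"
      using order_tendstoD(2)[OF lim, of "e / 2"] e by simp
    then obtain d where d: "0 < d" "\<And>s. 0 < s \<Longrightarrow> s < d \<Longrightarrow> \<omega> s < e / 2"
      by (auto simp: eventually_at_right_field)
    \<comment> \<open>For s >= d one has exp (- t^2 / (4 s)) <= 1 <= exp (1 / (4 d) - 1 / (4 s)), so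
      the kernel at t is at most t exp (1 / (4 d)) times the kernel at 1; 2 B bounds omega.\<close>
    define K where "K = 2 * B * exp (1 / (4 * d))"
    have K: "0 \<le> K" using B by (simp add: K_def)
    have est: "(\<integral>x. norm (P t f x - f x) \<partial>M) \<le> e / 2 + K * t" if t: "0 < t" for t
    proof -
      have pt: "sub_kernel t s * \<omega> s \<le> e / 2 * sub_kernel t s + K * t * sub_kernel 1 s" if s: "0 < s" for s
      proof (cases "s < d")
        case True
        have "sub_kernel t s * \<omega> s \<le> sub_kernel t s * (e / 2)"
          using d(2)[OF s True] t by (intro mult_left_mono) (auto simp: sub_kernel_nonneg)
        moreover have "0 \<le> K * t * sub_kernel 1 s" using K t by (simp add: sub_kernel_nonneg)
        ultimately show ?thesis by (simp add: mult.commute)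
      next
        case False
        have "sub_kernel t s \<le> t * (exp (1 / (4 * d)) * sub_kernel 1 s)"
        proof -
          have "exp (- t\<^sup>2 / (4 * s)) \<le> exp (1 / (4 * d) + - 1\<^sup>2 / (4 * s))"
          proof -
            have "- t\<^sup>2 / (4 * s) \<le> 0" using s by simp
            also have "0 \<le> 1 / (4 * d) + - 1\<^sup>2 / (4 * s)" using False d s by (simp add: field_simps)
            finally show ?thesis by simp
          qed
          then have "t / (2 * sqrt pi) / s powr (3 / 2) * exp (- t\<^sup>2 / (4 * s)) \<le>
              t / (2 * sqrt pi) / s powr (3 / 2) * (exp (1 / (4 * d)) * exp (- 1\<^sup>2 / (4 * s)))"
            using t unfolding exp_add by (intro mult_left_mono) auto
          then show ?thesis by (simp add: sub_kernel_def)
        qed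
        then have "sub_kernel t s * \<omega> s \<le> t * (exp (1 / (4 * d)) * sub_kernel 1 s) * (2 * B)"
          using \<omega>B[OF s] \<omega>0 t by (intro mult_mono) (auto simp: sub_kernel_nonneg)
        also have "\<dots> = K * t * sub_kernel 1 s" by (simp add: K_def)
        also have "\<dots> \<le> e / 2 * sub_kernel t s + K * t * sub_kernel 1 s"
          using e t by (simp add: sub_kernel_nonneg)
        finally show ?thesis .
      qed
      have "(\<integral>s. sub_kernel t s * \<omega> s \<partial>half_line) \<le> (\<integral>s. e / 2 * sub_kernel t s + K * t * sub_kernel 1 s \<partial>half_line)"
        using pt int\<omega>[OF t] sub_kernel_half_line[OF t] sub_kernel_half_line[of 1] by (intro integral_mono) auto
      also have "\<dots> = e / 2 + K * t"
        using sub_kernel_half_line[OF t] sub_kernel_half_line[of 1] by simp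
      finally show ?thesis using le[OF t] by simp
    qed
    have "(\<lambda>j. K * (1 / real (Suc j))) \<longlonglongrightarrow> K * 0"
      by (intro tendsto_intros LIMSEQ_Suc[OF lim_1_over_n])
    then have "\<forall>\<^sub>F j in sequentially. K * (1 / real (Suc j)) < e / 2"
      using e by (intro order_tendstoD) auto
    then obtain j0 where j0: "\<And>j. j0 \<le> j \<Longrightarrow> K * (1 / real (Suc j)) < e / 2"
      by (auto simp: eventually_sequentially)
    show "\<exists>j0. \<forall>j\<ge>j0. norm ((\<integral>x. norm (P (1 / real (Suc j)) f x - f x) \<partial>M) - 0) < e"
    proof (intro exI[of _ j0] allI impI)
      fix j assume "j0 \<le> j"
      have "(\<integral>x. norm (P (1 / real (Suc j)) f x - f x) \<partial>M) \<le> e / 2 + K * (1 / real (Suc j))"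
        by (rule est) simp
      then have "(\<integral>x. norm (P (1 / real (Suc j)) f x - f x) \<partial>M) < e"
        using j0[OF \<open>j0 \<le> j\<close>] by linarith
      then show "norm ((\<integral>x. norm (P (1 / real (Suc j)) f x - f x) \<partial>M) - 0) < e"
        by simp
    qed
  qed
qed

text \<open>Convergence in mean gives a.e. convergence along a subsequence, which is enough for
  passing to the limit in bounds.\<close>

lemma P_AE_tendsto:
  assumes f: "essbdd B f"
  shows "\<exists>X. (\<forall>j. 0 < X j) \<and> X \<longlonglongrightarrow> 0 \<and> (AE x in M. (\<lambda>j. P (X j) f x) \<longlonglongrightarrow> f x)"
proof -
  note [measurable] = essbdd_measurable[OF f]
  have "integrable M (\<lambda>x. P (1 / real (Suc j)) f x - f x)" for j
  proof (rule Bochner_Integration.integrable_diff)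
    show "integrable M (P (1 / real (Suc j)) f)"
      using essbdd_P[OF f, of "1 / real (Suc j)"] by (intro integrable_const_bound[where B = B]) (auto simp: essbdd_def)
    show "integrable M f"
      using f by (intro integrable_const_bound[where B = B]) (auto simp: essbdd_def)
  qed
  from tendsto_L1_AE_subseq[OF this P_L1_tendsto[OF f]] obtain r :: "nat \<Rightarrow> nat" where
    r: "strict_mono r" "AE x in M. (\<lambda>j. P (1 / real (Suc (r j))) f x - f x) \<longlonglongrightarrow> 0" by auto
  have "(\<lambda>j. 1 / real (Suc (r j))) \<longlonglongrightarrow> 0"
    using LIMSEQ_subseq_LIMSEQ[OF LIMSEQ_Suc[OF lim_1_over_n] r(1)] by (simp add: comp_def)
  with r(2) show ?thesis
    by (intro exI[of _ "\<lambda>j. 1 / real (Suc (r j))"]) (auto simp: LIM_zero_iff)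
qed

text \<open>The condition is imposed for each t almost everywhere, so the null set may vary with t,
  exactly as for an essential supremum at every t.\<close>

definition lip_bound :: "nat \<Rightarrow> real \<Rightarrow> real \<Rightarrow> real \<Rightarrow> ('a \<Rightarrow> complex) \<Rightarrow> bool" where
  "lip_bound n \<beta> A B f \<longleftrightarrow> essbdd B f \<and> 0 \<le> A \<and>
    (\<forall>t>0. AE x in M. norm (D n t f x) \<le> A * t powr (\<beta> - real n))"

text \<open>Half of the time carries the n derivatives controlled by the hypothesis, the other half
  the remaining m - n through the subordination bound. The second half also makes the estimate valid
  at every x.\<close>

lemma D_decay_high:
  assumes f: "lip_bound n \<beta> A B f" and m: "n \<le> m" and t: "0 < t" and x: "x \<in> space M"
  shows "norm (D m t f x) \<le> sub_const (m - n) * 2 powr (real m - \<beta>) * A * t powr (\<beta> - real m)"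
proof -
  have f': "essbdd B f" and n: "AE x in M. norm (D n (t / 2) f x) \<le> A * (t / 2) powr (\<beta> - real n)"
    using f t by (auto simp: lip_bound_def)
  note [measurable] = essbdd_measurable[OF f']
  have "D n (t / 2) f \<in> borel_measurable M" by measurable
  with n have e: "essbdd (A * (t / 2) powr (\<beta> - real n)) (D n (t / 2) f)" by (simp add: essbdd_def)
  have "D m t f x = D (m - n) (t / 2) (D n (t / 2) f) x"
    using D_D[OF f', of "t / 2" "t / 2" x "m - n" n] t x m by simp
  also have "norm \<dots> \<le> sub_const (m - n) * (A * (t / 2) powr (\<beta> - real n)) * (t / 2) powr (- real (m - n))"
    using t by (intro D_bound[OF e _ x]) auto
  also have "\<dots> = sub_const (m - n) * A * (t / 2) powr (\<beta> - real m)"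
    using m by (simp add: powr_add[symmetric] of_nat_diff mult.assoc)
  also have "(t / 2) powr (\<beta> - real m) = 2 powr (real m - \<beta>) * t powr (\<beta> - real m)"
    using t by (simp add: powr_divide powr_diff)
  finally show ?thesis by (simp add: mult_ac)
qed

text \<open>The constant is found before f, A and B are given. The case theta = 0 is subordination
  alone; positive theta is treated first for m >= n and then downwards in m.\<close>

lemma D_decay_ex:
  assumes "0 \<le> \<theta>" "\<theta> \<le> \<beta>" "\<theta> = 0 \<or> \<theta> < real m"
  shows "\<exists>C\<ge>0. \<forall>f A B. lip_bound n \<beta> A B f \<longrightarrow>
    (\<forall>x\<in>space M. \<forall>t>0. norm (D m t f x) \<le> C * (A + B) * t powr (\<theta> - real m))"
proof (cases "\<theta> = 0")
  case True
  show ?thesis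
  proof (intro exI[of _ "sub_const m"] conjI allI impI ballI)
    fix f A B x t assume f: "lip_bound n \<beta> A B f" and x: "x \<in> space M" and t: "0 < (t::real)"
    have e: "essbdd B f" "0 \<le> A" using f by (auto simp: lip_bound_def)
    have "norm (D m t f x) \<le> sub_const m * B * t powr (- real m)" by (rule D_bound[OF e(1) t x])
    also have "\<dots> \<le> sub_const m * (A + B) * t powr (- real m)"
      using e sub_const(1) by (intro mult_right_mono mult_left_mono) auto
    finally show "norm (D m t f x) \<le> sub_const m * (A + B) * t powr (\<theta> - real m)" using True by simp
  qed (rule sub_const)
next
  case False
  then have \<theta>: "0 < \<theta>" "\<theta> \<le> \<beta>" "\<theta> < real m" using assms by auto
  then show ?thesis
  \<comment> \<open>Each step lowers m by one by integrating the next derivative from infinity;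
    theta < m is inherited by m + 1.\<close>
  proof (induction "n - m" arbitrary: m)
    case 0
    then have nm: "n \<le> m" by simp
    let ?C = "sub_const m + sub_const (m - n) * 2 powr (real m - \<beta>)"
    show ?case
    proof (intro exI[of _ ?C] conjI allI impI ballI)
      fix f A B x t assume f: "lip_bound n \<beta> A B f" and x: "x \<in> space M" and t: "0 < (t::real)"
      have e: "essbdd B f" "0 \<le> A" using f by (auto simp: lip_bound_def)
      have B: "0 \<le> B" by (rule essbdd_nonneg[OF e(1)])
      note c0 = sub_const(1)[of m] sub_const(1)[of "m - n"]
      \<comment> \<open>Below time 1 the stronger exponent beta is available and theta <= beta;
        above time 1 the exponent 0 is already better than theta.\<close>
      show "norm (D m t f x) \<le> ?C * (A + B) * t powr (\<theta> - real m)"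
      proof (cases "t \<le> 1")
        case True
        have "norm (D m t f x) \<le> sub_const (m - n) * 2 powr (real m - \<beta>) * A * t powr (\<beta> - real m)"
          by (rule D_decay_high[OF f nm t x])
        also have "\<dots> \<le> ?C * (A + B) * t powr (\<theta> - real m)"
          using \<theta> t True e B c0 by (intro mult_mono powr_mono') auto
        finally show ?thesis .
      next
        case False
        have "norm (D m t f x) \<le> sub_const m * B * t powr (- real m)" by (rule D_bound[OF e(1) t x])
        also have "\<dots> \<le> ?C * (A + B) * t powr (\<theta> - real m)"
          using \<theta> t False e B c0 by (intro mult_mono powr_mono) auto
        finally show ?thesis .
      qed
    qed (use sub_const in auto)
  next
    case (Suc d)
    from Suc.hyps(1)[of "Suc m"] Suc.hyps(2) Suc.prems obtain C where C: "0 \<le> C"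
      "\<And>f A B x t. lip_bound n \<beta> A B f \<Longrightarrow> x \<in> space M \<Longrightarrow> 0 < t \<Longrightarrow>
        norm (D (Suc m) t f x) \<le> C * (A + B) * t powr (\<theta> - real (Suc m))"
      by fastforce
    show ?case
    proof (intro exI[of _ "C / (real m - \<theta>)"] conjI allI impI ballI)
      fix f A B x t assume f: "lip_bound n \<beta> A B f" and x: "x \<in> space M" and t: "0 < (t::real)"
      have e: "essbdd B f" "0 \<le> A" using f by (auto simp: lip_bound_def)
      have B: "0 \<le> B" by (rule essbdd_nonneg[OF e(1)])
      have "norm (D m t f x) \<le> C * (A + B) / (- (\<theta> - real m)) * t powr (\<theta> - real m)"
      proof (rule tail_bound_of_power_derivative_bound)
        show "((\<lambda>t. D m t f x) has_vector_derivative D (Suc m) u f x) (at u)" if "0 < u" for u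
          by (rule has_vector_derivative_D[OF e(1) that x])
        show "norm (D (Suc m) u f x) \<le> C * (A + B) * u powr (\<theta> - real m - 1)" if "0 < u" for u
          using C(2)[OF f x that] by (simp add: algebra_simps)
        \<comment> \<open>The orders reached here satisfy m > theta > 0, so t^(- m) does tend to
          0.\<close>
        have lim: "((\<lambda>t. sub_const m * B * t powr (- real m)) \<longlongrightarrow> sub_const m * B * 0) at_top"
          using Suc.prems \<theta> by (intro tendsto_intros tendsto_neg_powr filterlim_ident) auto
        show "((\<lambda>t. D m t f x) \<longlongrightarrow> 0) at_top"
        proof (rule Lim_null_comparison)
          show "\<forall>\<^sub>F t in at_top. norm (D m t f x) \<le> sub_const m * B * t powr (- real m)"
            using eventually_gt_at_top[of 0] by eventually_elim (rule D_bound[OF e(1) _ x])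
        qed (use lim in simp)
      qed (use Suc.prems C e B t in auto)
      then show "norm (D m t f x) \<le> C / (real m - \<theta>) * (A + B) * t powr (\<theta> - real m)" by simp
    qed (use C Suc.prems in auto)
  qed
qed

text \<open>Choice turns the constants into a function of m and theta common to all f; the data of f
  enter only as the factor A + B.\<close>

lemma D_decay:
  obtains C where "\<And>m \<theta>. 0 \<le> C m \<theta>"
    "\<And>f A B x. lip_bound n \<beta> A B f \<Longrightarrow> x \<in> space M \<Longrightarrow>
      decaying_derivatives (\<lambda>m t. D m t f x) (\<lambda>m \<theta>. C m \<theta> * (A + B)) \<beta>"
proof -
  have "\<forall>m \<theta>. \<exists>C. 0 \<le> C \<and> (0 \<le> \<theta> \<longrightarrow> \<theta> \<le> \<beta> \<longrightarrow> \<theta> = 0 \<or> \<theta> < real m \<longrightarrow>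
    (\<forall>f A B. lip_bound n \<beta> A B f \<longrightarrow>
      (\<forall>x\<in>space M. \<forall>t>0. norm (D m t f x) \<le> C * (A + B) * t powr (\<theta> - real m))))"
    using D_decay_ex[of _ \<beta> _ n] by (metis order_refl)
  then obtain C where C: "\<And>m \<theta>. 0 \<le> C m \<theta>"
    "\<And>m \<theta> f A B x t. 0 \<le> \<theta> \<Longrightarrow> \<theta> \<le> \<beta> \<Longrightarrow> \<theta> = 0 \<or> \<theta> < real m \<Longrightarrow> lip_bound n \<beta> A B f \<Longrightarrow>
      x \<in> space M \<Longrightarrow> 0 < t \<Longrightarrow> norm (D m t f x) \<le> C m \<theta> * (A + B) * t powr (\<theta> - real m)"
    by metis
  show ?thesis
  proof (rule that[OF C(1)])
    fix f A B x assume f: "lip_bound n \<beta> A B f" and x: "x \<in> space M"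
    have e: "essbdd B f" "0 \<le> A" using f by (auto simp: lip_bound_def)
    have "0 \<le> B" by (rule essbdd_nonneg[OF e(1)])
    then show "decaying_derivatives (\<lambda>m t. D m t f x) (\<lambda>m \<theta>. C m \<theta> * (A + B)) \<beta>"
      by unfold_locales (use e C has_vector_derivative_D[OF e(1) _ x] f x in auto)
  qed
qed

end

section \<open>Fractional powers\<close>

text \<open>At t = 0 the subordination formula returns 0 instead of f; this is the corrected orbit
  including its starting point.\<close>

definition (in density_semigroup) P0 :: "real \<Rightarrow> ('a \<Rightarrow> complex) \<Rightarrow> 'a \<Rightarrow> complex" where
  "P0 t f x = (if t = 0 then f x else P t f x)"

text \<open>The bound \<open>1 - c s \<le> s\<close> makes a factor 1 - c worth one power of s. The
  bounds on \<open>lam\<close> leave room for an exponent above it, and the bound on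
  \<open>n'\<close> for one below it.\<close>

locale fractional_power = density_semigroup M G
  for M :: "'a measure" and G :: "real \<Rightarrow> 'a \<Rightarrow> 'a \<Rightarrow> real" +
  fixes c :: "real \<Rightarrow> real" and k :: nat and lam \<beta> :: real and n n' :: nat
  assumes c_measurable [measurable]: "c \<in> borel_measurable borel"
    and c: "0 < s \<Longrightarrow> 0 \<le> c s" "0 < s \<Longrightarrow> c s \<le> 1" "0 < s \<Longrightarrow> 1 - c s \<le> s"
    and lam: "0 < lam" "lam < real k" "lam < \<beta>" and n': "\<beta> - lam < real n'"
begin

definition Q :: "real \<Rightarrow> ('a \<Rightarrow> complex) \<Rightarrow> 'a \<Rightarrow> complex" where
  "Q s g y = c s *\<^sub>R P s g y - g y"

definition S :: "('a \<Rightarrow> complex) \<Rightarrow> 'a \<Rightarrow> complex" where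
  "S f x = (\<integral>s. s powr (- lam - 1) *\<^sub>R (Q s ^^ k) f x \<partial>half_line)"

text \<open>For t > 0 this is the m-th t-derivative of P_t (Q_s^k f)(x). \<open>V\<close> below
  replaces \<open>W 0\<close> where t = 0 must be allowed, the value there being Q_s^k f(x).\<close>

definition W :: "nat \<Rightarrow> ('a \<Rightarrow> complex) \<Rightarrow> 'a \<Rightarrow> real \<Rightarrow> real \<Rightarrow> complex" where
  "W m f x s t = (wdiff (c s) s ^^ k) (\<lambda>t. D m t f x) t"

definition V :: "('a \<Rightarrow> complex) \<Rightarrow> 'a \<Rightarrow> real \<Rightarrow> real \<Rightarrow> complex" where
  "V f x s t = (wdiff (c s) s ^^ k) (\<lambda>t. P0 t f x) t"

lemma funpow_wdiff_measurable:
  fixes g :: "real \<Rightarrow> 'a \<Rightarrow> complex"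
  assumes g: "(\<lambda>(t, x). g t x) \<in> borel_measurable (borel \<Otimes>\<^sub>M M)"
    and [measurable]: "s \<in> borel_measurable N" "x \<in> N \<rightarrow>\<^sub>M M" and t: "t \<in> borel_measurable N"
  shows "(\<lambda>z. (wdiff (c (s z)) (s z) ^^ j) (\<lambda>t. g t (x z)) (t z)) \<in> borel_measurable N"
  using t
proof (induction j arbitrary: t)
  case 0
  note [measurable] = 0
  have "(\<lambda>z. (\<lambda>(t, x). g t x) (t z, x z)) \<in> borel_measurable N"
    by (rule measurable_compose[OF _ g]) measurable
  then show ?case by simp
next
  case (Suc j)
  have 1: "(\<lambda>z. c (s z)) \<in> borel_measurable N"
    by (rule measurable_compose[OF assms(2) c_measurable])
  have 2: "(\<lambda>z. t z + s z) \<in> borel_measurable N"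
    using Suc.prems assms(2) by (rule borel_measurable_add)
  have eq: "(wdiff (c (s z)) (s z) ^^ Suc j) (\<lambda>t. g t (x z)) (t z) =
      c (s z) *\<^sub>R (wdiff (c (s z)) (s z) ^^ j) (\<lambda>t. g t (x z)) (t z + s z) -
      (wdiff (c (s z)) (s z) ^^ j) (\<lambda>t. g t (x z)) (t z)" for z
    by (simp add: wdiff_def[of _ _ "(wdiff (c (s z)) (s z) ^^ j) (\<lambda>t. g t (x z))"])
  show ?case
    unfolding eq
    by (rule borel_measurable_diff[OF borel_measurable_scaleR[OF 1 Suc.IH[OF 2]] Suc.IH[OF Suc.prems]])
qed

lemma W_measurable:
  assumes [measurable]: "f \<in> borel_measurable M" "s \<in> borel_measurable N" "x \<in> N \<rightarrow>\<^sub>M M" "t \<in> borel_measurable N"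
  shows "(\<lambda>z. W m f (x z) (s z) (t z)) \<in> borel_measurable N"
  unfolding W_def by (rule funpow_wdiff_measurable[where g = "\<lambda>t x. D m t f x"]) measurable

lemma V_measurable:
  assumes [measurable]: "f \<in> borel_measurable M" "s \<in> borel_measurable N" "x \<in> N \<rightarrow>\<^sub>M M" "t \<in> borel_measurable N"
  shows "(\<lambda>z. V f (x z) (s z) (t z)) \<in> borel_measurable N"
  unfolding V_def by (rule funpow_wdiff_measurable[where g = "\<lambda>t x. P0 t f x"]) (unfold P0_def, measurable)

lemma V_eq_W: "0 < s \<Longrightarrow> 0 < t \<Longrightarrow> V f x s t = W 0 f x s t"
  unfolding V_def W_def by (rule funpow_wdiff_cong_pos) (auto simp: P0_def D_0)

lemma essbdd_Q:
  assumes f: "essbdd B f" and s: "0 < s"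
  shows "essbdd (2 * B) (Q s f)"
proof -
  note [measurable] = essbdd_measurable[OF f]
  have "Q s f \<in> borel_measurable M" unfolding Q_def by measurable
  moreover have "AE x in M. norm (f x) \<le> B" using f by (simp add: essbdd_def)
  then have "AE x in M. norm (Q s f x) \<le> 2 * B"
    using AE_space
  proof eventually_elim
    case (elim x)
    have "norm (Q s f x) \<le> norm (c s *\<^sub>R P s f x) + norm (f x)"
      unfolding Q_def by (rule norm_triangle_ineq4)
    also have "norm (c s *\<^sub>R P s f x) \<le> 1 * B"
      unfolding norm_scaleR using c[OF s] P_bound[OF f s] elim by (intro mult_mono) auto
    finally show ?case using elim by simp
  qed
  ultimately show ?thesis by (simp add: essbdd_def)
qed

lemma essbdd_funpow_Q:
  assumes f: "essbdd B f" and s: "0 < s"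
  shows "essbdd (2 ^ j * B) ((Q s ^^ j) f)"
proof (induction j)
  case (Suc j)
  then show ?case using essbdd_Q[OF Suc s] by (simp add: mult.assoc)
qed (use f in simp)

text \<open>By P_t P_s = P_(t + s), applying Q_s to the function is the same as applying the
  weighted difference to its orbit. Including t = 0 gives the formula for Q_s^j f itself.\<close>

lemma P0_funpow_Q:
  assumes f: "essbdd B f" and s: "0 < s" and x: "x \<in> space M" and t: "0 \<le> t"
  shows "P0 t ((Q s ^^ j) f) x = (wdiff (c s) s ^^ j) (\<lambda>t. P0 t f x) t"
  using t
proof (induction j arbitrary: t)
  case (Suc j)
  let ?g = "(Q s ^^ j) f"
  have g: "essbdd (2 ^ j * B) ?g" by (rule essbdd_funpow_Q[OF f s])
  have "P0 t (Q s ?g) x = c s *\<^sub>R P0 (t + s) ?g x - P0 t ?g x"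
  proof (cases "t = 0")
    case True
    then show ?thesis using s by (simp add: P0_def Q_def)
  next
    case False
    with Suc.prems have t: "0 < t" by simp
    have "P t (Q s ?g) x = (\<integral>y. c s *\<^sub>R P s ?g y - ?g y \<partial>KP t x)"
      by (simp only: P_eq_KP[OF essbdd_Q[OF g s] t x] Q_def)
    also have "\<dots> = c s *\<^sub>R P t (P s ?g) x - P t ?g x"
      using essbdd_integrable_KP[OF essbdd_P[OF g s] t x] essbdd_integrable_KP[OF g t x]
      by (simp add: P_eq_KP[OF essbdd_P[OF g s] t x] P_eq_KP[OF g t x])
    finally show ?thesis using t s P_semigroup[OF g t s x] by (simp add: P0_def)
  qed
  then show ?case
    using Suc.IH[of t] Suc.IH[of "t + s"] Suc.prems s
    by (simp add: wdiff_def[of "c s" s "(wdiff (c s) s ^^ j) (\<lambda>t. P0 t f x)"])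
qed simp

lemma V_eq: 
  assumes f: "essbdd B f" and s: "0 < s" and x: "x \<in> space M"
  shows "(Q s ^^ k) f x = V f x s 0" "0 < t \<Longrightarrow> P t ((Q s ^^ k) f) x = W 0 f x s t"
  using P0_funpow_Q[OF f s x, of 0 k] P0_funpow_Q[OF f s x, of t k] V_eq_W[OF s, of t f x]
  by (auto simp: V_def P0_def)

text \<open>Midpoint of the gap above \<open>lam\<close>: it makes s^(zeta - lam - 1) integrable at
  0 and stays below k and beta.\<close>

definition \<zeta>\<^sub>1 :: real where "\<zeta>\<^sub>1 = (lam + min (real k) \<beta>) / 2"

text \<open>Midpoint of the gap below \<open>lam\<close>: it makes s^(zeta - lam - 1) integrable at
  infinity, while zeta > beta - n' keeps beta - zeta admissible for derivatives of order n'.\<close>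

definition \<zeta>\<^sub>2 :: real where "\<zeta>\<^sub>2 = (lam + max 0 (\<beta> - real n')) / 2"

lemma \<zeta>\<^sub>1: "lam < \<zeta>\<^sub>1" "\<zeta>\<^sub>1 < real k" "\<zeta>\<^sub>1 < \<beta>" "0 < \<zeta>\<^sub>1"
  using lam by (auto simp: \<zeta>\<^sub>1_def)

lemma \<zeta>\<^sub>2: "0 < \<zeta>\<^sub>2" "\<zeta>\<^sub>2 < lam" "\<beta> - real n' < \<zeta>\<^sub>2"
  using lam n' by (auto simp: \<zeta>\<^sub>2_def max_def)

text \<open>Used for s >= 1, where s^(- lam - 1) is integrable by itself and cancellation in the
  difference is dispensed with.\<close>

lemma W_trivial_bound:
  assumes f: "essbdd B f" and s: "0 < s" and t: "0 < t" and x: "x \<in> space M"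
  shows "norm (W m f x s t) \<le> 2 ^ k * (sub_const m * B * t powr (- real m))"
  unfolding W_def
proof (rule norm_funpow_wdiff_le[where t0 = t])
  fix u assume u: "0 < u" "t \<le> u"
  have "norm (D m u f x) \<le> sub_const m * B * u powr (- real m)" by (rule D_bound[OF f u(1) x])
  also have "\<dots> \<le> sub_const m * B * t powr (- real m)"
    using t u sub_const(1) essbdd_nonneg[OF f] by (intro mult_left_mono powr_mono2') auto
  finally show "norm (D m u f x) \<le> sub_const m * B * t powr (- real m)" .
qed (use s t c[OF s] in auto)

text \<open>Two constants are added: \<open>I 0\<close> bounds the size of S f through a majorant
  uniform as t tends to 0, and \<open>C1\<close> bounds the n'-th derivative through the split at s
  = t. Both precede f.\<close>

lemma frac_main:
  obtains C where "0 \<le> C"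
    "\<And>f A B. lip_bound n \<beta> A B f \<Longrightarrow>
       AE x in M. integrable half_line (\<lambda>s. s powr (- lam - 1) *\<^sub>R (Q s ^^ k) f x)"
    "\<And>f A B. lip_bound n \<beta> A B f \<Longrightarrow> essbdd (C * (A + B)) (S f)"
    "\<And>f A B x t. lip_bound n \<beta> A B f \<Longrightarrow> x \<in> space M \<Longrightarrow> 0 < t \<Longrightarrow>
       norm (D n' t (S f) x) \<le> C * (A + B) * t powr (\<beta> - lam - real n')"
proof -
  obtain K where K: "\<And>m \<theta>. 0 \<le> K m \<theta>"
    "\<And>f A B x. lip_bound n \<beta> A B f \<Longrightarrow> x \<in> space M \<Longrightarrow>
      decaying_derivatives (\<lambda>m t. D m t f x) (\<lambda>m \<theta>. K m \<theta> * (A + B)) \<beta>"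
    using D_decay[of n \<beta>] by blast
  have wK: "0 \<le> wdiff_const K i j \<gamma> \<zeta>" for i j \<gamma> \<zeta>
    unfolding wdiff_const_def using K(1) by (auto intro!: sum_nonneg mult_nonneg_nonneg)
  define E where "E = (\<lambda>m. wdiff_const K m k \<zeta>\<^sub>1 \<zeta>\<^sub>1)"
  define F where "F = (\<lambda>m. 2 ^ k * sub_const m)"
  \<comment> \<open>A majorant in s alone, integrable against s^(- lam - 1). The factor
    \<open>s powr 0\<close> brings it into the form of \<open>integral_split_powers\<close>.\<close>
  define \<Phi> where "\<Phi> = (\<lambda>m s. if s < 1 then E m * s powr \<zeta>\<^sub>1 else F m * s powr 0)"
  define I where "I = (\<lambda>m. \<integral>s. s powr (- lam - 1) * \<Phi> m s \<partial>half_line)"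
  define C1 where "C1 = wdiff_const K n' k \<beta> \<zeta>\<^sub>1 / (\<zeta>\<^sub>1 - lam) + wdiff_const K n' k \<beta> \<zeta>\<^sub>2 / (lam - \<zeta>\<^sub>2)"
  have EF: "0 \<le> E m" "0 \<le> F m" for m
    using wK sub_const(1) by (auto simp: E_def F_def)
  have \<Phi>0: "0 \<le> \<Phi> m s" for m s using EF by (simp add: \<Phi>_def)
  have \<Phi>int: "integrable half_line (\<lambda>s. s powr (- lam - 1) * \<Phi> m s)" for m
    unfolding \<Phi>_def using integral_split_powers(1)[of 1 0 lam \<zeta>\<^sub>1] lam \<zeta>\<^sub>1 by simp
  have I0: "0 \<le> I m" for m
    unfolding I_def using \<Phi>0 by (intro integral_nonneg_AE) auto
  have C10: "0 \<le> C1" using \<zeta>\<^sub>1 \<zeta>\<^sub>2 wK by (auto simp: C1_def)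
  \<comment> \<open>For s < 1 the choice gamma = zeta spends the whole exponent on s and leaves t^(-
    m); for s >= 1 the trivial bound has the same power of t.\<close>
  have Wbound: "norm (W m f x s t) \<le> (A + B) * t powr (- real m) * \<Phi> m s"
    if f: "lip_bound n \<beta> A B f" and x: "x \<in> space M" and s: "0 < s" and t: "0 < t" for f A B x s t m
  proof (cases "s < 1")
    case True
    interpret dd: decaying_derivatives "\<lambda>m t. D m t f x" "\<lambda>m \<theta>. K m \<theta> * (A + B)" \<beta>
      by (rule K(2)[OF f x])
    have "norm (W m f x s t) \<le> wdiff_const (\<lambda>m \<theta>. K m \<theta> * (A + B)) m k \<zeta>\<^sub>1 \<zeta>\<^sub>1 * t powr (\<zeta>\<^sub>1 - real m - \<zeta>\<^sub>1) * s powr \<zeta>\<^sub>1"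
      unfolding W_def by (rule dd.norm_wdiff_le) (use \<zeta>\<^sub>1 s t c[OF s] in auto)
    then show ?thesis using True unfolding wdiff_const_cmult by (simp add: \<Phi>_def E_def mult_ac)
  next
    case False
    have e: "essbdd B f" "0 \<le> A" using f by (auto simp: lip_bound_def)
    have "norm (W m f x s t) \<le> 2 ^ k * (sub_const m * B * t powr (- real m))"
      by (rule W_trivial_bound[OF e(1) s t x])
    also have "\<dots> \<le> 2 ^ k * (sub_const m * (A + B) * t powr (- real m))"
      using e sub_const(1) by (intro mult_left_mono mult_right_mono) auto
    finally show ?thesis using False s by (simp add: \<Phi>_def F_def mult_ac)
  qed
  \<comment> \<open>For m = 0 the right-hand side of \<open>Wbound\<close> is independent of t, so
    the bound survives t -> 0 along the sequence X. The null set is that of X and hence common to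
    all s.\<close>
  have Vbound: "AE x in M. \<forall>s\<in>space half_line. norm (s powr (- lam - 1) *\<^sub>R V f x s 0) \<le> (A + B) * (s powr (- lam - 1) * \<Phi> 0 s)"
    if f: "lip_bound n \<beta> A B f" for f A B
  proof -
    have e: "essbdd B f" using f by (auto simp: lip_bound_def)
    obtain X where X: "\<And>j. 0 < X j" "X \<longlonglongrightarrow> 0" "AE x in M. (\<lambda>j. P (X j) f x) \<longlonglongrightarrow> f x"
      using P_AE_tendsto[OF e] by auto
    show ?thesis using X(3) AE_space
    proof eventually_elim
      case (elim x)
      \<comment> \<open>At a = 0 this is the a.e. convergence along X; at a > 0 it is continuity of
        the orbit.\<close>
      have lim: "(\<lambda>j. P0 (X j + a) f x) \<longlonglongrightarrow> P0 a f x" if "0 \<le> a" for a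
      proof (cases "a = 0")
        case True
        then show ?thesis using elim X(1) by (simp add: P0_def less_imp_neq[symmetric])
      next
        case False
        have "isCont (\<lambda>t. D 0 t f x) a"
          using has_vector_derivative_continuous[OF has_vector_derivative_D[OF e, of a x 0]] False that elim by simp
        moreover have "(\<lambda>j. X j + a) \<longlonglongrightarrow> a" using tendsto_add[OF X(2) tendsto_const, of a] by simp
        ultimately have "(\<lambda>j. D 0 (X j + a) f x) \<longlonglongrightarrow> D 0 a f x" by (rule isCont_tendsto_compose)
        then show ?thesis
          using False that X(1) by (simp add: P0_def D_0 add_pos_nonneg less_imp_neq[symmetric])
      qed
      show ?case
      proof
        fix s assume "s \<in> space half_line"
        then have s: "0 < s" by simp
        have "(\<lambda>j. V f x s (X j + 0)) \<longlonglongrightarrow> V f x s 0"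
          unfolding V_def by (rule tendsto_funpow_wdiff) (use lim s in auto)
        then have "(\<lambda>j. norm (V f x s (X j + 0))) \<longlonglongrightarrow> norm (V f x s 0)" by (rule tendsto_norm)
        moreover have "norm (V f x s (X j + 0)) \<le> (A + B) * \<Phi> 0 s" for j
          using Wbound[OF f _ s X(1), of x 0 j] V_eq_W[OF s X(1), of f x j] X(1)[of j] elim by simp
        ultimately have "norm (V f x s 0) \<le> (A + B) * \<Phi> 0 s"
          by (intro LIMSEQ_le_const2) auto
        then have "s powr (- lam - 1) * norm (V f x s 0) \<le> s powr (- lam - 1) * ((A + B) * \<Phi> 0 s)"
          by (intro mult_left_mono) auto
        then show "norm (s powr (- lam - 1) *\<^sub>R V f x s 0) \<le> (A + B) * (s powr (- lam - 1) * \<Phi> 0 s)"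
          by (simp add: mult_ac)
      qed
    qed
  qed
  have id_half [measurable]: "(\<lambda>s. s) \<in> borel_measurable half_line" by (rule sets_half_line_id)
  show ?thesis
  proof (rule that[of "I 0 + C1"])
    show "0 \<le> I 0 + C1" using I0 C10 by simp
  next
    fix f A B assume f: "lip_bound n \<beta> A B f"
    then have e: "essbdd B f" "0 \<le> A" by (auto simp: lip_bound_def)
    have B: "0 \<le> B" by (rule essbdd_nonneg[OF e(1)])
    note [measurable] = essbdd_measurable[OF e(1)]
    let ?v = "\<lambda>x s. s powr (- lam - 1) *\<^sub>R V f x s 0"
    have vm: "(\<lambda>(s, x). ?v x s) \<in> borel_measurable (half_line \<Otimes>\<^sub>M M)"
      unfolding split_beta' by (intro borel_measurable_scaleR powr_real_measurable V_measurable) measurable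
    have eq: "s powr (- lam - 1) *\<^sub>R (Q s ^^ k) f x = ?v x s" if "s \<in> space half_line" "x \<in> space M" for s x
      using V_eq(1)[OF e(1) _ that(2), of s] that by simp
    have AEint: "AE x in M. integrable half_line (?v x) \<and> norm (\<integral>s. ?v x s \<partial>half_line) \<le> I 0 * (A + B)"
      using Vbound[OF f] AE_space
    proof eventually_elim
      case (elim x)
      have m: "?v x \<in> borel_measurable half_line"
        using elim by (intro borel_measurable_scaleR powr_real_measurable V_measurable) measurable
      have int: "integrable half_line (?v x)"
        by (rule Bochner_Integration.integrable_bound[OF integrable_mult_right[OF \<Phi>int[of 0], of "A + B"] m])
          (use elim in \<open>auto intro!: AE_I2 order_trans[OF _ abs_ge_self]\<close>)
      have "norm (\<integral>s. ?v x s \<partial>half_line) \<le> (\<integral>s. norm (?v x s) \<partial>half_line)"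
        by (rule integral_norm_bound)
      also have "\<dots> \<le> (\<integral>s. (A + B) * (s powr (- lam - 1) * \<Phi> 0 s) \<partial>half_line)"
        using elim \<Phi>int by (intro integral_mono integrable_norm int) auto
      also have "\<dots> = I 0 * (A + B)" by (simp add: I_def)
      finally show ?case using int by simp
    qed
    have Seq: "S f x = (\<integral>s. ?v x s \<partial>half_line)" if "x \<in> space M" for x
      unfolding S_def using eq that by (intro Bochner_Integration.integral_cong) auto
    show "AE x in M. integrable half_line (\<lambda>s. s powr (- lam - 1) *\<^sub>R (Q s ^^ k) f x)"
      using AEint AE_space
    proof eventually_elim
      case (elim x)
      then show ?case
        by (subst Bochner_Integration.integrable_cong[OF refl eq]) auto
    qed
    have "(\<lambda>x. \<integral>s. ?v x s \<partial>half_line) \<in> borel_measurable M" using vm by measurable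
    then have Sm[measurable]: "S f \<in> borel_measurable M"
      by (subst measurable_cong[OF Seq])
    have AES: "AE x in M. norm (S f x) \<le> I 0 * (A + B)"
      using AEint AE_space by eventually_elim (simp add: Seq)
    then have eI: "essbdd (I 0 * (A + B)) (S f)" by (simp add: essbdd_def)
    then show "essbdd ((I 0 + C1) * (A + B)) (S f)"
      by (rule essbdd_mono) (use C10 e B in \<open>auto intro!: mult_right_mono\<close>)
    fix x t assume x: "x \<in> space M" and t: "0 < (t::real)"
    note [measurable] = x
    let ?w = "\<lambda>m s t. s powr (- lam - 1) *\<^sub>R W m f x s t"
    have wm: "(\<lambda>s. ?w m s t) \<in> borel_measurable half_line" for m t
      by (intro borel_measurable_scaleR powr_real_measurable W_measurable) measurable
    \<comment> \<open>Replacing u by a smaller t makes the majorant independent of u, as required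
      for differentiating under the integral near a given time.\<close>
    have wb: "norm (?w m s u) \<le> (A + B) * t powr (- real m) * (s powr (- lam - 1) * \<Phi> m s)"
      if "s \<in> space half_line" "0 < t" "t \<le> u" for m s u t
    proof -
      have "norm (?w m s u) \<le> s powr (- lam - 1) * ((A + B) * u powr (- real m) * \<Phi> m s)"
        using Wbound[OF f x, of s u m] that by (auto intro!: mult_left_mono)
      also have "\<dots> \<le> s powr (- lam - 1) * ((A + B) * t powr (- real m) * \<Phi> m s)"
        using that e B \<Phi>0 by (intro mult_left_mono mult_right_mono powr_mono2') auto
      finally show ?thesis by (simp add: mult_ac)
    qed
    have wi: "integrable half_line (\<lambda>s. ?w m s t)" if "0 < t" for m t
      by (rule Bochner_Integration.integrable_bound[OF integrable_mult_right[OF \<Phi>int[of m], of "(A + B) * t powr (- real m)"] wm])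
        (use wb[OF _ that order_refl] in \<open>auto intro!: AE_I2 order_trans[OF _ abs_ge_self]\<close>)
    \<comment> \<open>Fubini moves \<open>P u\<close> under the s-integral. The a.e. majorant
      \<open>Vbound\<close> transfers to \<open>KP u x\<close>, which is absolutely
      continuous.\<close>
    have PS: "P u (S f) x = (\<integral>s. ?w 0 s u \<partial>half_line)" if u: "0 < u" for u
    proof -
      interpret KPx: prob_space "KP u x" using u x by (rule prob_space_KP)
      have "P u (S f) x = (\<integral>y. (\<integral>s. ?v y s \<partial>half_line) \<partial>KP u x)"
        unfolding P_eq_KP[OF eI u x] using Seq by (intro Bochner_Integration.integral_cong) auto
      also have "\<dots> = (\<integral>s. (\<integral>y. ?v y s \<partial>KP u x) \<partial>half_line)"
      proof (rule Fubini_dominated)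
        show "AE y in KP u x. \<forall>s\<in>space half_line. norm (?v y s) \<le> (A + B) * (s powr (- lam - 1) * \<Phi> 0 s)"
          by (rule AE_KP[OF x Vbound[OF f]])
        show "integrable half_line (\<lambda>s. (A + B) * (s powr (- lam - 1) * \<Phi> 0 s))" using \<Phi>int by simp
        show "(\<lambda>(s, x). ?v x s) \<in> borel_measurable (half_line \<Otimes>\<^sub>M KP u x)"
          using vm by (simp cong: measurable_cong_sets)
      qed (use sigma_finite_half_line KPx.finite_measure_axioms in auto)
      also have "\<dots> = (\<integral>s. ?w 0 s u \<partial>half_line)"
      proof (rule Bochner_Integration.integral_cong[OF refl])
        fix s assume "s \<in> space half_line"
        then have s: "0 < s" by simp
        have "W 0 f x s u = P u ((Q s ^^ k) f) x" by (rule V_eq(2)[OF e(1) s x u, symmetric])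
        also have "\<dots> = (\<integral>y. V f y s 0 \<partial>KP u x)"
          unfolding P_eq_KP[OF essbdd_funpow_Q[OF e(1) s] u x]
          using V_eq(1)[OF e(1) s] by (intro Bochner_Integration.integral_cong) auto
        finally show "(\<integral>y. ?v y s \<partial>KP u x) = ?w 0 s u" by simp
      qed
      finally show ?thesis .
    qed
    \<comment> \<open>All t-derivatives of the orbit of S f are taken under the s-integral, where
      they act on the weighted differences.\<close>
    have Dm: "D m u (S f) x = (\<integral>s. ?w m s u \<partial>half_line)" if u: "0 < u" for m u
    proof -
      have "D m u (S f) x = ((\<lambda>g u. vector_derivative g (at u)) ^^ m) (\<lambda>u. P u (S f) x) u"
        by (rule funpow_vector_derivative_P[OF eI u x, symmetric])
      also have "\<dots> = (\<integral>s. ?w m s u \<partial>half_line)"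
      proof (rule funpow_vector_derivative_eq[where U = "\<lambda>m u. \<integral>s. ?w m s u \<partial>half_line"])
        fix i and v :: real assume v: "0 < v"
        show "((\<lambda>u. \<integral>s. ?w i s u \<partial>half_line) has_vector_derivative (\<integral>s. ?w (Suc i) s v \<partial>half_line)) (at v)"
        proof (rule has_vector_derivative_integral_dominated[where a = "v / 2" and b = "2 * v"])
          show "integrable half_line (\<lambda>s. (A + B) * (v / 2) powr (- real (Suc i)) * (s powr (- lam - 1) * \<Phi> (Suc i) s))"
            using \<Phi>int by simp
          show "((\<lambda>u. ?w i s u) has_vector_derivative ?w (Suc i) s u) (at u)"
            if "v / 2 < u" "s \<in> space half_line" for u s
            unfolding W_def using that v
            by (intro bounded_linear.has_vector_derivative[OF bounded_linear_scaleR_right]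
                has_vector_derivative_funpow_wdiff has_vector_derivative_D[OF e(1) _ x]) auto
          show "norm (?w (Suc i) s u) \<le> (A + B) * (v / 2) powr (- real (Suc i)) * (s powr (- lam - 1) * \<Phi> (Suc i) s)"
            if "v / 2 < u" "s \<in> space half_line" for u s
            by (rule wb) (use that v in auto)
        qed (use v wi wm in auto)
      qed (use PS u in auto)
      finally show ?thesis .
    qed
    interpret dd: decaying_derivatives "\<lambda>m t. D m t f x" "\<lambda>m \<theta>. K m \<theta> * (A + B)" \<beta>
      by (rule K(2)[OF f x])
    \<comment> \<open>Now gamma = beta: only zeta of the exponent is traded for s, and the rest
      improves the power of t.\<close>
    have sc: "norm (W n' f x s t) \<le> (A + B) * t powr (\<beta> - real n' - \<zeta>) * (wdiff_const K n' k \<beta> \<zeta> * s powr \<zeta>)"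
      if "0 < s" "0 < \<zeta>" "\<zeta> \<le> real k" "\<zeta> \<le> \<beta>" "\<beta> - \<zeta> < real n'" for s \<zeta>
    proof -
      have "norm (W n' f x s t) \<le> wdiff_const (\<lambda>m \<theta>. K m \<theta> * (A + B)) n' k \<beta> \<zeta> * t powr (\<beta> - real n' - \<zeta>) * s powr \<zeta>"
        unfolding W_def by (rule dd.norm_wdiff_le) (use that t c[OF that(1)] in auto)
      then show ?thesis unfolding wdiff_const_cmult by (simp add: mult_ac)
    qed
    \<comment> \<open>Splitting at s = t balances the two bounds: after integration both scale as
      t^(beta - n' - lam).\<close>
    define e1 where "e1 = t powr (\<beta> - real n' - \<zeta>\<^sub>1) * wdiff_const K n' k \<beta> \<zeta>\<^sub>1"
    define e2 where "e2 = t powr (\<beta> - real n' - \<zeta>\<^sub>2) * wdiff_const K n' k \<beta> \<zeta>\<^sub>2"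
    let ?g = "\<lambda>s. s powr (- lam - 1) * (if s < t then e1 * s powr \<zeta>\<^sub>1 else e2 * s powr \<zeta>\<^sub>2)"
    note g = integral_split_powers[OF t \<zeta>\<^sub>2(2) \<zeta>\<^sub>1(1), of e1 e2]
    have wg: "norm (?w n' s t) \<le> (A + B) * ?g s" if "s \<in> space half_line" for s
    proof -
      have "norm (W n' f x s t) \<le> (A + B) * (if s < t then e1 * s powr \<zeta>\<^sub>1 else e2 * s powr \<zeta>\<^sub>2)"
        using sc[of s \<zeta>\<^sub>1] sc[of s \<zeta>\<^sub>2] that \<zeta>\<^sub>1 \<zeta>\<^sub>2 lam n' by (simp add: e1_def e2_def mult_ac)
      then have "s powr (- lam - 1) * norm (W n' f x s t) \<le>
          s powr (- lam - 1) * ((A + B) * (if s < t then e1 * s powr \<zeta>\<^sub>1 else e2 * s powr \<zeta>\<^sub>2))"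
        by (intro mult_left_mono) auto
      then show ?thesis by (simp add: mult_ac)
    qed
    have ex: "\<beta> - lam - real n' = \<beta> - real n' - lam" by simp
    have "norm (D n' t (S f) x) \<le> (\<integral>s. norm (?w n' s t) \<partial>half_line)"
      unfolding Dm[OF t] by (rule integral_norm_bound)
    also have "\<dots> \<le> (\<integral>s. (A + B) * ?g s \<partial>half_line)"
      using wi[OF t] wg g(1) by (intro integral_mono integrable_norm) auto
    also have "\<dots> = (A + B) * (e1 * t powr (\<zeta>\<^sub>1 - lam) / (\<zeta>\<^sub>1 - lam) + e2 * t powr (\<zeta>\<^sub>2 - lam) / (lam - \<zeta>\<^sub>2))"
      using g(2) by simp
    also have "e1 * t powr (\<zeta>\<^sub>1 - lam) = wdiff_const K n' k \<beta> \<zeta>\<^sub>1 * t powr (\<beta> - lam - real n')"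
      by (simp add: e1_def mult_ac powr_add[symmetric] ex)
    also have "e2 * t powr (\<zeta>\<^sub>2 - lam) = wdiff_const K n' k \<beta> \<zeta>\<^sub>2 * t powr (\<beta> - lam - real n')"
      by (simp add: e2_def mult_ac powr_add[symmetric] ex)
    also have "(A + B) * (wdiff_const K n' k \<beta> \<zeta>\<^sub>1 * t powr (\<beta> - lam - real n') / (\<zeta>\<^sub>1 - lam) +
        wdiff_const K n' k \<beta> \<zeta>\<^sub>2 * t powr (\<beta> - lam - real n') / (lam - \<zeta>\<^sub>2)) = C1 * (A + B) * t powr (\<beta> - lam - real n')"
      by (simp add: C1_def algebra_simps)
    also have "\<dots> \<le> (I 0 + C1) * (A + B) * t powr (\<beta> - lam - real n')"
      using I0 e B by (intro mult_right_mono) auto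
    finally show "norm (D n' t (S f) x) \<le> (I 0 + C1) * (A + B) * t powr (\<beta> - lam - real n')" .
  qed
qed

end

section \<open>The Laguerre semigroup\<close>

lemma pos_orthant_borel [measurable]: "(pos_orthant :: (real ^ 'd) set) \<in> sets borel"
proof -
  have "pos_orthant = (\<Inter>i. {x :: real ^ 'd. 0 < x $ i})" by (auto simp: pos_orthant_def)
  moreover have "open {x :: real ^ 'd. 0 < x $ i}" for i
    by (intro open_Collect_less continuous_intros)
  then have "open (\<Inter>i\<in>UNIV. {x :: real ^ 'd. 0 < x $ i})" by (intro open_INT) auto
  ultimately have "open (pos_orthant :: (real ^ 'd) set)" by (simp only:)
  then show ?thesis by simp
qed

lemma space_orthant_measure [simp]: "space orthant_measure = pos_orthant"
  by (simp add: orthant_measure_def space_restrict_space)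

lemma sets_laguerre_measure [measurable_cong, simp]: "sets (laguerre_measure \<alpha>) = sets orthant_measure"
  by (simp add: laguerre_measure_def)

lemma space_laguerre_measure [simp]: "space (laguerre_measure \<alpha>) = pos_orthant"
  by (simp add: laguerre_measure_def)

lemma measurable_laguerre_measure: "borel_measurable (laguerre_measure \<alpha>) = borel_measurable orthant_measure"
  by (rule measurable_cong_sets) simp_all

lemma orthant_restrict: "f \<in> borel_measurable borel \<Longrightarrow> f \<in> borel_measurable orthant_measure"
  unfolding orthant_measure_def by (intro measurable_restrict_space1) simp

lemma component_measurable [measurable (raw)]:
  assumes "f \<in> N \<rightarrow>\<^sub>M orthant_measure"
  shows "(\<lambda>x. f x $ i) \<in> borel_measurable N"
  by (rule measurable_compose[OF assms orthant_restrict])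
    (intro borel_measurable_continuous_onI continuous_intros)

lemma orthant_measure_component: "(\<lambda>y. y $ i) \<in> borel_measurable orthant_measure"
  by (rule component_measurable) simp

lemma bessel_I_measurable [measurable]: "bessel_I a \<in> borel_measurable borel"
  unfolding bessel_I_def[abs_def] by measurable

lemma laguerre_factor_measurable [measurable (raw)]:
  assumes [measurable]: "f \<in> borel_measurable N" "g \<in> borel_measurable N" "h \<in> borel_measurable N"
  shows "(\<lambda>z. laguerre_factor a (f z) (g z) (h z)) \<in> borel_measurable N"
  unfolding laguerre_factor_def by measurable

lemma laguerre_kernel_eq: "laguerre_kernel \<alpha> t x y = (\<Prod>j\<in>UNIV. laguerre_factor (\<alpha> $ j) t (x $ j) (y $ j))"
  by (simp add: laguerre_kernel_def laguerre_factor_def)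

lemma laguerre_weight_nonneg: "- 1 < a \<Longrightarrow> 0 \<le> laguerre_weight a y"
  using Gamma_real_pos[of "a + 1"] by (simp add: laguerre_weight_def)

text \<open>The indicator of the orthant is distributed over the coordinates, so the integrand
  becomes a product on all of R^d and the product formula for \<open>lborel\<close> applies;
  \<open>axis_index\<close> translates basis vectors into coordinates.\<close>

lemma nn_integral_laguerre_measure_prod:
  fixes \<alpha> :: "real ^ 'd" and h :: "'d \<Rightarrow> real \<Rightarrow> ennreal"
  assumes \<alpha>: "\<And>i. - 1 < \<alpha> $ i" and h[measurable]: "\<And>j. h j \<in> borel_measurable borel"
  shows "(\<integral>\<^sup>+y. (\<Prod>j\<in>UNIV. h j (y $ j)) \<partial>laguerre_measure \<alpha>) = (\<Prod>j\<in>UNIV. lag_int (\<alpha> $ j) (h j))"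
proof -
  note [measurable] = orthant_measure_component
  let ?w = "\<lambda>y. \<Prod>i\<in>UNIV. laguerre_weight (\<alpha> $ i) (y $ i)"
  define g where "g = (\<lambda>j u. ennreal (indicator {0<..} u * laguerre_weight (\<alpha> $ j) u) * h j u)"
  have [measurable]: "g j \<in> borel_measurable borel" for j unfolding g_def by measurable
  have dens: "laguerre_measure \<alpha> = density orthant_measure (\<lambda>y. ennreal (?w y))"
    by (simp add: laguerre_measure_def laguerre_weight_def)
  have "(\<integral>\<^sup>+y. (\<Prod>j\<in>UNIV. h j (y $ j)) \<partial>laguerre_measure \<alpha>) =
    (\<integral>\<^sup>+y. ennreal (?w y) * (\<Prod>j\<in>UNIV. h j (y $ j)) \<partial>orthant_measure)"
    unfolding dens by (rule nn_integral_density) measurable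
  also have "\<dots> = (\<integral>\<^sup>+y. ennreal (?w y) * (\<Prod>j\<in>UNIV. h j (y $ j)) * indicator pos_orthant y \<partial>lborel)"
    unfolding orthant_measure_def by (rule nn_integral_restrict_space) simp
  also have "\<dots> = (\<integral>\<^sup>+y. (\<Prod>j\<in>UNIV. g j (y $ j)) \<partial>lborel)"
  proof (rule nn_integral_cong)
    fix y :: "real ^ 'd"
    show "ennreal (?w y) * (\<Prod>j\<in>UNIV. h j (y $ j)) * indicator pos_orthant y = (\<Prod>j\<in>UNIV. g j (y $ j))"
    proof (cases "y \<in> pos_orthant")
      case True
      then have "g j (y $ j) = ennreal (laguerre_weight (\<alpha> $ j) (y $ j)) * h j (y $ j)" for j
        by (simp add: g_def pos_orthant_def)
      then show ?thesis
        using True laguerre_weight_nonneg[OF \<alpha>] by (simp add: prod.distrib prod_ennreal)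
    next
      case False
      then obtain j where "\<not> 0 < y $ j" by (auto simp: pos_orthant_def)
      then have "g j (y $ j) = 0" by (simp add: g_def)
      then have "(\<Prod>j\<in>UNIV. g j (y $ j)) = 0" by (intro prod_zero) auto
      then show ?thesis using False by simp
    qed
  qed
  also have "\<dots> = (\<integral>\<^sup>+y. (\<Prod>b\<in>Basis. g (axis_index b) ((y :: real ^ 'd) \<bullet> b)) \<partial>lborel)"
  proof (rule nn_integral_cong)
    fix y :: "real ^ 'd"
    have B: "(Basis :: (real ^ 'd) set) = range (\<lambda>i. axis i 1)" by (auto simp: Basis_vec_def)
    have "inj (\<lambda>i::'d. axis i 1 :: real ^ 'd)" by (auto simp: inj_def axis_eq_axis)
    then show "(\<Prod>j\<in>UNIV. g j (y $ j)) = (\<Prod>b\<in>Basis. g (axis_index b) (y \<bullet> b))"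
      unfolding B by (subst prod.reindex) (auto simp: inner_axis)
  qed
  also have "\<dots> = (\<Prod>b\<in>(Basis :: (real ^ 'd) set). \<integral>\<^sup>+u. g (axis_index b) u \<partial>lborel)"
    by (rule nn_integral_lborel_prod) auto
  also have "\<dots> = (\<Prod>j\<in>UNIV. \<integral>\<^sup>+u. g j u \<partial>lborel)"
  proof -
    have B: "(Basis :: (real ^ 'd) set) = range (\<lambda>i. axis i 1)" by (auto simp: Basis_vec_def)
    have "inj (\<lambda>i::'d. axis i 1 :: real ^ 'd)" by (auto simp: inj_def axis_eq_axis)
    then show ?thesis unfolding B by (subst prod.reindex) auto
  qed
  finally show ?thesis unfolding g_def .
qed

lemma prob_space_laguerre_measure:
  assumes \<alpha>: "\<And>i. - 1 < \<alpha> $ i"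
  shows "prob_space (laguerre_measure \<alpha>)"
proof (rule prob_spaceI)
  show "emeasure (laguerre_measure \<alpha>) (space (laguerre_measure \<alpha>)) = 1"
    using nn_integral_laguerre_measure_prod[OF \<alpha>, of "\<lambda>_ _. 1"] lag_int_one[OF \<alpha>] by simp
qed

text \<open>The density is positive on the orthant, so the null sets coincide. Essential suprema are
  taken for Lebesgue measure, the semigroup estimates for the Laguerre measure.\<close>

lemma AE_laguerre_measure_iff:
  assumes \<alpha>: "\<And>i. - 1 < \<alpha> $ i"
  shows "(AE x in laguerre_measure \<alpha>. Q x) \<longleftrightarrow> (AE x in orthant_measure. Q x)"
proof -
  note [measurable] = orthant_measure_component
  have pos: "0 < (\<Prod>i\<in>UNIV. x $ i powr \<alpha> $ i * exp (- (x $ i)) / Gamma (\<alpha> $ i + 1))" if "x \<in> pos_orthant" for x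
  proof (intro prod_pos divide_pos_pos Gamma_real_pos mult_pos_pos)
    fix i
    show "0 < x $ i powr \<alpha> $ i" using that by (auto simp: pos_orthant_def less_le)
    show "0 < \<alpha> $ i + 1" using \<alpha>[of i] by linarith
  qed simp
  have "(AE x in laguerre_measure \<alpha>. Q x) \<longleftrightarrow>
    (AE x in orthant_measure. 0 < ennreal (\<Prod>i\<in>UNIV. x $ i powr \<alpha> $ i * exp (- (x $ i)) / Gamma (\<alpha> $ i + 1)) \<longrightarrow> Q x)"
    unfolding laguerre_measure_def by (rule AE_density) measurable
  also have "\<dots> \<longleftrightarrow> (AE x in orthant_measure. Q x)"
    by (rule AE_cong) (use pos in auto)
  finally show ?thesis .
qed

lemma laguerre_kernel_measurable:
  "(\<lambda>(t, x, y). laguerre_kernel \<alpha> t x y) \<in> borel_measurable (borel \<Otimes>\<^sub>M laguerre_measure \<alpha> \<Otimes>\<^sub>M laguerre_measure \<alpha>)"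
proof -
  note [measurable] = orthant_measure_component
  show ?thesis unfolding laguerre_kernel_eq split_beta' by measurable
qed

lemma laguerre_kernel_nonneg:
  assumes "\<And>i. - 1 < \<alpha> $ i" "0 < t" "x \<in> pos_orthant" "y \<in> pos_orthant"
  shows "0 \<le> laguerre_kernel \<alpha> t x y"
  unfolding laguerre_kernel_eq using assms by (intro prod_nonneg laguerre_factor_nonneg ballI) (auto simp: pos_orthant_def)

lemma laguerre_kernel_sym: "laguerre_kernel \<alpha> t x y = laguerre_kernel \<alpha> t y x"
  unfolding laguerre_kernel_eq by (subst laguerre_factor_sym) simp

section \<open>Laplace transform and concentration of the Laguerre kernel\<close>

definition lag_laplace :: "real \<Rightarrow> real \<Rightarrow> real \<Rightarrow> real \<Rightarrow> real" where
  "lag_laplace a x c t = (lag_rate t / (lag_rate t + c)) powr (a + 1) * exp (- (lag_rate t - 1) * x * c / (lag_rate t + c))"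

text \<open>As t tends to 0, \<open>lag_rate\<close> tends to infinity and only rational limits in R
  remain. The limit is the Laplace transform of a point mass at x.\<close>

lemma tendsto_lag_laplace: "((\<lambda>t. lag_laplace a x c t) \<longlongrightarrow> exp (- c * x)) (at_right 0)"
proof -
  have R: "filterlim lag_rate at_top (at_right 0)" unfolding lag_rate_def by real_asymp
  have "((\<lambda>R. R / (R + c)) \<longlongrightarrow> 1) at_top" by real_asymp
  then have 1: "((\<lambda>R. (R / (R + c)) powr (a + 1)) \<longlongrightarrow> 1 powr (a + 1)) at_top"
    by (intro tendsto_intros) auto
  have "((\<lambda>R. - (R - 1) * x * c / (R + c)) \<longlongrightarrow> - c * x) at_top"
  proof -
    have "((\<lambda>R. (R - 1) / (R + c)) \<longlongrightarrow> 1) at_top" by real_asymp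
    then have "((\<lambda>R. (- x * c) * ((R - 1) / (R + c))) \<longlongrightarrow> (- x * c) * 1) at_top" by (intro tendsto_intros)
    then show ?thesis by (simp add: algebra_simps)
  qed
  then have "((\<lambda>R. (R / (R + c)) powr (a + 1) * exp (- (R - 1) * x * c / (R + c))) \<longlongrightarrow> 1 powr (a + 1) * exp (- c * x)) at_top"
    by (intro tendsto_intros 1)
  from filterlim_compose[OF this R] show ?thesis by (simp add: lag_laplace_def)
qed

text \<open>In the product every coordinate other than j has exponent 0 and contributes mass
  1.\<close>

lemma laguerre_kernel_laplace:
  fixes \<alpha> :: "real ^ 'd"
  assumes \<alpha>: "\<And>i. - 1 < \<alpha> $ i" and t: "0 < t" and x: "x \<in> pos_orthant" and c: "0 \<le> c"
  shows "(\<integral>\<^sup>+y. ennreal (laguerre_kernel \<alpha> t x y) * ennreal (exp (- c * y $ j)) \<partial>laguerre_measure \<alpha>) =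
    ennreal (lag_laplace (\<alpha> $ j) (x $ j) c t)"
proof -
  let ?c = "\<lambda>i. if i = j then c else 0"
  have xi: "0 < x $ i" for i using x by (simp add: pos_orthant_def)
  have "(\<integral>\<^sup>+y. ennreal (laguerre_kernel \<alpha> t x y) * ennreal (exp (- c * y $ j)) \<partial>laguerre_measure \<alpha>) =
    (\<integral>\<^sup>+y. (\<Prod>i\<in>UNIV. ennreal (laguerre_factor (\<alpha> $ i) t (x $ i) (y $ i)) * ennreal (exp (- ?c i * y $ i))) \<partial>laguerre_measure \<alpha>)"
  proof (rule nn_integral_cong)
    fix y assume "y \<in> space (laguerre_measure \<alpha>)"
    then have y: "0 < y $ i" for i by (simp add: pos_orthant_def)
    have "(\<Prod>i\<in>UNIV. ennreal (exp (- ?c i * y $ i))) = ennreal (exp (- c * y $ j))"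
    proof -
      have "ennreal (exp (- ?c i * y $ i)) = (if i = j then ennreal (exp (- c * y $ j)) else 1)" for i by simp
      then show ?thesis by (simp only: prod.delta[OF finite]) simp
    qed
    then show "ennreal (laguerre_kernel \<alpha> t x y) * ennreal (exp (- c * y $ j)) =
      (\<Prod>i\<in>UNIV. ennreal (laguerre_factor (\<alpha> $ i) t (x $ i) (y $ i)) * ennreal (exp (- ?c i * y $ i)))"
      unfolding laguerre_kernel_eq prod.distrib
      using laguerre_factor_nonneg[OF \<alpha> t xi y] by (simp add: prod_ennreal)
  qed
  also have "\<dots> = (\<Prod>i\<in>UNIV. lag_int (\<alpha> $ i) (\<lambda>y. ennreal (laguerre_factor (\<alpha> $ i) t (x $ i) y) * ennreal (exp (- ?c i * y))))"
    by (rule nn_integral_laguerre_measure_prod[OF \<alpha>]) measurable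
  also have "\<dots> = (\<Prod>i\<in>UNIV. ennreal (lag_laplace (\<alpha> $ i) (x $ i) (?c i) t))"
    using laguerre_factor_laplace[OF \<alpha> t xi, of "?c _"] c by (intro prod.cong) (auto simp: lag_laplace_def)
  also have "\<dots> = (\<Prod>i\<in>UNIV. if i = j then ennreal (lag_laplace (\<alpha> $ i) (x $ i) c t) else 1)"
    using lag_rate[OF t] by (intro prod.cong) (auto simp: lag_laplace_def)
  also have "\<dots> = ennreal (lag_laplace (\<alpha> $ j) (x $ j) c t)" by simp
  finally show ?thesis .
qed

lemma laguerre_kernel_mass:
  assumes \<alpha>: "\<And>i. - 1 < \<alpha> $ i" and t: "0 < t" and x: "x \<in> pos_orthant"
  shows "(\<integral>\<^sup>+y. ennreal (laguerre_kernel \<alpha> t x y) \<partial>laguerre_measure \<alpha>) = 1"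
  using laguerre_kernel_laplace[OF \<alpha> t x, of 0 undefined] lag_rate[OF t] by (simp add: lag_laplace_def)

lemma laguerre_kernel_semigroup:
  fixes \<alpha> :: "real ^ 'd"
  assumes \<alpha>: "\<And>i. - 1 < \<alpha> $ i" and t: "0 < t" and s: "0 < s" and x: "x \<in> pos_orthant" and z: "z \<in> pos_orthant"
  shows "(\<integral>\<^sup>+y. ennreal (laguerre_kernel \<alpha> t x y) * ennreal (laguerre_kernel \<alpha> s y z) \<partial>laguerre_measure \<alpha>) =
    ennreal (laguerre_kernel \<alpha> (t + s) x z)"
proof -
  have xi: "0 < x $ i" "0 < z $ i" for i using x z by (simp_all add: pos_orthant_def)
  have "(\<integral>\<^sup>+y. ennreal (laguerre_kernel \<alpha> t x y) * ennreal (laguerre_kernel \<alpha> s y z) \<partial>laguerre_measure \<alpha>) =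
    (\<integral>\<^sup>+y. (\<Prod>i\<in>UNIV. ennreal (laguerre_factor (\<alpha> $ i) t (x $ i) (y $ i)) * ennreal (laguerre_factor (\<alpha> $ i) s (y $ i) (z $ i))) \<partial>laguerre_measure \<alpha>)"
  proof (rule nn_integral_cong)
    fix y assume "y \<in> space (laguerre_measure \<alpha>)"
    then have y: "0 < y $ i" for i by (simp add: pos_orthant_def)
    show "ennreal (laguerre_kernel \<alpha> t x y) * ennreal (laguerre_kernel \<alpha> s y z) =
      (\<Prod>i\<in>UNIV. ennreal (laguerre_factor (\<alpha> $ i) t (x $ i) (y $ i)) * ennreal (laguerre_factor (\<alpha> $ i) s (y $ i) (z $ i)))"
      unfolding laguerre_kernel_eq prod.distrib
      using laguerre_factor_nonneg[OF \<alpha> t xi(1) y] laguerre_factor_nonneg[OF \<alpha> s y xi(2)] by (simp add: prod_ennreal)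
  qed
  also have "\<dots> = (\<Prod>i\<in>UNIV. lag_int (\<alpha> $ i) (\<lambda>y. ennreal (laguerre_factor (\<alpha> $ i) t (x $ i) y) * ennreal (laguerre_factor (\<alpha> $ i) s y (z $ i))))"
    by (rule nn_integral_laguerre_measure_prod[OF \<alpha>]) measurable
  also have "\<dots> = (\<Prod>i\<in>UNIV. ennreal (laguerre_factor (\<alpha> $ i) (t + s) (x $ i) (z $ i)))"
    using laguerre_factor_semigroup[OF \<alpha> t s xi] by simp
  also have "\<dots> = ennreal (laguerre_kernel \<alpha> (t + s) x z)"
    unfolding laguerre_kernel_eq
    by (rule prod_ennreal) (use t s in \<open>auto intro!: laguerre_factor_nonneg[OF \<alpha> _ xi]\<close>)
  finally show ?thesis .
qed

text \<open>Distances are measured in the coordinates \<open>exp (- y\<^sub>j)\<close>, whose first two moments under the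
  Laguerre kernel are values of its Laplace transform.\<close>

lemma exp_coordinates_close:
  fixes x :: "real ^ 'd" and \<phi> :: "real ^ 'd \<Rightarrow> complex"
  assumes \<phi>: "continuous_on UNIV \<phi>" and e: "0 < e"
  shows "\<exists>d>0. \<forall>y. (\<Sum>j\<in>UNIV. (exp (- y $ j) - exp (- x $ j))\<^sup>2) < d \<longrightarrow> norm (\<phi> y - \<phi> x) < e"
proof -
  define E where "E = (\<lambda>y :: real ^ 'd. \<chi> j. exp (- y $ j))"
  define L where "L = (\<lambda>u :: real ^ 'd. \<chi> j. - ln (u $ j))"
  have LE: "L (E y) = y" for y by (simp add: L_def E_def vec_eq_iff)
  have "isCont L (E x)"
    unfolding isCont_def
  proof (rule vec_tendstoI)
    fix j
    have "((\<lambda>u. - ln (u $ j)) \<longlongrightarrow> - ln (E x $ j)) (at (E x))"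
      by (intro tendsto_intros) (auto simp: E_def)
    then show "((\<lambda>u. L u $ j) \<longlongrightarrow> L (E x) $ j) (at (E x))" by (simp add: L_def)
  qed
  moreover have "isCont \<phi> (L (E x))"
    using \<phi> by (simp add: continuous_on_eq_continuous_at)
  ultimately have "isCont (\<lambda>u. \<phi> (L u)) (E x)" by (rule isCont_o2)
  then obtain d where d: "0 < d" "\<And>u. dist u (E x) < d \<Longrightarrow> dist (\<phi> (L u)) (\<phi> (L (E x))) < e"
    using e unfolding continuous_at_eps_delta by metis
  show ?thesis
  proof (intro exI[of _ "d\<^sup>2"] conjI allI impI)
    fix y assume y: "(\<Sum>j\<in>UNIV. (exp (- y $ j) - exp (- x $ j))\<^sup>2) < d\<^sup>2"
    have "(norm (E y - E x))\<^sup>2 = (\<Sum>j\<in>UNIV. (exp (- y $ j) - exp (- x $ j))\<^sup>2)"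
      by (simp add: norm_vec_def L2_set_def real_sqrt_pow2 sum_nonneg E_def)
    with y have "norm (E y - E x) < d" using d(1) power2_less_imp_less[of "norm (E y - E x)" d] by simp
    then show "norm (\<phi> y - \<phi> x) < e" using d(2)[of "E y"] by (simp add: dist_norm LE)
  qed (use d in simp)
qed

text \<open>A Chebyshev argument: away from x the difference of values is at most 2 B, hence at most
  a multiple of the squared distance in exponential coordinates, whose mean under the kernel tends
  to 0.\<close>

lemma laguerre_kernel_concentrates:
  fixes \<alpha> :: "real ^ 'd" and \<phi> :: "real ^ 'd \<Rightarrow> complex"
  assumes \<alpha>: "\<And>i. - 1 < \<alpha> $ i" and x: "x \<in> pos_orthant"
    and \<phi>: "continuous_on UNIV \<phi>" and \<phi>B: "\<And>y. norm (\<phi> y) \<le> B"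
  shows "((\<lambda>s. \<integral>y. laguerre_kernel \<alpha> s x y *\<^sub>R \<phi> y \<partial>laguerre_measure \<alpha>) \<longlongrightarrow> \<phi> x) (at_right 0)"
proof -
  let ?M = "laguerre_measure \<alpha>" and ?G = "laguerre_kernel \<alpha>"
  interpret prob_space ?M by (rule prob_space_laguerre_measure[OF \<alpha>])
  note [measurable] = orthant_measure_component
  have xM: "x \<in> space orthant_measure" using x by simp
  have Gm[measurable]: "(\<lambda>y. ?G s x y) \<in> borel_measurable ?M" for s
    unfolding laguerre_kernel_eq by measurable
  have \<phi>m[measurable]: "\<phi> \<in> borel_measurable ?M"
    unfolding measurable_laguerre_measure using \<phi> by (intro orthant_restrict borel_measurable_continuous_onI)
  have B: "0 \<le> B" using \<phi>B norm_ge_zero order_trans by blast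
  have G0: "0 \<le> ?G s x y" if "0 < s" "y \<in> space ?M" for s y
    using laguerre_kernel_nonneg[OF \<alpha> that(1) x] that(2) by simp
  have lap: "integrable ?M (\<lambda>y. ?G s x y * exp (- c * y $ j))"
    "(\<integral>y. ?G s x y * exp (- c * y $ j) \<partial>?M) = lag_laplace (\<alpha> $ j) (x $ j) c s" if s: "0 < s" and c: "0 \<le> c" for s c j
  proof -
    have nn: "(\<integral>\<^sup>+y. ennreal (?G s x y * exp (- c * y $ j)) \<partial>?M) = ennreal (lag_laplace (\<alpha> $ j) (x $ j) c s)"
      unfolding laguerre_kernel_laplace[OF \<alpha> s x c, symmetric]
      using G0[OF s] by (intro nn_integral_cong) (simp add: ennreal_mult)
    show "integrable ?M (\<lambda>y. ?G s x y * exp (- c * y $ j))"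
      using G0[OF s] nn by (intro integrableI_nonneg) auto
    show "(\<integral>y. ?G s x y * exp (- c * y $ j) \<partial>?M) = lag_laplace (\<alpha> $ j) (x $ j) c s"
      using G0[OF s] nn by (subst integral_eq_nn_integral) (auto simp: lag_laplace_def)
  qed
  have one: "integrable ?M (?G s x)" "(\<integral>y. ?G s x y \<partial>?M) = 1" if "0 < s" for s
    using lap[OF that, of 0 undefined] lag_rate[OF that] by (simp_all add: lag_laplace_def)
  \<comment> \<open>The second moment of exp (- y_j) about exp (- x_j), expanded into Laplace
    transforms at 2, 1 and 0.\<close>
  define V where "V = (\<lambda>j s. lag_laplace (\<alpha> $ j) (x $ j) 2 s - 2 * exp (- x $ j) * lag_laplace (\<alpha> $ j) (x $ j) 1 s + exp (- 2 * x $ j))"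
  have V: "integrable ?M (\<lambda>y. ?G s x y * (exp (- y $ j) - exp (- x $ j))\<^sup>2)"
    "(\<integral>y. ?G s x y * (exp (- y $ j) - exp (- x $ j))\<^sup>2 \<partial>?M) = V j s" if s: "0 < s" for s j
  proof -
    have sq: "?G s x y * (exp (- y $ j) - exp (- x $ j))\<^sup>2 =
      ?G s x y * exp (- 2 * y $ j) - 2 * exp (- x $ j) * (?G s x y * exp (- 1 * y $ j)) + exp (- 2 * x $ j) * ?G s x y" for y
    proof -
      have "exp (- 2 * u) = (exp (- u))\<^sup>2" for u :: real by (simp add: power2_eq_square exp_add[symmetric])
      then show ?thesis by (simp add: power2_eq_square algebra_simps)
    qed
    show "integrable ?M (\<lambda>y. ?G s x y * (exp (- y $ j) - exp (- x $ j))\<^sup>2)"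
      unfolding sq using lap(1)[OF s, of 2 j] lap(1)[OF s, of 1 j] one(1)[OF s]
      by (intro Bochner_Integration.integrable_add Bochner_Integration.integrable_diff integrable_mult_right) auto
    show "(\<integral>y. ?G s x y * (exp (- y $ j) - exp (- x $ j))\<^sup>2 \<partial>?M) = V j s"
      unfolding sq V_def using lap[OF s, of 2 j] lap[OF s, of 1 j] one[OF s] by simp
  qed
  have "((\<lambda>s. \<Sum>j\<in>UNIV. V j s) \<longlongrightarrow> (\<Sum>j\<in>UNIV. exp (- 2 * x $ j) - 2 * exp (- x $ j) * exp (- 1 * x $ j) + exp (- 2 * x $ j))) (at_right 0)"
    unfolding V_def by (intro tendsto_intros tendsto_lag_laplace)
  moreover have "exp (- 2 * u) - 2 * exp (- u) * exp (- 1 * u) + exp (- 2 * u) = 0" for u :: real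
    by (simp add: exp_add[symmetric])
  ultimately have Vlim: "((\<lambda>s. \<Sum>j\<in>UNIV. V j s) \<longlongrightarrow> 0) (at_right 0)" by simp
  show ?thesis
  proof (rule tendstoI)
    fix e :: real assume e: "0 < e"
    obtain d where d: "0 < d" "\<And>y. (\<Sum>j\<in>UNIV. (exp (- y $ j) - exp (- x $ j))\<^sup>2) < d \<Longrightarrow> norm (\<phi> y - \<phi> x) < e / 2"
      using exp_coordinates_close[OF \<phi>, of "e / 2" x] e by auto
    \<comment> \<open>Chosen so that D times the threshold d equals the trivial bound 2 B.\<close>
    define D where "D = 2 * B / d"
    have D: "0 \<le> D" using B d by (simp add: D_def)
    have close: "norm (\<phi> y - \<phi> x) \<le> e / 2 + D * (\<Sum>j\<in>UNIV. (exp (- y $ j) - exp (- x $ j))\<^sup>2)" (is "_ \<le> _ + D * ?S y") for y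
    proof (cases "?S y < d")
      case True
      have "0 \<le> D * ?S y" using D by (intro mult_nonneg_nonneg sum_nonneg) auto
      then show ?thesis using d(2)[OF True] by simp
    next
      case False
      have "norm (\<phi> y - \<phi> x) \<le> 2 * B"
        using norm_triangle_ineq4[of "\<phi> y" "\<phi> x"] \<phi>B[of y] \<phi>B[of x] by simp
      also have "2 * B = D * d" using d by (simp add: D_def)
      also have "D * d \<le> D * ?S y" using D False by (intro mult_left_mono) auto
      finally show ?thesis using e by simp
    qed
    have est: "norm ((\<integral>y. ?G s x y *\<^sub>R \<phi> y \<partial>?M) - \<phi> x) \<le> e / 2 + D * (\<Sum>j\<in>UNIV. V j s)" if s: "0 < s" for s
    proof -
      have i1: "integrable ?M (\<lambda>y. ?G s x y *\<^sub>R \<phi> y)"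
      proof (rule Bochner_Integration.integrable_bound)
        show "integrable ?M (\<lambda>y. ?G s x y * B)" using one(1)[OF s] by simp
        show "AE y in ?M. norm (?G s x y *\<^sub>R \<phi> y) \<le> norm (?G s x y * B)"
          using \<phi>B B by (auto simp: abs_mult intro!: mult_left_mono)
      qed measurable
      have i2: "integrable ?M (\<lambda>y. ?G s x y *\<^sub>R \<phi> x)" "(\<integral>y. ?G s x y *\<^sub>R \<phi> x \<partial>?M) = \<phi> x"
        using one[OF s] by simp_all
      have i3: "integrable ?M (\<lambda>y. \<Sum>j\<in>UNIV. ?G s x y * (exp (- y $ j) - exp (- x $ j))\<^sup>2)"
        using V(1)[OF s] by (intro Bochner_Integration.integrable_sum)
      have "(\<integral>y. ?G s x y *\<^sub>R \<phi> y \<partial>?M) - \<phi> x = (\<integral>y. ?G s x y *\<^sub>R (\<phi> y - \<phi> x) \<partial>?M)"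
        unfolding scaleR_diff_right using i1 i2 by simp
      also have "norm \<dots> \<le> (\<integral>y. norm (?G s x y *\<^sub>R (\<phi> y - \<phi> x)) \<partial>?M)"
        by (rule integral_norm_bound)
      also have "\<dots> \<le> (\<integral>y. e / 2 * ?G s x y + D * (\<Sum>j\<in>UNIV. ?G s x y * (exp (- y $ j) - exp (- x $ j))\<^sup>2) \<partial>?M)"
      proof (rule integral_mono)
        show "integrable ?M (\<lambda>y. norm (?G s x y *\<^sub>R (\<phi> y - \<phi> x)))"
          unfolding scaleR_diff_right by (intro integrable_norm Bochner_Integration.integrable_diff i1 i2)
        show "integrable ?M (\<lambda>y. e / 2 * ?G s x y + D * (\<Sum>j\<in>UNIV. ?G s x y * (exp (- y $ j) - exp (- x $ j))\<^sup>2))"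
          using one(1)[OF s] i3 by (intro Bochner_Integration.integrable_add integrable_mult_right)
        fix y assume "y \<in> space ?M"
        then have g: "0 \<le> ?G s x y" by (rule G0[OF s])
        have "norm (?G s x y *\<^sub>R (\<phi> y - \<phi> x)) = ?G s x y * norm (\<phi> y - \<phi> x)" using g by simp
        also have "\<dots> \<le> ?G s x y * (e / 2 + D * (\<Sum>j\<in>UNIV. (exp (- y $ j) - exp (- x $ j))\<^sup>2))"
          using close[of y] g by (rule mult_left_mono)
        also have "\<dots> = e / 2 * ?G s x y + D * (\<Sum>j\<in>UNIV. ?G s x y * (exp (- y $ j) - exp (- x $ j))\<^sup>2)"
          by (simp add: algebra_simps sum_distrib_left[symmetric])
        finally show "norm (?G s x y *\<^sub>R (\<phi> y - \<phi> x)) \<le> e / 2 * ?G s x y + D * (\<Sum>j\<in>UNIV. ?G s x y * (exp (- y $ j) - exp (- x $ j))\<^sup>2)" .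
      qed
      also have "\<dots> = e / 2 + D * (\<Sum>j\<in>UNIV. V j s)"
        using one[OF s] i3 V[OF s] by simp
      finally show ?thesis .
    qed
    have "((\<lambda>s. D * (\<Sum>j\<in>UNIV. V j s)) \<longlongrightarrow> D * 0) (at_right 0)" by (intro tendsto_intros Vlim)
    then have "\<forall>\<^sub>F s in at_right 0. D * (\<Sum>j\<in>UNIV. V j s) < e / 2" using e by (intro order_tendstoD) auto
    moreover have "\<forall>\<^sub>F s in at_right 0. 0 < (s::real)" by (simp add: eventually_at_right_less)
    ultimately show "\<forall>\<^sub>F s in at_right 0. dist (\<integral>y. ?G s x y *\<^sub>R \<phi> y \<partial>?M) (\<phi> x) < e"
    proof eventually_elim
      case (elim s)
      then show ?case using est[OF elim(2)] by (simp add: dist_norm)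
    qed
  qed
qed

text \<open>The algebraic laws are inherited from the one-dimensional factors. Continuity in mean
  combines continuous approximants with concentration at every point.\<close>

lemma laguerre_density_semigroup:
  fixes \<alpha> :: "real ^ 'd"
  assumes \<alpha>: "\<And>i. - 1 < \<alpha> $ i"
  shows "density_semigroup (laguerre_measure \<alpha>) (laguerre_kernel \<alpha>)"
proof -
  let ?M = "laguerre_measure \<alpha>"
  interpret prob_space ?M by (rule prob_space_laguerre_measure[OF \<alpha>])
  show ?thesis
  proof unfold_locales
    show "(\<lambda>(t, x, y). laguerre_kernel \<alpha> t x y) \<in> borel_measurable (borel \<Otimes>\<^sub>M ?M \<Otimes>\<^sub>M ?M)"
      by (rule laguerre_kernel_measurable)
  next
    fix B and f :: "real ^ 'd \<Rightarrow> complex"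
    assume f: "f \<in> borel_measurable ?M" and fB: "AE x in ?M. norm (f x) \<le> B"
    have "AE x in ?M. 0 \<le> B" using fB by eventually_elim (use norm_ge_zero order_trans in blast)
    then have B: "0 \<le> B" by simp
    \<comment> \<open>The approximation is stated on the whole space, so f is extended by zero; on
      the orthant nothing changes.\<close>
    define f' where "f' = (\<lambda>x. if x \<in> pos_orthant then f x else 0)"
    have "f' \<in> borel_measurable borel"
      using f unfolding measurable_laguerre_measure orthant_measure_def f'_def
      by (subst (asm) measurable_restrict_space_iff[where c = 0]) auto
    from bounded_measurable_approx_continuous[OF this B] obtain \<phi> where
      \<phi>: "\<And>n. continuous_on UNIV (\<phi> n)" "\<And>n x. norm (\<phi> n x) \<le> B"
      "AE x in lborel. norm (f' x) \<le> B \<longrightarrow> (\<lambda>n. \<phi> n x) \<longlonglongrightarrow> f' x" by auto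
    have \<phi>m: "\<phi> n \<in> borel_measurable ?M" for n
      unfolding measurable_laguerre_measure using \<phi>(1) by (intro orthant_restrict borel_measurable_continuous_onI)
    have "AE x in orthant_measure. norm (f' x) \<le> B \<longrightarrow> (\<lambda>n. \<phi> n x) \<longlonglongrightarrow> f' x"
      unfolding orthant_measure_def by (subst AE_restrict_space_iff) (use \<phi>(3) in auto)
    then have AE\<phi>: "AE x in ?M. norm (f' x) \<le> B \<longrightarrow> (\<lambda>n. \<phi> n x) \<longlonglongrightarrow> f' x"
      by (simp add: AE_laguerre_measure_iff[OF \<alpha>])
    have approx: "(\<lambda>n. \<integral>x. norm (f x - \<phi> n x) \<partial>?M) \<longlonglongrightarrow> (\<integral>x. 0 \<partial>?M)"
    proof (rule integral_dominated_convergence[where w = "\<lambda>_. 2 * B"])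
      show "AE x in ?M. (\<lambda>n. norm (f x - \<phi> n x)) \<longlonglongrightarrow> 0"
        using AE\<phi> fB AE_space
      proof eventually_elim
        case (elim x)
        then have "(\<lambda>n. f x - \<phi> n x) \<longlonglongrightarrow> f x - f x" by (intro tendsto_intros) (simp add: f'_def)
        then show ?case by (simp add: tendsto_norm_zero)
      qed
      show "AE x in ?M. norm (norm (f x - \<phi> n x)) \<le> 2 * B" for n
        using fB
      proof eventually_elim
        case (elim x)
        then show ?case using norm_triangle_ineq4[of "f x" "\<phi> n x"] \<phi>(2)[of n x] by simp
      qed
      show "(\<lambda>x. norm (f x - \<phi> n x)) \<in> borel_measurable ?M" for n
        using f \<phi>m[of n] by measurable
    qed auto
    show "((\<lambda>s. \<integral>x. norm ((\<integral>y. laguerre_kernel \<alpha> s x y *\<^sub>R f y \<partial>?M) - f x) \<partial>?M) \<longlongrightarrow> 0) (at_right 0)"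
    proof (rule symmetric_kernel_L1_continuous[where \<phi> = \<phi> and B = B])
      show "(\<lambda>(x, y). laguerre_kernel \<alpha> s x y) \<in> borel_measurable (?M \<Otimes>\<^sub>M ?M)" for s
      proof -
        have "(\<lambda>p. (\<lambda>(t, x, y). laguerre_kernel \<alpha> t x y) (s, p)) \<in> borel_measurable (?M \<Otimes>\<^sub>M ?M)"
          by (rule measurable_compose[OF _ laguerre_kernel_measurable]) simp
        then show ?thesis by (simp add: split_beta')
      qed
    qed (use f fB \<phi> \<phi>m approx laguerre_kernel_nonneg[OF \<alpha>] laguerre_kernel_mass[OF \<alpha>]
        laguerre_kernel_concentrates[OF \<alpha> _ \<phi>(1,2)] in \<open>auto intro: laguerre_kernel_sym\<close>)
  qed (use laguerre_kernel_nonneg[OF \<alpha>] laguerre_kernel_mass[OF \<alpha>] laguerre_kernel_semigroup[OF \<alpha>] in auto)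
qed

section \<open>Lipschitz spaces\<close>

lemma (in density_semigroup) D_scaleR: "D m t (\<lambda>y. \<kappa> *\<^sub>R f y) x = \<kappa> *\<^sub>R D m t f x"
proof -
  have "T s (\<lambda>y. \<kappa> *\<^sub>R f y) x = \<kappa> *\<^sub>R T s f x" for s
    unfolding T_def by (subst scaleR_left_commute) (rule integral_scaleR_right)
  then show ?thesis
    unfolding D_def by (simp only:) (subst scaleR_left_commute, rule integral_scaleR_right)
qed

lemma Linf_norm_leD:
  assumes "Linf_norm f \<le> ereal B"
  shows "AE x in orthant_measure. norm (f x) \<le> B"
  using esssup_AE[where M = orthant_measure and f = "\<lambda>x. ereal (norm (f x))"]
proof eventually_elim
  case (elim x)
  then have "ereal (norm (f x)) \<le> ereal B"
    using assms unfolding Linf_norm_def by (rule order_trans)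
  then show ?case by simp
qed

lemma Linf_norm_leI:
  assumes "f \<in> borel_measurable orthant_measure" "AE x in orthant_measure. norm (f x) \<le> B"
  shows "Linf_norm f \<le> ereal B"
  unfolding Linf_norm_def using assms by (intro esssup_I) auto

lemma least_above: "b < real (least_above b)"
  unfolding least_above_def using reals_Archimedean2[of b] by (rule LeastI_ex)

text \<open>Transfers the abstract estimates to the Lipschitz spaces: lengths of
  \<open>Linf_norm\<close> are converted to real bounds, the derivatives to the explicit
  \<open>L.D\<close>, and the normalising constant to a fixed scalar.\<close>

lemma Lip_frac_power:
  fixes \<alpha> :: "real ^ 'd" and c :: "real \<Rightarrow> real"
  assumes \<alpha>: "\<And>i. - 1 < \<alpha> $ i" and lam: "0 < lam" "lam < \<beta>"
    and cm: "c \<in> borel_measurable borel"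
    and c: "\<And>s. 0 < s \<Longrightarrow> 0 \<le> c s" "\<And>s. 0 < s \<Longrightarrow> c s \<le> 1" "\<And>s. 0 < s \<Longrightarrow> 1 - c s \<le> s"
  defines "Qs \<equiv> \<lambda>s f x. c s *\<^sub>R poisson_laguerre \<alpha> s f x"
  shows "Lip \<alpha> \<beta> \<subseteq> frac_power_dom Qs lam \<and> Lip_bounded \<alpha> \<beta> (\<beta> - lam) (frac_power Qs lam)"
proof -
  let ?M = "laguerre_measure \<alpha>"
  let ?k = "least_above lam" and ?n = "least_above \<beta>" and ?n' = "least_above (\<beta> - lam)"
  interpret L: density_semigroup ?M "laguerre_kernel \<alpha>"
    by (rule laguerre_density_semigroup[OF \<alpha>])
  interpret L: fractional_power ?M "laguerre_kernel \<alpha>" c ?k lam \<beta> ?n ?n'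
    by unfold_locales (use lam cm c least_above in auto)
  have P: "poisson_laguerre \<alpha> = L.P"
    by (intro ext) (simp add: poisson_laguerre_def L.P_def integral_half_line sub_kernel_def L.T_def laguerre_semigroup_def)
  have Q: "(\<lambda>g y. Qs s g y - g y) = L.Q s" for s
    by (intro ext) (simp add: Qs_def L.Q_def P)
  have meas: "f \<in> borel_measurable ?M \<longleftrightarrow> f \<in> borel_measurable orthant_measure" for f :: "real ^ 'd \<Rightarrow> complex"
    by (simp add: measurable_laguerre_measure)
  note AE_M = AE_laguerre_measure_iff[OF \<alpha>]
  have nonneg: "0 \<le> B" if "Linf_norm f \<le> ereal B" for f :: "real ^ 'd \<Rightarrow> complex" and B
  proof -
    have "AE x in ?M. norm (f x) \<le> B" using Linf_norm_leD[OF that] by (simp add: AE_M)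
    then have "AE x in ?M. 0 \<le> B" by eventually_elim (use norm_ge_zero order_trans in blast)
    then show ?thesis by simp
  qed
  \<comment> \<open>The value minus infinity is excluded because it would make - 1 an a.e. bound for
    a norm.\<close>
  have finite_norm: "Linf_norm f = ereal (real_of_ereal (Linf_norm f))" if "Linf_norm f < \<infinity>" for f :: "real ^ 'd \<Rightarrow> complex"
  proof (cases "Linf_norm f")
    case MInf
    then show ?thesis using nonneg[of f "- 1"] by simp
  qed (use that in auto)
  have deriv: "poisson_deriv \<alpha> m t f x = L.D m t f x" if "L.essbdd B f" "0 < t" "x \<in> pos_orthant" for f m t x B
    unfolding poisson_deriv_def P using L.funpow_vector_derivative_P[OF that(1,2)] that(3) by simp
  \<comment> \<open>Any admissible Lipschitz constant may serve as A; nonnegativity comes from the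
    condition at t = 1.\<close>
  have lip_bound: "L.lip_bound ?n \<beta> A (real_of_ereal (Linf_norm f)) f"
    if f: "f \<in> Lip \<alpha> \<beta>" and A: "A \<in> Lip_constants \<alpha> \<beta> f" for f A
  proof -
    have fm: "f \<in> borel_measurable orthant_measure" and fin: "Linf_norm f < \<infinity>" using f by (auto simp: Lip_def Linf_def)
    have "AE x in orthant_measure. norm (f x) \<le> real_of_ereal (Linf_norm f)"
      using finite_norm[OF fin] by (intro Linf_norm_leD) simp
    with fm have e: "L.essbdd (real_of_ereal (Linf_norm f)) f" by (simp add: L.essbdd_def meas AE_M)
    have d: "Linf_norm (poisson_deriv \<alpha> ?n t f) \<le> ereal (A * t powr (- real ?n + \<beta>))" if "0 < t" for t
      using A that by (auto simp: Lip_constants_def)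
    have "0 \<le> A" using nonneg[OF d[of 1]] by simp
    moreover have "AE x in ?M. norm (L.D ?n t f x) \<le> A * t powr (\<beta> - real ?n)" if t: "0 < t" for t
    proof -
      have "AE x in ?M. norm (poisson_deriv \<alpha> ?n t f x) \<le> A * t powr (- real ?n + \<beta>)"
        using Linf_norm_leD[OF d[OF t]] by (simp add: AE_M)
      then show ?thesis using AE_space
        by eventually_elim (simp add: deriv[OF e t])
    qed
    ultimately show ?thesis using e by (simp add: L.lip_bound_def)
  qed
  obtain C where C: "0 \<le> C"
    "\<And>f A B. L.lip_bound ?n \<beta> A B f \<Longrightarrow>
       AE x in ?M. integrable half_line (\<lambda>s. s powr (- lam - 1) *\<^sub>R (L.Q s ^^ ?k) f x)"
    "\<And>f A B. L.lip_bound ?n \<beta> A B f \<Longrightarrow> L.essbdd (C * (A + B)) (L.S f)"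
    "\<And>f A B x t. L.lip_bound ?n \<beta> A B f \<Longrightarrow> x \<in> space ?M \<Longrightarrow> 0 < t \<Longrightarrow>
       norm (L.D ?n' t (L.S f) x) \<le> C * (A + B) * t powr (\<beta> - lam - real ?n')"
    by (rule L.frac_main, rule that) (assumption | blast)+
  \<comment> \<open>The normalising factor only rescales S f, so its absolute value multiplies all
    bounds.\<close>
  define \<kappa> where "\<kappa> = 1 / frac_const lam ?k"
  have S: "frac_power Qs lam f = (\<lambda>x. \<kappa> *\<^sub>R L.S f x)" for f
    by (rule ext) (simp add: frac_power_def L.S_def integral_half_line frac_integrand_def Q \<kappa>_def)
  have S_bound: "Linf_norm (frac_power Qs lam f) \<le> ereal (\<bar>\<kappa>\<bar> * C * (A + real_of_ereal (Linf_norm f)))"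
    "frac_power Qs lam f \<in> borel_measurable orthant_measure"
    "\<bar>\<kappa>\<bar> * C * (A + real_of_ereal (Linf_norm f)) \<in> Lip_constants \<alpha> (\<beta> - lam) (frac_power Qs lam f)"
    if f: "f \<in> Lip \<alpha> \<beta>" and A: "A \<in> Lip_constants \<alpha> \<beta> f" for f A
  proof -
    note lb = lip_bound[OF f A]
    let ?B = "real_of_ereal (Linf_norm f)"
    have Sb: "L.essbdd (C * (A + ?B)) (L.S f)" by (rule C(3)[OF lb])
    then have Sm: "L.S f \<in> borel_measurable ?M" and SAE: "AE x in ?M. norm (L.S f x) \<le> C * (A + ?B)"
      by (auto simp: L.essbdd_def)
    have KS: "L.essbdd (\<bar>\<kappa>\<bar> * C * (A + ?B)) (\<lambda>x. \<kappa> *\<^sub>R L.S f x)"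
      unfolding L.essbdd_def
    proof
      show "(\<lambda>x. \<kappa> *\<^sub>R L.S f x) \<in> borel_measurable ?M" using Sm by measurable
      show "AE x in ?M. norm (\<kappa> *\<^sub>R L.S f x) \<le> \<bar>\<kappa>\<bar> * C * (A + ?B)"
        using SAE by eventually_elim (auto simp: mult.assoc intro!: mult_left_mono)
    qed
    then show "frac_power Qs lam f \<in> borel_measurable orthant_measure"
      unfolding S meas[symmetric] by (rule L.essbdd_measurable)
    then show "Linf_norm (frac_power Qs lam f) \<le> ereal (\<bar>\<kappa>\<bar> * C * (A + ?B))"
      using KS unfolding S by (intro Linf_norm_leI) (auto simp: L.essbdd_def AE_M)
    have "Linf_norm (poisson_deriv \<alpha> ?n' t (\<lambda>x. \<kappa> *\<^sub>R L.S f x)) \<le>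
        ereal (\<bar>\<kappa>\<bar> * C * (A + ?B) * t powr (- real ?n' + (\<beta> - lam)))" if t: "0 < t" for t
    proof (rule Linf_norm_leI)
      have eq: "poisson_deriv \<alpha> ?n' t (\<lambda>x. \<kappa> *\<^sub>R L.S f x) x = \<kappa> *\<^sub>R L.D ?n' t (L.S f) x" if "x \<in> pos_orthant" for x
        using deriv[OF KS t that] L.D_scaleR by simp
      have "L.D ?n' t (L.S f) \<in> borel_measurable ?M"
        by (rule L.essbdd_measurable[OF L.essbdd_D[OF Sb t]])
      then have "(\<lambda>x. \<kappa> *\<^sub>R L.D ?n' t (L.S f) x) \<in> borel_measurable orthant_measure"
        unfolding meas by measurable
      then show "poisson_deriv \<alpha> ?n' t (\<lambda>x. \<kappa> *\<^sub>R L.S f x) \<in> borel_measurable orthant_measure"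
        by (subst measurable_cong[OF eq]) simp_all
      show "AE x in orthant_measure. norm (poisson_deriv \<alpha> ?n' t (\<lambda>x. \<kappa> *\<^sub>R L.S f x) x) \<le>
          \<bar>\<kappa>\<bar> * C * (A + ?B) * t powr (- real ?n' + (\<beta> - lam))"
      proof (rule AE_I2)
        fix x :: "real ^ 'd" assume x: "x \<in> space orthant_measure"
        have "\<bar>\<kappa>\<bar> * norm (L.D ?n' t (L.S f) x) \<le> \<bar>\<kappa>\<bar> * (C * (A + ?B) * t powr (\<beta> - lam - real ?n'))"
          using C(4)[OF lb _ t, of x] x by (intro mult_left_mono) auto
        then show "norm (poisson_deriv \<alpha> ?n' t (\<lambda>x. \<kappa> *\<^sub>R L.S f x) x) \<le>
            \<bar>\<kappa>\<bar> * C * (A + ?B) * t powr (- real ?n' + (\<beta> - lam))"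
          using eq[of x] x by (simp add: mult.assoc)
      qed
    qed
    then show "\<bar>\<kappa>\<bar> * C * (A + ?B) \<in> Lip_constants \<alpha> (\<beta> - lam) (frac_power Qs lam f)"
      by (simp add: Lip_constants_def S)
  qed
  have "Lip \<alpha> \<beta> \<subseteq> frac_power_dom Qs lam"
  proof
    fix f assume f: "f \<in> Lip \<alpha> \<beta>"
    then obtain A where A: "A \<in> Lip_constants \<alpha> \<beta> f" by (auto simp: Lip_def)
    have "frac_integrand Qs lam f x = (\<lambda>s. s powr (- lam - 1) *\<^sub>R (L.Q s ^^ ?k) f x)" for x
      by (rule ext) (simp add: frac_integrand_def Q)
    then show "f \<in> frac_power_dom Qs lam"
      using C(2)[OF lip_bound[OF f A]] by (simp add: frac_power_dom_def integrable_half_line AE_M)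
  qed
  moreover have "Lip_bounded \<alpha> \<beta> (\<beta> - lam) (frac_power Qs lam)"
    unfolding Lip_bounded_def
  \<comment> \<open>The factor 2 accounts for the two parts of the norm, each bounded by |kappa| C
    (A + B); adding 1 makes the constant positive for the divisions below.\<close>
  proof (intro exI[of _ "2 * \<bar>\<kappa>\<bar> * C + 1"] ballI conjI)
    fix f assume f: "f \<in> Lip \<alpha> \<beta>"
    then obtain A0 where A0: "A0 \<in> Lip_constants \<alpha> \<beta> f" by (auto simp: Lip_def)
    let ?F = "frac_power Qs lam f" and ?B = "real_of_ereal (Linf_norm f)" and ?K = "2 * \<bar>\<kappa>\<bar> * C + 1"
    have Ffin: "Linf_norm ?F < \<infinity>" using S_bound(1)[OF f A0] by (auto simp: less_top[symmetric] top_ereal_def)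
    show "?F \<in> Lip \<alpha> (\<beta> - lam)"
      using S_bound[OF f A0] Ffin by (auto simp: Lip_def Linf_def)
    have K: "0 < ?K" using C(1) by (simp add: add_nonneg_pos)
    \<comment> \<open>At t = 1 the power of t is 1, so every admissible constant is nonnegative; the
      infimum in the norm is then a genuine lower bound.\<close>
    have bdd: "bdd_below (Lip_constants \<alpha> (\<beta> - lam) ?F)"
    proof (rule bdd_belowI)
      fix A assume "A \<in> Lip_constants \<alpha> (\<beta> - lam) ?F"
      then have "Linf_norm (poisson_deriv \<alpha> ?n' 1 ?F) \<le> ereal (A * 1 powr (- real ?n' + (\<beta> - lam)))"
        unfolding Lip_constants_def using zero_less_one by blast
      from nonneg[OF this] show "0 \<le> A" by simp
    qed
    have le: "Lip_norm \<alpha> (\<beta> - lam) ?F \<le> ?K * (?B + A)" if A: "A \<in> Lip_constants \<alpha> \<beta> f" for A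
    proof -
      have "real_of_ereal (Linf_norm ?F) \<le> \<bar>\<kappa>\<bar> * C * (A + ?B)"
        using S_bound(1)[OF f A] finite_norm[OF Ffin] by (metis ereal_less_eq(3))
      moreover have "Inf (Lip_constants \<alpha> (\<beta> - lam) ?F) \<le> \<bar>\<kappa>\<bar> * C * (A + ?B)"
        by (rule cInf_lower[OF S_bound(3)[OF f A] bdd])
      moreover have "0 \<le> A + ?B"
        using lip_bound[OF f A] L.essbdd_nonneg[of ?B f] by (auto simp: L.lip_bound_def)
      ultimately show ?thesis unfolding Lip_norm_def by (simp add: algebra_simps)
    qed
    \<comment> \<open>The estimate holds for every admissible A. Solved for A it is a lower bound of
      the set of constants, so it passes to the infimum.\<close>
    have "Lip_norm \<alpha> (\<beta> - lam) ?F / ?K - ?B \<le> Inf (Lip_constants \<alpha> \<beta> f)"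
    proof (rule cInf_greatest)
      show "Lip_constants \<alpha> \<beta> f \<noteq> {}" using A0 by auto
      fix A assume "A \<in> Lip_constants \<alpha> \<beta> f"
      then show "Lip_norm \<alpha> (\<beta> - lam) ?F / ?K - ?B \<le> A"
        using le[of A] K by (simp add: pos_divide_le_eq diff_le_eq mult.commute add.commute)
    qed
    then have "Lip_norm \<alpha> (\<beta> - lam) ?F / ?K \<le> Lip_norm \<alpha> \<beta> f" by (simp add: Lip_norm_def)
    then show "Lip_norm \<alpha> (\<beta> - lam) ?F \<le> ?K * Lip_norm \<alpha> \<beta> f"
      using K by (simp add: pos_divide_le_eq mult.commute)
  qed
  ultimately show ?thesis by simp
qed

theorem theorem4p4:
  fixes \<alpha> :: "real ^ 'd" and lam \<beta> :: real
  assumes "\<And>i. - 1 / 2 < \<alpha> $ i"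
    and "1 \<le> lam" and "lam < \<beta>"
  shows "(Lip \<alpha> \<beta> \<subseteq> frac_power_dom (poisson_laguerre \<alpha>) lam
            \<and> Lip_bounded \<alpha> \<beta> (\<beta> - lam) (laguerre_frac_deriv \<alpha> lam))
       \<and> (Lip \<alpha> \<beta> \<subseteq> frac_power_dom (bessel_poisson_laguerre \<alpha>) lam
            \<and> Lip_bounded \<alpha> \<beta> (\<beta> - lam) (bessel_laguerre_frac_deriv \<alpha> lam))"
proof -
  have \<alpha>: "- 1 < \<alpha> $ i" for i using assms(1)[of i] by simp
  have lam: "0 < lam" using assms(2) by simp
  have "(\<lambda>s f x. 1 *\<^sub>R poisson_laguerre \<alpha> s f x) = poisson_laguerre \<alpha>" by (intro ext) simp
  moreover have "(\<lambda>s f x. exp (- s) *\<^sub>R poisson_laguerre \<alpha> s f x) = bessel_poisson_laguerre \<alpha>"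
    by (intro ext) (simp add: bessel_poisson_laguerre_def)
  \<comment> \<open>This is the third condition on the weight for the Bessel family,
    \<open>c s = exp (- s)\<close>; for the constant weight 1 it reads 0 <= s.\<close>
  moreover have "1 - exp (- s) \<le> s" for s :: real using exp_ge_add_one_self[of "- s"] by simp
  ultimately show ?thesis
    using Lip_frac_power[OF \<alpha> lam assms(3), of "\<lambda>_. 1"]
      Lip_frac_power[OF \<alpha> lam assms(3), of "\<lambda>s. exp (- s)"]
    unfolding laguerre_frac_deriv_def bessel_laguerre_frac_deriv_def by simp
qed

end
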